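(* Let $\widehat{\mathcal{A}}_\infty$ be a UHF algebra with canonical masa $\widehat{\mathcal{D}}_\infty$, and let $\widehat{\mathcal{S}}_\infty\subseteq\widehat{\mathcal{A}}_\infty$ be a concrete operator $\widehat{\mathcal{D}}_\infty$-system. Then the C*-envelope of $\widehat{\mathcal{S}}_\infty$ coincides with the C*-subalgebra of $\widehat{\mathcal{A}}_\infty$ generated by $\widehat{\mathcal{S}}_\infty$.
   Context: UHF setting: $(n_k)_{k\in\mathbb{N}}$ are positive integers with $n_k\mid n_{k+1}$, $l_k=n_{k+1}/n_k$, $e^k_{i,j}$ ($1\le i,j\le n_k$) are the canonical matrix units of $M_{n_k}(\mathbb{C})$, and $\pi_k:M_{n_k}\to M_{n_{k+1}}$ is the unital $*$-homomorphism with $\pi_k(e^k_{i,j})=\sum_{r=0}^{l_k-1}e^{k+1}_{rn_k+i,\,rn_k+j}$. The UHF algebra is the C*-algebra inductive limit $\widehat{\mathcal{A}}_\infty=\varinjlim_{\mathbf{C}^*}(M_{n_k},\pi_k)$; $\mathcal{A}_k\cong M_{n_k}$ denotes the image of $M_{n_k}$ in it, $\mathcal{D}_k\subseteq\mathcal{A}_k$ the diagonal matrices, and the canonical masa is $\widehat{\mathcal{D}}_\infty=\overline{\bigcup_k\mathcal{D}_k}=\varinjlim_{\mathbf{C}^*}\mathcal{D}_k$. A concrete operator $\widehat{\mathcal{D}}_\infty$-system is a norm-closed selfadjoint subspace $\widehat{\mathcal{S}}_\infty\subseteq\widehat{\mathcal{A}}_\infty$ with $\widehat{\mathcal{D}}_\infty\subseteq\widehat{\mathcal{S}}_\infty$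 and $\widehat{\mathcal{D}}_\infty\widehat{\mathcal{S}}_\infty\widehat{\mathcal{D}}_\infty\subseteq\widehat{\mathcal{S}}_\infty$ (with the operator system structure inherited from $\widehat{\mathcal{A}}_\infty$). A C*-cover of an operator system $\mathcal{S}$ is a pair $(\mathcal{A},\nu)$ with $\mathcal{A}$ a unital C*-algebra and $\nu:\mathcal{S}\to\mathcal{A}$ a unital completely isometric map whose image generates $\mathcal{A}$. The C*-envelope is the (unique up to isomorphism) C*-cover $(C_e^*(\mathcal{S}),\kappa)$ such that for every C*-cover $(\mathcal{A},\phi)$ there is a $*$-homomorphism $\widetilde\phi:\mathcal{A}\to C_e^*(\mathcal{S})$ with $\widetilde\phi\circ\phi=\kappa$. The claim means that the C*-algebra generated by $\widehat{\mathcal{S}}_\infty$, with the inclusion map, is the C*-envelope. *)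

theory Defs
  imports "HOL-Analysis.Analysis" "Jordan_Normal_Form.Matrix"
begin

section \<open>Unital C*-algebras\<close>

class scaleC =
  fixes scaleC :: "complex \<Rightarrow> 'a \<Rightarrow> 'a"  (infixr \<open>*\<^sub>C\<close> 75)

class star =
  fixes star :: "'a \<Rightarrow> 'a"

text \<open>
  The superclass \<^class>\<open>real_normed_algebra_1\<close> includes \<open>norm 1 = 1\<close>, so the zero algebra is excluded.
  This loses nothing below: an algebra that receives a unital isometric map from an algebra with
  \<open>1 \<noteq> 0\<close> is itself nonzero.
\<close>

class unital_cstar_algebra = banach + real_normed_algebra_1 + scaleC + star +
  assumes scaleC_add_right: "c *\<^sub>C (x + y) = c *\<^sub>C x + c *\<^sub>C y"
    and scaleC_add_left: "(c + d) *\<^sub>C x = c *\<^sub>C x + d *\<^sub>C x"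
    and scaleC_scaleC: "c *\<^sub>C (d *\<^sub>C x) = (c * d) *\<^sub>C x"
    and scaleR_scaleC: "r *\<^sub>R x = complex_of_real r *\<^sub>C x"
    and mult_scaleC_left: "(c *\<^sub>C x) * y = c *\<^sub>C (x * y)"
    and mult_scaleC_right: "x * (c *\<^sub>C y) = c *\<^sub>C (x * y)"
    and norm_scaleC: "norm (c *\<^sub>C x) = cmod c * norm x"
    and star_star: "star (star x) = x"
    and star_add: "star (x + y) = star x + star y"
    and star_scaleC: "star (c *\<^sub>C x) = cnj c *\<^sub>C star x"
    and star_mult: "star (x * y) = star y * star x"
    and norm_star_mult: "norm (star x * x) = (norm x)\<^sup>2"

definition csubspace :: "'a::unital_cstar_algebra set \<Rightarrow> bool" where
  "csubspace V \<longleftrightarrow> 0 \<in> V \<and> (\<forall>x\<in>V. \<forall>y\<in>V. x + y \<in> V) \<and> (\<forall>c. \<forall>x\<in>V. c *\<^sub>C x \<in> V)"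

definition cstar_subalgebra :: "'a::unital_cstar_algebra set \<Rightarrow> bool" where
  "cstar_subalgebra B \<longleftrightarrow>
     csubspace B \<and> closed B \<and> (\<forall>x\<in>B. \<forall>y\<in>B. x * y \<in> B) \<and> (\<forall>x\<in>B. star x \<in> B)"

definition cstar_generated :: "'a::unital_cstar_algebra set \<Rightarrow> 'a set" where
  "cstar_generated X = \<Inter>{B. cstar_subalgebra B \<and> X \<subseteq> B}"

definition clinear_on ::
    "'a::unital_cstar_algebra set \<Rightarrow> ('a \<Rightarrow> 'b::unital_cstar_algebra) \<Rightarrow> bool" where
  "clinear_on V f \<longleftrightarrow>
     (\<forall>x\<in>V. \<forall>y\<in>V. f (x + y) = f x + f y) \<and> (\<forall>c. \<forall>x\<in>V. f (c *\<^sub>C x) = c *\<^sub>C f x)"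

definition star_homomorphism ::
    "'a::unital_cstar_algebra set \<Rightarrow> 'b::unital_cstar_algebra set \<Rightarrow> ('a \<Rightarrow> 'b) \<Rightarrow> bool" where
  "star_homomorphism A B f \<longleftrightarrow>
     (\<forall>x\<in>A. f x \<in> B) \<and> clinear_on A f \<and>
     (\<forall>x\<in>A. \<forall>y\<in>A. f (x * y) = f x * f y) \<and> (\<forall>x\<in>A. f (star x) = star (f x))"


section \<open>Matrix norms and completely isometric maps\<close>

text \<open>
  The C*-norm of \<open>M\<^sub>m(A)\<close>: the operator norm of a matrix acting by left multiplication on the
  Hilbert \<open>A\<close>-module \<open>A\<^sup>m\<close>, whose norm is \<open>\<parallel>v\<parallel> = \<parallel>\<Sum>\<^sub>i v\<^sub>i\<^sup>* v\<^sub>i\<parallel>\<^bsup>1/2\<^esup>\<close>.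
\<close>

definition column_norm :: "'a::unital_cstar_algebra vec \<Rightarrow> real" where
  "column_norm v = sqrt (norm (\<Sum>i<dim_vec v. star (vec_index v i) * vec_index v i))"

definition matrix_norm :: "'a::unital_cstar_algebra mat \<Rightarrow> real" where
  "matrix_norm X =
     (SUP v \<in> {v \<in> carrier_vec (dim_col X). column_norm v \<le> 1}. column_norm (mult_mat_vec X v))"

definition completely_isometric_on ::
    "'a::unital_cstar_algebra set \<Rightarrow> ('a \<Rightarrow> 'b::unital_cstar_algebra) \<Rightarrow> bool" where
  "completely_isometric_on S f \<longleftrightarrow>
     (\<forall>m. \<forall>X \<in> carrier_mat m m. elements_mat X \<subseteq> S \<longrightarrow> matrix_norm (map_mat f X) = matrix_norm X)"


section \<open>C*-covers and the C*-envelope\<close>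

text \<open>
  An operator system is given concretely, as a subspace \<open>S\<close> of a unital C*-algebra, with the matrix
  norms inherited from it.  A unital C*-algebra is given as a C*-subalgebra \<open>B\<close> with \<open>1 \<in> B\<close> of a
  type of class \<^class>\<open>unital_cstar_algebra\<close>; the case \<open>B = UNIV\<close> is included.
\<close>

definition cstar_cover ::
    "'a::unital_cstar_algebra set \<Rightarrow> 'b::unital_cstar_algebra set \<Rightarrow> ('a \<Rightarrow> 'b) \<Rightarrow> bool" where
  "cstar_cover S B \<phi> \<longleftrightarrow>
     cstar_subalgebra B \<and> 1 \<in> B \<and>
     (\<forall>s\<in>S. \<phi> s \<in> B) \<and> clinear_on S \<phi> \<and> \<phi> 1 = 1 \<and> completely_isometric_on S \<phi> \<and>
     cstar_generated (\<phi> ` S) = B"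

text \<open>
  The universal property quantifies over all C*-covers.  HOL cannot quantify over types inside a
  formula, so the type in which the competing covers live is a parameter; a theorem about
  \<open>cstar_envelope TYPE('c)\<close> with a free type variable \<open>'c\<close> covers all of them.
\<close>

definition cstar_envelope ::
    "'c::unital_cstar_algebra itself \<Rightarrow> 'a::unital_cstar_algebra set \<Rightarrow>
     'b::unital_cstar_algebra set \<Rightarrow> ('a \<Rightarrow> 'b) \<Rightarrow> bool" where
  "cstar_envelope _ S E \<kappa> \<longleftrightarrow>
     cstar_cover S E \<kappa> \<and>
     (\<forall>(B :: 'c set) \<phi>. cstar_cover S B \<phi> \<longrightarrow>
        (\<exists>\<pi>. star_homomorphism B E \<pi> \<and> (\<forall>s\<in>S. \<pi> (\<phi> s) = \<kappa> s)))"


section \<open>UHF algebras and their canonical masas\<close>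

definition mat_star :: "complex mat \<Rightarrow> complex mat" where
  "mat_star x = map_mat cnj (transpose_mat x)"

text \<open>
  The connecting map \<open>M\<^bsub>n k\<^esub> \<rightarrow> M\<^bsub>n (k+1)\<^esub>\<close> repeats its argument along the diagonal
  \<open>n (k+1) / n k\<close> times.  Indices start at \<open>0\<close>.
\<close>

definition uhf_connect :: "(nat \<Rightarrow> nat) \<Rightarrow> nat \<Rightarrow> complex mat \<Rightarrow> complex mat" where
  "uhf_connect n k x =
     mat (n (Suc k)) (n (Suc k))
       (\<lambda>(p, q). if p div n k = q div n k then x $$ (p mod n k, q mod n k) else 0)"

definition matrix_unit :: "nat \<Rightarrow> nat \<Rightarrow> nat \<Rightarrow> complex mat" where
  "matrix_unit N i j = mat N N (\<lambda>(p, q). if p = i \<and> q = j then 1 else 0)"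

lemma uhf_connect_matrix_unit:
  assumes "n k dvd n (Suc k)" "i < n k" "j < n k" "p < n (Suc k)" "q < n (Suc k)"
  shows "uhf_connect n k (matrix_unit (n k) i j) $$ (p, q) =
    (\<Sum>r < n (Suc k) div n k. matrix_unit (n (Suc k)) (r * n k + i) (r * n k + j) $$ (p, q))"
proof -
  let ?N = "n k" and ?l = "n (Suc k) div n k"
  have N: "?N > 0" using assms by linarith
  have pl: "p div ?N < ?l"
    using assms N by (metis dvd_div_mult_self less_mult_imp_div_less)
  have eq: "p = r * ?N + i \<longleftrightarrow> p div ?N = r \<and> p mod ?N = i"
           "q = r * ?N + j \<longleftrightarrow> q div ?N = r \<and> q mod ?N = j" for r
    using assms(2,3) N by auto
  have "(\<Sum>r < ?l. matrix_unit (n (Suc k)) (r * ?N + i) (r * ?N + j) $$ (p, q)) =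
    (\<Sum>r < ?l. if r = p div ?N
       then (if q div ?N = p div ?N \<and> p mod ?N = i \<and> q mod ?N = j then 1 else 0) else 0)"
    unfolding matrix_unit_def using assms(4,5) by (intro sum.cong refl) (auto simp: eq)
  also have "\<dots> = (if q div ?N = p div ?N \<and> p mod ?N = i \<and> q mod ?N = j then 1 else 0)"
    using pl by (subst sum.delta) auto
  also have "\<dots> = uhf_connect n k (matrix_unit ?N i j) $$ (p, q)"
    unfolding uhf_connect_def matrix_unit_def using assms(4,5) N by auto
  finally show ?thesis by simp
qed

definition unital_matrix_star_hom ::
    "nat \<Rightarrow> (complex mat \<Rightarrow> 'a::unital_cstar_algebra) \<Rightarrow> bool" where
  "unital_matrix_star_hom N f \<longleftrightarrow>
     (\<forall>x \<in> carrier_mat N N. \<forall>y \<in> carrier_mat N N. f (x + y) = f x + f y \<and> f (x * y) = f x * f y) \<and>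
     (\<forall>c. \<forall>x \<in> carrier_mat N N. f (c \<cdot>\<^sub>m x) = c *\<^sub>C f x) \<and>
     (\<forall>x \<in> carrier_mat N N. f (mat_star x) = star (f x)) \<and>
     f (1\<^sub>m N) = 1"

text \<open>
  \<open>uhf_algebra n \<iota>\<close>: the ambient C*-algebra, with the canonical maps \<open>\<iota> k\<close> of \<open>M\<^bsub>n k\<^esub>\<close> into it, is
  the C*-inductive limit of the system above.  As the connecting maps are injective, that limit is
  the completion of the increasing union of the matrix algebras; the norm on the union need not be
  prescribed, since an injective *-homomorphism out of \<open>M\<^bsub>n k\<^esub>\<close> is isometric.
\<close>

definition uhf_algebra ::
    "(nat \<Rightarrow> nat) \<Rightarrow> (nat \<Rightarrow> complex mat \<Rightarrow> 'a::unital_cstar_algebra) \<Rightarrow> bool" where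
  "uhf_algebra n \<iota> \<longleftrightarrow>
     (\<forall>k. 0 < n k \<and> n k dvd n (Suc k)) \<and>
     (\<forall>k. unital_matrix_star_hom (n k) (\<iota> k) \<and> inj_on (\<iota> k) (carrier_mat (n k) (n k))) \<and>
     (\<forall>k. \<forall>x \<in> carrier_mat (n k) (n k). \<iota> (Suc k) (uhf_connect n k x) = \<iota> k x) \<and>
     closure (\<Union>k. \<iota> k ` carrier_mat (n k) (n k)) = UNIV"

definition canonical_masa ::
    "(nat \<Rightarrow> nat) \<Rightarrow> (nat \<Rightarrow> complex mat \<Rightarrow> 'a::unital_cstar_algebra) \<Rightarrow> 'a set" where
  "canonical_masa n \<iota> = closure (\<Union>k. \<iota> k ` {d \<in> carrier_mat (n k) (n k). diagonal_mat d})"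

definition concrete_operator_system_over ::
    "'a::unital_cstar_algebra set \<Rightarrow> 'a set \<Rightarrow> bool" where
  "concrete_operator_system_over D S \<longleftrightarrow>
     csubspace S \<and> closed S \<and> (\<forall>s\<in>S. star s \<in> S) \<and> D \<subseteq> S \<and>
     (\<forall>d\<in>D. \<forall>s\<in>S. \<forall>d'\<in>D. d * s * d' \<in> S)"

end

(*
  Let phi : S -> B be a C*-cover.  Thresholding the matrix entries of approximants shows that S is the
  closed span of the matrix units it contains, hence of unitaries u which lie in S and in one of the
  finite-dimensional algebras A_k.  If M_n = A_k with n = n_k, then conj(u) (x) u fixes the maximally
  entangled vector of C^n (x) C^n.  Complete isometry makes X_u = conj(u) (x) phi(u) a contraction of
  M_n(B), so X_u should fix the corresponding vector in a GNS representation of M_n(B); no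
  representation is needed, because the vector functional is seen directly to stay contractive modulo
  the left ideal generated by all X_u - 1.  Modulo this ideal 1 (x) phi(u) equals the scalar matrix u^T,
  so every word in the elements phi(u) dominates in norm the normalized trace of the same word in the
  elements u.  Passing to high powers turns the trace into the norm, the assignment phi(u) -> u extends
  to a contractive *-homomorphism, and continuity extends it to B.
*)

theory Submission
  imports Defs
begin

section \<open>Positivity in unital C*-algebras\<close>

text \<open>The hypothesis on phi concerns linear combinations of elements of S only: nothing is
  known about a product phi(u) phi(u'), and phi(u) is not known to be unitary. The factor conj(u)
  removes this obstacle. It turns unitarity of u into a vector fixed by all conj(u) (x) u at once,
  and the relations expressing this can be multiplied. The transpose reverses the order of factors,
  and a left ideal tolerates exactly that: in b b' the right factor is replaced by a scalar matrix,
  which commutes past b and so leaves b on the right, ready to be replaced in turn.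

  Contractivity modulo the ideal survives because the cost is of second order. Adding a large
  multiple of X_u + 1 raises the functional by the largest possible amount, while absorbing a term Y
  (X_u - 1) costs only a difference of the form sqrt(s^2 + M^2) - s, which tends to 0.

  Comparing trace and norm in A_k loses a factor depending on k. It is constant on the words of one
  level, so it disappears within that level, and the resulting bound is uniform in k.

  Positivity is built from norm estimates and square roots, just far enough for columns over the
  algebra to behave like vectors of a Hilbert module.\<close>

lemma scaleC_one [simp]: "1 *\<^sub>C x = (x :: 'a::unital_cstar_algebra)"
  by (metis of_real_1 scaleR_one scaleR_scaleC)

interpretation scaleC: vector_space "scaleC :: complex \<Rightarrow> 'a::unital_cstar_algebra \<Rightarrow> 'a"
  by unfold_locales (simp_all add: scaleC_add_right scaleC_add_left scaleC_scaleC)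

declare mult_scaleC_left [simp] mult_scaleC_right [simp] star_star [simp] star_scaleC [simp]

lemma star_0 [simp]: "star (0 :: 'a::unital_cstar_algebra) = 0"
  by (metis add_cancel_right_right star_add)

lemma star_uminus [simp]: "star (- x) = - star (x :: 'a::unital_cstar_algebra)"
  by (metis add.right_inverse add_eq_0_iff star_0 star_add)

lemma star_diff: "star (x - y) = star x - star (y :: 'a::unital_cstar_algebra)"
  by (metis diff_conv_add_uminus star_add star_uminus)

lemma star_1 [simp]: "star (1 :: 'a::unital_cstar_algebra) = 1"
  by (metis mult.right_neutral star_mult star_star)

lemma star_scaleR [simp]: "star (r *\<^sub>R x) = r *\<^sub>R star (x :: 'a::unital_cstar_algebra)"
  by (simp add: scaleR_scaleC)

lemma star_of_real [simp]: "star (of_real r :: 'a::unital_cstar_algebra) = of_real r"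
  by (simp add: of_real_def)

lemma star_sum: "star (sum f A) = (\<Sum>i\<in>A. star (f i :: 'a::unital_cstar_algebra))"
  by (induction A rule: infinite_finite_induct) (simp_all add: star_add)

lemma star_power: "star (x ^ k) = star (x :: 'a::unital_cstar_algebra) ^ k"
  by (induction k) (simp_all add: star_mult power_commutes)

lemma norm_star [simp]: "norm (star x) = norm (x :: 'a::unital_cstar_algebra)"
proof -
  have "norm y \<le> norm (star y)" for y :: 'a
  proof (cases "y = 0")
    case False
    have "norm y * norm y \<le> norm (star y) * norm y"
      using norm_star_mult[of y] norm_mult_ineq[of "star y" y] by (simp add: power2_eq_square)
    then show ?thesis using False by simp
  qed simp
  from this[of x] this[of "star x"] show ?thesis by simp
qed

lemma bounded_linear_star: "bounded_linear (star :: 'a::unital_cstar_algebra \<Rightarrow> 'a)"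
  by (rule bounded_linear_intro[where K = 1]) (simp_all add: star_add)

lemma norm_selfadjoint_square:
  "star h = h \<Longrightarrow> norm (h * h) = (norm (h :: 'a::unital_cstar_algebra))\<^sup>2"
  by (metis norm_star_mult)

lemma commute_left: "a * b = b * a \<Longrightarrow> a * (b * c) = b * (a * (c :: 'a::semigroup_mult))"
  by (simp flip: mult.assoc)

text \<open>In spectral terms the estimate places the spectrum of the selfadjoint \<open>h\<close>
  in \<open>[0, 2 t]\<close>. In this form sums of positive elements are positive by the triangle
  inequality.\<close>

definition positive :: "'a::unital_cstar_algebra \<Rightarrow> bool" where
  "positive h \<longleftrightarrow> star h = h \<and> (\<exists>t. norm (of_real t - h) \<le> t)"

lemma positive_selfadjoint: "positive h \<Longrightarrow> star h = h"
  by (simp add: positive_def)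

lemma positive_add: "positive h \<Longrightarrow> positive k \<Longrightarrow> positive (h + k)"
  unfolding positive_def
proof (elim conjE exE, intro conjI)
  fix s t assume "norm (of_real s - h) \<le> s" "norm (of_real t - k) \<le> t"
  then have "norm ((of_real s - h) + (of_real t - k)) \<le> s + t"
    by (meson add_mono norm_triangle_le)
  then show "\<exists>t. norm (of_real t - (h + k)) \<le> t"
    by (intro exI[of _ "s + t"]) (simp add: algebra_simps)
qed (simp add: star_add)

lemma positive_scaleR: "positive h \<Longrightarrow> 0 \<le> r \<Longrightarrow> positive (r *\<^sub>R h)"
  unfolding positive_def
proof (elim conjE exE, intro conjI)
  fix t assume "norm (of_real t - h) \<le> t" "0 \<le> r"
  then have "norm (r *\<^sub>R (of_real t - h)) \<le> r * t"
    by (simp add: mult_left_mono)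
  then show "\<exists>t. norm (of_real t - (r *\<^sub>R h)) \<le> t"
    by (intro exI[of _ "r * t"]) (simp add: scaleR_diff_right of_real_def)
qed simp

lemma positive_0 [simp]: "positive 0"
  by (auto simp: positive_def intro: exI[of _ 0])

lemma positive_norm_minus: "star h = h \<Longrightarrow> positive (of_real (norm h) - h)"
  by (auto simp: positive_def star_diff intro!: exI[of _ "norm h"])

lemma positive_of_real: "positive (of_real r :: 'a::unital_cstar_algebra) \<longleftrightarrow> 0 \<le> r"
proof
  assume "positive (of_real r :: 'a)"
  then obtain t where "norm (of_real (t - r) :: 'a) \<le> t"
    unfolding positive_def by auto
  then show "0 \<le> r" by (simp only: norm_of_real)
next
  assume "0 \<le> r"
  then show "positive (of_real r :: 'a)"
    by (auto simp: positive_def intro!: exI[of _ r])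
qed

text \<open>These are the coefficients of the power series of \<open>sqrt (1 + y)\<close>. With the
  sign \<open>(-1) ^ n\<close> attached, all after the zeroth are nonpositive, so their absolute
  values are controlled by the partial sums at \<open>y = -1\<close>. The bound 1 is what makes the
  root in \<open>sqrt_near_one\<close> positive again.\<close>

lemma abs_gbinomial_half_summable: "summable (\<lambda>n. \<bar>(1/2 :: real) gchoose n\<bar>)"
  and abs_gbinomial_half_bound: "(\<Sum>n. \<bar>(1/2 :: real) gchoose Suc n\<bar>) \<le> 1"
proof -
  have sgn: "(-1) ^ n * ((-1/2 :: real) gchoose n) \<ge> 0" for n
  proof (induction n)
    case (Suc n)
    have "real (Suc n) * ((-1/2) gchoose Suc n) = (-1/2 - real n) * ((-1/2 :: real) gchoose n)"
      using gbinomial_mult_1[of "-1/2 :: real" n] by (simp add: algebra_simps)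
    then have "((-1/2) gchoose Suc n) = - ((1/2 + real n) / real (Suc n)) * ((-1/2 :: real) gchoose n)"
      by (simp add: field_simps del: of_nat_Suc)
    then have "(-1) ^ Suc n * ((-1/2 :: real) gchoose Suc n)
        = ((-1) ^ n * ((-1/2) gchoose n)) * ((1/2 + real n) / real (Suc n))"
      by simp
    then show ?case using Suc by simp
  qed simp
  have sgn2: "\<bar>(1/2 :: real) gchoose Suc n\<bar> = - ((-1) ^ Suc n * ((1/2 :: real) gchoose Suc n))" for n
  proof -
    have "((1/2 :: real) gchoose Suc n) = (1/2) / (real (Suc n)) * ((-1/2) gchoose n)"
      using gbinomial_absorption'[of "Suc n" "1/2 :: real"] by simp
    then have eq: "- ((-1) ^ Suc n * ((1/2 :: real) gchoose Suc n))
        = (1/2) / real (Suc n) * ((-1) ^ n * ((-1/2) gchoose n))"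
      by simp
    then have "- ((-1) ^ Suc n * ((1/2 :: real) gchoose Suc n)) \<ge> 0"
      using sgn[of n] by simp
    moreover have "\<bar>- ((-1) ^ Suc n * ((1/2 :: real) gchoose Suc n))\<bar> = \<bar>(1/2 :: real) gchoose Suc n\<bar>"
      by (simp add: abs_mult power_abs)
    ultimately show ?thesis by simp
  qed
  have part: "(\<Sum>k<n. \<bar>(1/2 :: real) gchoose Suc k\<bar>) \<le> 1" for n
  proof -
    \<comment> \<open>The alternating partial sums for \<open>1/2\<close> collapse to one
      coefficient for \<open>-1/2\<close>, whose sign is known.\<close>
    have "(\<Sum>k\<le>n. (-1) ^ k * ((1/2 :: real) gchoose k)) = (-1) ^ n * ((-1/2) gchoose n)"
      using gbinomial_sum_lower_neg[of "1/2 :: real" n] by (simp add: mult.commute)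
    then have "0 \<le> (\<Sum>k\<le>n. (-1) ^ k * ((1/2 :: real) gchoose k))" using sgn by simp
    also have "\<dots> = 1 - (\<Sum>k<n. \<bar>(1/2 :: real) gchoose Suc k\<bar>)"
      by (subst sum.atMost_shift) (simp add: sgn2 sum_negf del: power_Suc)
    finally show ?thesis by simp
  qed
  have *: "summable (\<lambda>n. \<bar>(1/2 :: real) gchoose Suc n\<bar>)"
    by (rule summableI_nonneg_bounded[of _ 1]) (auto simp: part)
  then show "summable (\<lambda>n. \<bar>(1/2 :: real) gchoose n\<bar>)"
    using summable_Suc_iff[of "\<lambda>n. \<bar>(1/2 :: real) gchoose n\<bar>"] by simp
  show "(\<Sum>n. \<bar>(1/2 :: real) gchoose Suc n\<bar>) \<le> 1"
    using * part by (intro suminf_le_const) auto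
qed

text \<open>The binomial series of \<open>sqrt (1 + y)\<close> converges absolutely up to and
  including \<open>norm y = 1\<close>, and Vandermonde's convolution identifies its square. The
  clause on commuting elements stands in for functional calculus, since later arguments need roots
  that commute with one another.\<close>

lemma sqrt_near_one:
  fixes h :: "'a::unital_cstar_algebra"
  assumes h: "star h = h" "norm (1 - h) \<le> 1"
  obtains s where "star s = s" "s * s = h" "norm (1 - s) \<le> 1"
    "\<And>x. x * h = h * x \<Longrightarrow> x * s = s * x"
proof -
  define y where "y = h - 1"
  have y: "norm y \<le> 1" "star y = y"
    using h by (simp_all add: y_def norm_minus_commute star_diff)
  define c where "c n = ((1/2 :: real) gchoose n)" for n
  define f where "f n = c n *\<^sub>R y ^ n" for n
  have nf: "norm (f n) \<le> \<bar>c n\<bar>" for n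
  proof -
    have "norm (y ^ n) \<le> 1"
      by (meson norm_ge_zero norm_power_ineq order_trans power_le_one y(1))
    then show ?thesis by (simp add: f_def mult_left_le)
  qed
  have sc: "summable (\<lambda>n. \<bar>c n\<bar>)" unfolding c_def by (rule abs_gbinomial_half_summable)
  have snf: "summable (\<lambda>n. norm (f n))"
    by (rule summable_comparison_test[OF _ sc]) (auto simp: nf)
  have sf: "summable f" using snf by (rule summable_norm_cancel)
  define s where "s = suminf f"
  have "(\<lambda>k. \<Sum>i\<le>k. f i * f (k - i)) sums (s * s)"
    unfolding s_def by (rule Cauchy_product_sums[OF snf snf])
  moreover have "(\<Sum>i\<le>k. f i * f (k - i)) = ((1::real) gchoose k) *\<^sub>R y ^ k" for k
  proof -
    have "(\<Sum>i\<le>k. f i * f (k - i)) = (\<Sum>i\<le>k. (c i * c (k - i)) *\<^sub>R y ^ k)"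
      by (rule sum.cong) (simp_all add: f_def power_add[symmetric])
    also have "\<dots> = ((1::real) gchoose k) *\<^sub>R y ^ k"
      using gbinomial_Vandermonde[of "1/2 :: real" "1/2" k]
      by (simp add: c_def scaleR_sum_left[symmetric] atMost_atLeast0)
    finally show ?thesis .
  qed
  ultimately have ss: "(\<lambda>k. ((1::real) gchoose k) *\<^sub>R y ^ k) sums (s * s)" by simp
  have "((1::real) gchoose k) = 0" if "k \<notin> {0, 1}" for k
    using that binomial_gbinomial[of 1 k, where 'a = real] by (simp add: binomial_eq_0)
  then have "(\<lambda>k. ((1::real) gchoose k) *\<^sub>R y ^ k) sums (\<Sum>k\<in>{0, 1}. ((1::real) gchoose k) *\<^sub>R y ^ k)"
    by (intro sums_finite) auto
  with ss have "s * s = (\<Sum>k\<in>{0, 1}. ((1::real) gchoose k) *\<^sub>R y ^ k)"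
    by (rule sums_unique2)
  then have s2: "s * s = h" by (simp add: y_def)
  have star: "star s = s"
  proof -
    have "star (f n) = f n" for n by (simp add: f_def star_power y)
    then show ?thesis unfolding s_def using bounded_linear.suminf[OF bounded_linear_star sf] by simp
  qed
  have comm: "x * s = s * x" if "x * h = h * x" for x
  proof -
    have xy: "x * y = y * x" using that by (simp add: y_def algebra_simps)
    have "x * y ^ n = y ^ n * x" for n
      by (induction n) (simp_all add: xy, metis mult.assoc xy)
    then have "x * f n = f n * x" for n by (simp add: f_def)
    then show ?thesis
      unfolding s_def using suminf_mult[OF sf, of x] suminf_mult2[OF sf, of x] by (simp add: sums_iff)
  qed
  have "1 - s = - (\<Sum>n. f (Suc n))"
    proof -
    have "f 0 = 1" by (simp add: f_def c_def)
    then show ?thesis using suminf_split_head[OF sf] by (simp add: s_def)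
  qed
  then have "norm (1 - s) = norm (\<Sum>n. f (Suc n))" by simp
  also have "\<dots> \<le> (\<Sum>n. norm (f (Suc n)))"
    by (rule summable_norm) (use snf in \<open>simp add: summable_Suc_iff[of "\<lambda>n. norm (f n)"]\<close>)
  also have "\<dots> \<le> (\<Sum>n. \<bar>c (Suc n)\<bar>)"
    by (rule suminf_le) (use snf sc nf in
        \<open>simp_all add: summable_Suc_iff[of "\<lambda>n. norm (f n)"] summable_Suc_iff[of "\<lambda>n. \<bar>c n\<bar>"]\<close>)
  also have "\<dots> \<le> 1" unfolding c_def by (rule abs_gbinomial_half_bound)
  finally have "norm (1 - s) \<le> 1" .
  from that[OF star s2 this comm] show thesis by blast
qed

lemma positive_sqrt:
  fixes h :: "'a::unital_cstar_algebra"
  assumes "positive h"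
  obtains s where "positive s" "s * s = h" "\<And>x. x * h = h * x \<Longrightarrow> x * s = s * x"
proof -
  from assms obtain t where t: "star h = h" "norm (of_real t - h) \<le> t"
    by (auto simp: positive_def)
  show thesis
  proof (cases "t = 0")
    case True
    then show ?thesis using t that[of 0] by simp
  next
    case False
    then have tp: "t > 0" using t(2) norm_ge_zero[of "of_real t - h"] by linarith
    define g where "g = (1/t) *\<^sub>R h"
    have "1 - g = (1/t) *\<^sub>R (of_real t - h)"
      using tp by (simp add: g_def scaleR_diff_right of_real_def)
    then have g1: "norm (1 - g) \<le> 1" using t tp by (simp add: divide_simps)
    have sg: "star g = g" by (simp add: g_def t)
    obtain s where s: "star s = s" "s * s = g" "norm (1 - s) \<le> 1"
      "\<And>x. x * g = g * x \<Longrightarrow> x * s = s * x"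
      by (rule sqrt_near_one[OF sg g1]) blast
    have "positive s" unfolding positive_def using s(1,3) by (auto intro: exI[of _ 1])
    then have "positive (sqrt t *\<^sub>R s)" using tp by (intro positive_scaleR) auto
    moreover have "(sqrt t *\<^sub>R s) * (sqrt t *\<^sub>R s) = h"
      using s(2) tp by (simp add: g_def)
    moreover have "x * (sqrt t *\<^sub>R s) = (sqrt t *\<^sub>R s) * x" if "x * h = h * x" for x
    proof -
      have "x * g = g * x" using that by (simp add: g_def)
      from s(4)[OF this] show ?thesis by simp
    qed
    ultimately show ?thesis using that by blast
  qed
qed

text \<open>The element \<open>u = g + \<i> p\<close> satisfies \<open>star u * u = T^2\<close>, so
  it has norm \<open>T\<close>, and \<open>g\<close> is its real part.\<close>

lemma norm_le_of_sum_squares: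
  fixes g p :: "'a::unital_cstar_algebra"
  assumes sa: "star g = g" "star p = p" and comm: "g * p = p * g"
    and eq: "g * g + p * p = of_real (T\<^sup>2)" and T: "0 \<le> T"
  shows "norm g \<le> T"
proof -
  define u where "u = g + \<i> *\<^sub>C p"
  have su: "star u = g - \<i> *\<^sub>C p" by (simp add: u_def star_add sa)
  have "star u * u = g * g + p * p"
    unfolding su unfolding u_def by (simp add: algebra_simps scaleC_scaleC comm)
  then have "(norm u)\<^sup>2 = T\<^sup>2" using norm_star_mult[of u] eq
    by (simp del: of_real_power)
  then have nu: "norm u = T" using T by simp
  have "2 *\<^sub>R g = u + star u" unfolding su unfolding u_def by (simp add: scaleR_2)
  then have "2 * norm g \<le> norm u + norm (star u)"
    by (metis norm_scaleR norm_triangle_ineq abs_numeral)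
  then show ?thesis using nu by simp
qed

text \<open>Since \<open>(h - T/2)^2 + (T - h) h = (T/2)^2\<close>, and \<open>(T - h) h\<close> is
  the square of the product of two commuting roots, \<open>norm_le_of_sum_squares\<close> bounds the
  distance of \<open>h\<close> from the midpoint \<open>T/2\<close>.\<close>

lemma positive_norm_le:
  fixes h :: "'a::unital_cstar_algebra"
  assumes h: "positive h" and Th: "positive (of_real T - h)"
  shows "norm h \<le> T"
proof -
  have T: "0 \<le> T"
    using positive_add[OF h Th] by (simp add: positive_of_real)
  obtain s where s: "positive s" "s * s = h" "\<And>x. x * h = h * x \<Longrightarrow> x * s = s * x"
    by (rule positive_sqrt[OF h]) blast
  obtain r where r: "positive r" "r * r = of_real T - h"
    "\<And>x. x * (of_real T - h) = (of_real T - h) * x \<Longrightarrow> x * r = r * x"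
    by (rule positive_sqrt[OF Th]) blast
  have rh: "h * r = r * h" by (rule r(3)) (simp add: algebra_simps of_real_def)
  have rs: "r * s = s * r" by (rule s(3)) (simp add: rh)
  define g where "g = h - of_real (T/2)"
  define p where "p = r * s"
  have sh: "s * h = h * s" using s(2) by (metis mult.assoc)
  have "norm g \<le> T/2"
  proof (rule norm_le_of_sum_squares)
    show "star g = g" using h by (simp add: g_def star_diff positive_selfadjoint)
    show "star p = p" using r(1) s(1) rs by (simp add: p_def star_mult positive_selfadjoint)
    show "g * p = p * g"
    proof -
      have "h * (r * s) = (r * s) * h" by (simp add: mult.assoc sh commute_left[OF rh])
      then show ?thesis by (simp add: g_def p_def left_diff_distrib right_diff_distrib of_real_def)
    qed
    have "p * p = (r * r) * (s * s)" unfolding p_def by (metis rs mult.assoc)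
    then have pp: "p * p = (of_real T - h) * h" using r(2) s(2) by simp
    show "g * g + p * p = of_real ((T/2)\<^sup>2)"
      unfolding pp by (simp add: g_def algebra_simps of_real_def power2_eq_square scaleR_left_distrib[symmetric])
    show "0 \<le> T/2" using T by simp
  qed
  moreover have "norm h \<le> norm g + norm (of_real (T/2) :: 'a)"
    using norm_triangle_ineq[of g "of_real (T/2)"] by (simp add: g_def)
  ultimately show ?thesis using T by (simp only: norm_of_real)
qed

text \<open>After scaling to norm 1, \<open>1 - g^2\<close> has a root \<open>r\<close>, because
  \<open>1 - (1 - g^2)\<close> has norm 1. From \<open>r^2 + g^2 = 1\<close> follows
  \<open>norm r \<le> 1\<close>, hence \<open>norm (1 - g^2) \<le> 1\<close>, which is the estimate
  that defines positivity of \<open>g^2\<close>.\<close>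

lemma positive_square:
  fixes s :: "'a::unital_cstar_algebra"
  assumes s: "star s = s"
  shows "positive (s * s)"
proof (cases "s = 0")
  case False
  define T where "T = norm s"
  have T: "T > 0" using False by (simp add: T_def)
  define g where "g = (1/T) *\<^sub>R s"
  have g: "star g = g" "norm g = 1" using s T by (simp_all add: g_def T_def)
  have g1: "norm (1 - (1 - g * g)) \<le> 1" using norm_selfadjoint_square[OF g(1)] g(2) by simp
  have sg: "star (1 - g * g) = 1 - g * g" by (simp add: star_diff star_mult g)
  obtain r where r: "star r = r" "r * r = 1 - g * g"
    "\<And>x. x * (1 - g * g) = (1 - g * g) * x \<Longrightarrow> x * r = r * x"
    by (rule sqrt_near_one[OF sg g1]) blast
  have "norm r \<le> 1"
  proof (rule norm_le_of_sum_squares[of r g])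
    show "r * g = g * r" by (rule r(3)[symmetric]) (simp add: algebra_simps)
  qed (simp_all add: r(1,2) g)
  then have "(norm r)\<^sup>2 \<le> 1" by (simp add: power_le_one)
  then have "norm (1 - g * g) \<le> 1"
    using norm_selfadjoint_square[OF r(1)] r(2) by simp
  then have "positive (g * g)"
    unfolding positive_def using g by (auto simp: star_mult intro!: exI[of _ 1])
  then have "positive (T\<^sup>2 *\<^sub>R (g * g))" by (rule positive_scaleR) simp
  then show ?thesis using T by (simp add: g_def power2_eq_square)
qed simp

lemma positive_conj_real:
  assumes "positive k" "star r = r" and comm: "r * k = k * r"
  shows "positive (r * k * (r :: 'a::unital_cstar_algebra))"
proof -
  obtain s where s: "positive s" "s * s = k" "\<And>x. x * k = k * x \<Longrightarrow> x * s = s * x"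
    by (rule positive_sqrt[OF assms(1)]) blast
  have sr: "r * s = s * r" using s(3) comm by simp
  have "star (r * s) = r * s" using sr s(1) assms by (simp add: star_mult positive_selfadjoint)
  from positive_square[OF this] show ?thesis
    by (simp add: s(2)[symmetric] mult.assoc sr[symmetric] commute_left[OF sr[symmetric]])
qed

section \<open>The order given by positive elements\<close>

definition cle :: "'a::unital_cstar_algebra \<Rightarrow> 'a \<Rightarrow> bool"  (infix \<open>\<preceq>\<close> 50) where
  "x \<preceq> y \<longleftrightarrow> positive (y - x)"

lemma cle_refl [simp]: "x \<preceq> x"
  by (simp add: cle_def)

lemma cle_trans [trans]: "x \<preceq> y \<Longrightarrow> y \<preceq> z \<Longrightarrow> x \<preceq> z"
  unfolding cle_def using positive_add[of "z - y" "y - x"] by simp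

lemma cle_add: "x \<preceq> y \<Longrightarrow> x' \<preceq> y' \<Longrightarrow> x + x' \<preceq> y + y'"
  unfolding cle_def using positive_add[of "y - x" "y' - x'"] by (simp add: algebra_simps)

lemma cle_sum: "(\<And>i. i \<in> A \<Longrightarrow> f i \<preceq> g i) \<Longrightarrow> sum f A \<preceq> sum g A"
  by (induction A rule: infinite_finite_induct) (auto intro: cle_add)

lemma cle_scaleR: "x \<preceq> y \<Longrightarrow> 0 \<le> r \<Longrightarrow> r *\<^sub>R x \<preceq> r *\<^sub>R y"
  unfolding cle_def using positive_scaleR[of "y - x" r] by (simp add: algebra_simps)

lemma cle_norm: "star h = h \<Longrightarrow> h \<preceq> of_real (norm h)"
  by (simp add: cle_def positive_norm_minus)

lemma norm_mono:
  fixes h :: "'a::unital_cstar_algebra"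
  assumes "positive h" "h \<preceq> k"
  shows "norm h \<le> norm k"
proof (rule positive_norm_le[OF assms(1)])
  have "positive k" using positive_add assms unfolding cle_def by fastforce
  then have "k \<preceq> of_real (norm k)" by (simp add: cle_norm positive_selfadjoint)
  then have "h \<preceq> of_real (norm k)" using assms(2) cle_trans by blast
  then show "positive (of_real (norm k) - h)" by (simp add: cle_def)
qed

lemma norm_le_of_cle_of_real:
  "positive h \<Longrightarrow> h \<preceq> of_real T \<Longrightarrow> norm h \<le> T"
  by (simp add: cle_def positive_norm_le)

text \<open>This replaces the usual comparison of the spectra of \<open>star y * y\<close> and
  \<open>y * star y\<close>. Writing \<open>star y * y = - k\<close> and
  \<open>q = y * star y\<close>, the sum of the two products is positive, so \<open>q\<close> is
  positive too and \<open>t - q\<close> has norm at most \<open>t\<close>. As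
  \<open>(t - q) y = y (t + k)\<close>, the element \<open>star y (t - q)^2 y\<close> equals
  \<open>- k (t + k)^2\<close>. Its norm is at most \<open>t^3\<close>, yet at least that of
  \<open>2 t k^2\<close>, which is \<open>2 t^3\<close>; hence \<open>t = 0\<close>.\<close>

lemma negative_star_square_eq_0:
  fixes y :: "'a::unital_cstar_algebra"
  assumes r: "star r = r" "star y * y = - (r * r)"
  shows "y = 0"
proof -
  define k where "k = r * r"
  define t where "t = norm k"
  have nk: "norm y * norm y = t"
    using norm_star_mult[of y] r(2) by (simp add: t_def k_def power2_eq_square)
  have k: "star k = k" "positive k" using r by (simp_all add: k_def star_mult positive_square)
  define q where "q = y * star y"
  have sq: "star q = q" by (simp add: q_def star_mult)
  have nq: "norm q = t"
    using norm_star_mult[of "star y"] nk by (simp add: q_def power2_eq_square)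
  define a where "a = y + star y"
  define b where "b = \<i> *\<^sub>C (y - star y)"
  have ab: "star a = a" "star b = b"
    by (simp_all add: a_def b_def star_add star_diff algebra_simps scaleC.scale_right_diff_distrib)
  have "a * a + b * b = 2 *\<^sub>R (star y * y + y * star y)"
    by (simp add: a_def b_def algebra_simps scaleC_scaleC scaleR_2)
  then have "star y * y + y * star y = (1/2) *\<^sub>R (a * a + b * b)" by simp
  moreover have "positive ((1/2) *\<^sub>R (a * a + b * b))"
    by (intro positive_scaleR positive_add positive_square ab) simp
  ultimately have "positive (q - k)" by (simp add: r(2) q_def k_def)
  from positive_add[OF this k(2)] have pq: "positive q" by simp
  have nqt: "norm (of_real t - q) \<le> t"
  proof (rule positive_norm_le)
    show "positive (of_real t - q)" using positive_norm_minus[OF sq] nq by simp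
  qed (simp add: pq)
  have e: "(of_real t - q) * y = y * (of_real t + k)"
    using r(2) by (simp add: algebra_simps q_def k_def of_real_def)
  have e2: "star y * ((of_real t - q) * ((of_real t - q) * y))
      = - (k * ((of_real t + k) * (of_real t + k)))"
  proof -
    define w z where "w = of_real t - q" and "z = of_real t + k"
    have wy: "w * y = y * z" using e by (simp add: w_def z_def)
    have "star y * (w * (w * y)) = star y * (w * (y * z))" by (simp only: wy)
    also have "\<dots> = star y * ((w * y) * z)" by (simp only: mult.assoc)
    also have "\<dots> = star y * ((y * z) * z)" by (simp only: wy)
    also have "\<dots> = (star y * y) * (z * z)" by (simp only: mult.assoc)
    also have "\<dots> = - (k * (z * z))" by (simp add: r(2) k_def)
    finally show ?thesis by (simp add: w_def z_def)
  qed
  have "norm (k * ((of_real t + k) * (of_real t + k)))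
      = norm (star y * ((of_real t - q) * ((of_real t - q) * y)))"
    unfolding e2 by simp
  also have "\<dots> \<le> norm (star y) * (norm (of_real t - q) * (norm (of_real t - q) * norm y))"
    by (intro order_trans[OF norm_mult_ineq] mult_mono order_refl) auto
  also have "\<dots> \<le> norm (star y) * (t * (t * norm y))"
    using nqt by (intro mult_mono order_refl) (auto simp: t_def)
  also have "\<dots> = t^3" using nk by (simp add: power3_eq_cube algebra_simps)
  finally have le: "norm (k * ((of_real t + k) * (of_real t + k))) \<le> t^3" .
  have "(2 * t) *\<^sub>R (k * k) \<preceq> k * ((of_real t + k) * (of_real t + k))"
  proof -
    have "positive (k * k * k)" using k by (intro positive_conj_real) auto
    then have "positive (k * k * k + t\<^sup>2 *\<^sub>R k)"
      using k by (intro positive_add positive_scaleR) auto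
    then show ?thesis
      by (simp add: cle_def algebra_simps of_real_def power2_eq_square scaleR_2 scaleR_left_distrib
          flip: scaleR_scaleR)
  qed
  moreover have "positive ((2 * t) *\<^sub>R (k * k))"
    using k by (intro positive_scaleR positive_square) (auto simp: t_def)
  ultimately have "norm ((2 * t) *\<^sub>R (k * k)) \<le> t^3"
    using norm_mono le order_trans by blast
  then have "2 * t * t\<^sup>2 \<le> t ^ 3"
    using norm_selfadjoint_square[OF k(1)] by (simp add: t_def)
  then have "t^3 \<le> 0" by (simp add: power2_eq_square power3_eq_cube)
  then have "t = 0" by (simp add: t_def power_le_zero_eq)
  then show ?thesis using nk by simp
qed

text \<open>Let \<open>a\<close> be the absolute value of \<open>h = star x * x\<close>, that is,
  the root of \<open>h^2\<close>, so that \<open>z = a - h\<close> is twice the negative part. Then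
  \<open>h z = - a z\<close> makes \<open>star (x z) * (x z)\<close> the negative of a square, and
  the preceding lemma gives \<open>x z = 0\<close>. Consequently \<open>z^2 = 0\<close> and
  \<open>h = a\<close>.\<close>

lemma positive_star_mult: "positive (star x * (x :: 'a::unital_cstar_algebra))"
proof -
  define h where "h = star x * x"
  have h: "star h = h" by (simp add: h_def star_mult)
  obtain a where a: "positive a" "a * a = h * h" "\<And>z. z * (h * h) = (h * h) * z \<Longrightarrow> z * a = a * z"
    by (rule positive_sqrt[OF positive_square[OF h]]) blast
  have sa: "star a = a" using a(1) by (simp add: positive_selfadjoint)
  have ha: "h * a = a * h" by (rule a(3)) (simp add: mult.assoc)
  define z where "z = a - h"
  have sz: "star z = z" by (simp add: z_def star_diff h sa)
  have za: "z * a = a * z" by (simp add: z_def algebra_simps ha)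
  have hz: "h * z = - (a * z)"
    using a(2) by (simp add: z_def algebra_simps ha)
  obtain s where s: "positive s" "s * s = a" "\<And>w. w * a = a * w \<Longrightarrow> w * s = s * w"
    by (rule positive_sqrt[OF a(1)]) blast
  have sz': "z * s = s * z" using s(3) za by simp
  have "x * z = 0"
  proof (rule negative_star_square_eq_0)
    show "star (s * z) = s * z" using s(1) sz sz' by (simp add: star_mult positive_selfadjoint)
    have "star (x * z) * (x * z) = z * (h * z)" by (simp add: star_mult sz h_def mult.assoc)
    also have "\<dots> = - (z * (a * z))" by (simp add: hz)
    also have "z * (a * z) = (s * z) * (s * z)"
      by (simp add: s(2)[symmetric] mult.assoc commute_left[OF sz'])
    finally show "star (x * z) * (x * z) = - (s * z * (s * z))" .
  qed
  then have hz0: "h * z = 0" by (simp add: h_def mult.assoc)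
  then have az0: "a * z = 0" using hz by simp
  have "z * z = 0" using hz0 az0 by (simp add: z_def left_diff_distrib)
  then have "z = 0" using norm_selfadjoint_square[OF sz] by simp
  then show ?thesis using a(1) by (simp add: z_def h_def)
qed

lemma positive_conj:
  fixes k :: "'a::unital_cstar_algebra"
  assumes "positive k"
  shows "positive (star x * k * x)"
proof -
  obtain s where s: "positive s" "s * s = k" by (rule positive_sqrt[OF assms]) blast
  have "star (s * x) * (s * x) = star x * k * x"
    using s by (simp add: star_mult positive_selfadjoint) (metis mult.assoc)
  then show ?thesis using positive_star_mult[of "s * x"] by simp
qed

lemma cle_conj: "h \<preceq> k \<Longrightarrow> star x * h * x \<preceq> star x * k * x"
  unfolding cle_def using positive_conj[of "k - h" x] by (simp add: algebra_simps)

lemma positive_sum: "(\<And>i. i \<in> A \<Longrightarrow> positive (f i)) \<Longrightarrow> positive (sum f A)"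
  by (induction A rule: infinite_finite_induct) (auto intro: positive_add)

lemma star_mult_cle_norm:
  fixes x y :: "'a::unital_cstar_algebra"
  shows "star (x * y) * (x * y) \<preceq> (norm x)\<^sup>2 *\<^sub>R (star y * y)"
proof -
  have "star x * x \<preceq> of_real ((norm x)\<^sup>2)"
    using cle_norm[of "star x * x"] by (simp add: star_mult norm_star_mult)
  from cle_conj[OF this, of y] show ?thesis
    by (simp add: star_mult mult.assoc of_real_def)
qed

text \<open>The difference of the two sides is \<open>star z * z\<close> for a weighted sum
  \<open>z\<close> of \<open>x\<close> and \<open>y\<close>. The free weight is needed in
  \<open>column_norm_dilation\<close>, where the two terms have very different sizes.\<close>

lemma star_diff_mult_cle:
  fixes x y :: "'a::unital_cstar_algebra"
  assumes "0 < \<delta>"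
  shows "star (x - y) * (x - y) \<preceq> (1 + \<delta>) *\<^sub>R (star x * x) + (1 + 1/\<delta>) *\<^sub>R (star y * y)"
proof -
  define z where "z = sqrt \<delta> *\<^sub>R x + (1 / sqrt \<delta>) *\<^sub>R y"
  have "star z * z = \<delta> *\<^sub>R (star x * x) + star x * y + star y * x + (1/\<delta>) *\<^sub>R (star y * y)"
    using assms by (simp add: z_def star_add algebra_simps)
  then have "(1 + \<delta>) *\<^sub>R (star x * x) + (1 + 1/\<delta>) *\<^sub>R (star y * y) - star (x - y) * (x - y) = star z * z"
    by (simp add: star_diff algebra_simps)
  then show ?thesis using positive_star_mult[of z] by (simp add: cle_def)
qed

no_notation Finite_Cartesian_Product.vec_nth (infixl \<open>$\<close> 90)

section \<open>Columns and matrix norms\<close>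

definition column_inner :: "'a::unital_cstar_algebra vec \<Rightarrow> 'a vec \<Rightarrow> 'a" where
  "column_inner v w = (\<Sum>i<dim_vec v. star (v $ i) * w $ i)"

lemma column_norm_alt: "column_norm v = sqrt (norm (column_inner v v))"
  by (simp add: column_norm_def column_inner_def)

lemma column_norm_square: "(column_norm v)\<^sup>2 = norm (column_inner v v)"
  by (simp add: column_norm_alt)

lemma column_norm_nonneg [simp]: "0 \<le> column_norm v"
  by (simp add: column_norm_alt)

lemma positive_column_inner: "positive (column_inner v v)"
  unfolding column_inner_def by (intro positive_sum positive_star_mult)

lemma star_column_inner: "dim_vec v = dim_vec w \<Longrightarrow> star (column_inner v w) = column_inner w v"
  by (simp add: column_inner_def star_sum star_mult)

lemma column_norm_le_iff: "0 \<le> c \<Longrightarrow> column_norm v \<le> c \<longleftrightarrow> norm (column_inner v v) \<le> c\<^sup>2"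
  by (metis column_norm_nonneg column_norm_square power2_le_iff_abs_le abs_of_nonneg)

lemma column_norm_le_mult_iff:
  "0 \<le> c \<Longrightarrow> column_norm w \<le> c * column_norm v
    \<longleftrightarrow> norm (column_inner w w) \<le> c\<^sup>2 * norm (column_inner v v)"
  by (subst column_norm_le_iff) (simp_all add: power_mult_distrib column_norm_square)

lemma column_norm_mono_cle:
  assumes "column_inner w w \<preceq> K *\<^sub>R column_inner v v" "0 \<le> c" "K = c\<^sup>2"
  shows "column_norm w \<le> c * column_norm v"
proof -
  have "norm (column_inner w w) \<le> norm (K *\<^sub>R column_inner v v)"
    by (rule norm_mono[OF positive_column_inner assms(1)])
  then show ?thesis using assms by (subst column_norm_le_mult_iff) auto
qed

lemma norm_entry_le_column_norm:
  assumes "i < dim_vec v"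
  shows "norm (v $ i) \<le> column_norm v"
proof -
  have "column_inner v v = star (v $ i) * v $ i + (\<Sum>j\<in>{..<dim_vec v} - {i}. star (v $ j) * v $ j)"
    unfolding column_inner_def using assms by (subst sum.remove[of _ i]) auto
  then have "star (v $ i) * v $ i \<preceq> column_inner v v"
    by (simp add: cle_def positive_sum positive_star_mult)
  then have "norm (star (v $ i) * v $ i) \<le> norm (column_inner v v)"
    by (rule norm_mono[OF positive_star_mult])
  then have "(norm (v $ i))\<^sup>2 \<le> (column_norm v)\<^sup>2"
    by (simp add: norm_star_mult column_norm_square)
  then show ?thesis by (simp add: power2_le_iff_abs_le)
qed

text \<open>The Hilbert module argument: expand the positive sum of the squares of
  \<open>T w_i - v_i c\<close>, where \<open>c\<close> is the inner product. The number
  \<open>T\<close> replaces the inner square of \<open>v\<close>, which need not be invertible; this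
  yields \<open>star c * c\<close> below \<open>T\<close> times the inner square of
  \<open>w\<close>.\<close>

lemma column_Cauchy_Schwarz:
  fixes v w :: "'a::unital_cstar_algebra vec"
  assumes dim: "dim_vec w = dim_vec v"
  shows "norm (column_inner v w) \<le> column_norm v * column_norm w"
proof (cases "column_norm v = 0")
  case True
  then have "v $ i = 0" if "i < dim_vec v" for i
    using norm_entry_le_column_norm[OF that] by simp
  then show ?thesis by (simp add: column_inner_def)
next
  case False
  define T where "T = norm (column_inner v v)"
  have T: "T > 0" using False by (simp add: T_def column_norm_alt)
  define c where "c = column_inner v w"
  have sc: "star c = column_inner w v" by (simp add: c_def star_column_inner dim)
  have "positive (\<Sum>i<dim_vec v. star (T *\<^sub>R w $ i - v $ i * c) * (T *\<^sub>R w $ i - v $ i * c))"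
    by (intro positive_sum positive_star_mult)
  also have "(\<Sum>i<dim_vec v. star (T *\<^sub>R w $ i - v $ i * c) * (T *\<^sub>R w $ i - v $ i * c))
     = T\<^sup>2 *\<^sub>R column_inner w w - T *\<^sub>R (column_inner w v * c) - T *\<^sub>R (star c * column_inner v w)
       + star c * column_inner v v * c"
    unfolding column_inner_def dim
    by (simp add: star_diff star_mult algebra_simps sum.distrib sum_subtractf
        power2_eq_square scaleR_sum_right sum_distrib_left sum_distrib_right)
  finally have pos: "positive (T\<^sup>2 *\<^sub>R column_inner w w - T *\<^sub>R (column_inner w v * c)
      - T *\<^sub>R (star c * column_inner v w) + star c * column_inner v v * c)" .
  have TT: "(2 * T) *\<^sub>R y = T *\<^sub>R y + T *\<^sub>R y" for y :: 'a
    by (simp flip: scaleR_left_distrib)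
  from pos have p1: "positive (T\<^sup>2 *\<^sub>R column_inner w w - (2 * T) *\<^sub>R (star c * c) + star c * column_inner v v * c)"
    by (simp add: sc TT diff_diff_eq flip: c_def)
  have p2: "star c * column_inner v v * c \<preceq> T *\<^sub>R (star c * c)"
  proof -
    have "column_inner v v \<preceq> of_real T"
      unfolding T_def by (intro cle_norm positive_selfadjoint positive_column_inner)
    from cle_conj[OF this, of c] show ?thesis by (simp add: of_real_def)
  qed
  from positive_add[OF p1 p2[unfolded cle_def]]
  have "positive (T\<^sup>2 *\<^sub>R column_inner w w - T *\<^sub>R (star c * c))"
    by (simp add: TT)
  then have "positive ((1/T) *\<^sub>R (T\<^sup>2 *\<^sub>R column_inner w w - T *\<^sub>R (star c * c)))"
    using T by (intro positive_scaleR) auto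
  then have "star c * c \<preceq> T *\<^sub>R column_inner w w"
    using T by (simp add: cle_def algebra_simps power2_eq_square)
  then have "norm (star c * c) \<le> norm (T *\<^sub>R column_inner w w)"
    by (rule norm_mono[OF positive_star_mult])
  then have "(norm c)\<^sup>2 \<le> (column_norm v * column_norm w)\<^sup>2"
    using T by (simp add: norm_star_mult power_mult_distrib column_norm_square T_def)
  then show ?thesis by (simp add: power2_le_iff_abs_le c_def)
qed

lemma column_norm_triangle:
  fixes v w :: "'a::unital_cstar_algebra vec"
  assumes dim: "dim_vec v = dim_vec w"
  shows "column_norm (v + w) \<le> column_norm v + column_norm w"
proof -
  have "column_inner (v + w) (v + w)
      = column_inner v v + column_inner v w + (column_inner w v + column_inner w w)"
    using dim by (simp add: column_inner_def star_add algebra_simps sum.distrib)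
  then have "norm (column_inner (v + w) (v + w))
      \<le> norm (column_inner v v) + norm (column_inner v w) + (norm (column_inner w v) + norm (column_inner w w))"
    by (metis add_mono norm_triangle_le norm_triangle_ineq)
  also have "\<dots> \<le> (column_norm v)\<^sup>2 + column_norm v * column_norm w
      + (column_norm w * column_norm v + (column_norm w)\<^sup>2)"
    using column_Cauchy_Schwarz[of v w] column_Cauchy_Schwarz[of w v] dim
    by (intro add_mono) (simp_all add: column_norm_square)
  also have "\<dots> = (column_norm v + column_norm w)\<^sup>2"
    by (simp add: power2_eq_square algebra_simps)
  finally show ?thesis by (subst column_norm_le_iff) auto
qed

text \<open>The difference of the two sides is half the sum of
  \<open>star (x i - x j) * (x i - x j)\<close> over all pairs.\<close>

lemma star_sum_mult_cle:
  fixes x :: "'i \<Rightarrow> 'a::unital_cstar_algebra"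
  assumes "finite J"
  shows "star (sum x J) * sum x J \<preceq> real (card J) *\<^sub>R (\<Sum>j\<in>J. star (x j) * x j)"
proof -
  define P where "P = (\<Sum>j\<in>J. star (x j) * x j)"
  define X where "X = sum x J"
  have X: "(\<Sum>i\<in>J. star (x i) * X) = star X * X" "(\<Sum>i\<in>J. star X * x i) = star X * X"
    by (simp_all add: X_def star_sum flip: sum_distrib_left sum_distrib_right)
  have P: "(\<Sum>i\<in>J. real (card J) *\<^sub>R (star (x i) * x i)) = real (card J) *\<^sub>R P"
    by (simp add: P_def flip: scaleR_sum_right)
  have "positive ((1/2) *\<^sub>R (\<Sum>i\<in>J. \<Sum>j\<in>J. star (x i - x j) * (x i - x j)))"
    by (intro positive_scaleR positive_sum positive_star_mult) simp
  also have "(\<Sum>i\<in>J. \<Sum>j\<in>J. star (x i - x j) * (x i - x j))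
     = (\<Sum>i\<in>J. real (card J) *\<^sub>R (star (x i) * x i) - star (x i) * X - star X * x i + P)"
    by (intro sum.cong refl)
       (simp add: star_diff algebra_simps sum.distrib sum_subtractf P_def X_def sum_distrib_left
         sum_distrib_right star_sum scaleR_conv_of_real)
  also have "\<dots> = 2 *\<^sub>R (real (card J) *\<^sub>R P - star X * X)"
  proof -
    have "a - y - y + a = 2 *\<^sub>R (a - y)" for a y :: 'a by (simp add: scaleR_2)
    then show ?thesis by (simp only: sum.distrib sum_subtractf X P sum_constant_scaleR)
  qed
  finally show ?thesis by (simp add: cle_def P_def X_def)
qed

lemma index_mult_mat_vec_sum:
  "A \<in> carrier_mat n m \<Longrightarrow> v \<in> carrier_vec m \<Longrightarrow> i < n \<Longrightarrow>
    (A *\<^sub>v v) $ i = (\<Sum>j<m. A $$ (i, j) * v $ j)"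
  by (auto simp: scalar_prod_def atLeast0LessThan intro!: sum.cong)

lemma index_mult_mat_sum:
  "A \<in> carrier_mat n m \<Longrightarrow> B \<in> carrier_mat m p \<Longrightarrow> i < n \<Longrightarrow> k < p \<Longrightarrow>
    (A * B) $$ (i, k) = (\<Sum>j<m. A $$ (i, j) * B $$ (j, k))"
  by (auto simp: scalar_prod_def atLeast0LessThan intro!: sum.cong)

text \<open>A crude constant suffices, but the bound has to hold in the order and not only in norm:
  in \<open>column_norm_dilation\<close> it is added to another term before norms are taken.\<close>

lemma column_inner_mult_cle:
  fixes A :: "'a::unital_cstar_algebra mat"
  assumes A: "A \<in> carrier_mat n m"
  obtains K where "0 < K"
    "\<And>v. v \<in> carrier_vec m \<Longrightarrow> column_inner (A *\<^sub>v v) (A *\<^sub>v v) \<preceq> K\<^sup>2 *\<^sub>R column_inner v v"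
proof -
  define K where "K = 1 + (\<Sum>i<n. real m * (\<Sum>j<m. (norm (A $$ (i, j)))\<^sup>2))"
  have K: "K \<ge> 1" by (simp add: K_def sum_nonneg)
  have "column_inner (A *\<^sub>v v) (A *\<^sub>v v) \<preceq> (sqrt K)\<^sup>2 *\<^sub>R column_inner v v"
    if v: "v \<in> carrier_vec m" for v
  proof -
    define P where "P = column_inner v v"
    have P: "positive P" by (simp add: P_def positive_column_inner)
    have row: "star ((A *\<^sub>v v) $ i) * (A *\<^sub>v v) $ i \<preceq> (real m * (\<Sum>j<m. (norm (A $$ (i, j)))\<^sup>2)) *\<^sub>R P"
      if i: "i < n" for i
    proof -
      have "star ((A *\<^sub>v v) $ i) * (A *\<^sub>v v) $ i
          \<preceq> real m *\<^sub>R (\<Sum>j<m. star (A $$ (i, j) * v $ j) * (A $$ (i, j) * v $ j))"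
        using star_sum_mult_cle[of "{..<m}" "\<lambda>j. A $$ (i, j) * v $ j"]
        by (simp only: index_mult_mat_vec_sum[OF A v i] card_lessThan finite_lessThan)
      also have "\<dots> \<preceq> real m *\<^sub>R (\<Sum>j<m. (norm (A $$ (i, j)))\<^sup>2 *\<^sub>R P)"
      proof (intro cle_scaleR cle_sum)
        fix j assume j: "j \<in> {..<m}"
        have "star (A $$ (i, j) * v $ j) * (A $$ (i, j) * v $ j)
            \<preceq> (norm (A $$ (i, j)))\<^sup>2 *\<^sub>R (star (v $ j) * v $ j)"
          by (rule star_mult_cle_norm)
        also have "\<dots> \<preceq> (norm (A $$ (i, j)))\<^sup>2 *\<^sub>R P"
        proof (rule cle_scaleR)
          have "P - star (v $ j) * v $ j = (\<Sum>j\<in>{..<m} - {j}. star (v $ j) * v $ j)"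
            unfolding P_def column_inner_def using j v by (subst sum.remove[of _ j]) auto
          then show "star (v $ j) * v $ j \<preceq> P"
            by (simp add: cle_def positive_sum positive_star_mult)
        qed simp
        finally show "star (A $$ (i, j) * v $ j) * (A $$ (i, j) * v $ j) \<preceq> (norm (A $$ (i, j)))\<^sup>2 *\<^sub>R P" .
      qed simp
      finally show ?thesis by (simp only: scaleR_sum_left[symmetric] scaleR_scaleR)
    qed
    have "column_inner (A *\<^sub>v v) (A *\<^sub>v v) \<preceq> (\<Sum>i<n. (real m * (\<Sum>j<m. (norm (A $$ (i, j)))\<^sup>2)) *\<^sub>R P)"
    proof -
      have "dim_vec (A *\<^sub>v v) = n" using A by simp
      then show ?thesis
        unfolding column_inner_def using row by (simp only:) (intro cle_sum, simp)
    qed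
    also have "\<dots> \<preceq> K *\<^sub>R P"
      using P by (simp add: cle_def K_def scaleR_add_left scaleR_sum_left)
    finally show ?thesis using K by (simp add: P_def)
  qed
  then show thesis using that[of "sqrt K"] K by simp
qed

lemma mult_mat_vec_scaleR:
  fixes A :: "'a::unital_cstar_algebra mat"
  assumes "A \<in> carrier_mat n m" "v \<in> carrier_vec m"
  shows "A *\<^sub>v map_vec (scaleR r) v = map_vec (scaleR r) (A *\<^sub>v v)"
proof (rule eq_vecI)
  fix i assume "i < dim_vec (map_vec (scaleR r) (A *\<^sub>v v))"
  then have i: "i < n" using assms by simp
  show "(A *\<^sub>v map_vec (scaleR r) v) $ i = map_vec (scaleR r) (A *\<^sub>v v) $ i"
    using assms i by (simp add: scalar_prod_def scaleR_sum_right)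
qed (use assms in auto)

lemma column_norm_scaleR: "column_norm (map_vec (scaleR r) v) = \<bar>r\<bar> * column_norm v"
  for v :: "'a::unital_cstar_algebra vec"
proof -
  have "column_inner (map_vec (scaleR r) v) (map_vec (scaleR r) v) = r\<^sup>2 *\<^sub>R column_inner v v"
    by (simp add: column_inner_def scaleR_sum_right power2_eq_square)
  then show ?thesis by (simp add: column_norm_alt real_sqrt_mult)
qed

lemma bdd_above_matrix_norm:
  fixes A :: "'a::unital_cstar_algebra mat"
  shows "bdd_above ((\<lambda>v. column_norm (A *\<^sub>v v)) ` {v \<in> carrier_vec (dim_col A). column_norm v \<le> 1})"
proof -
  obtain K where K: "0 < K"
    "\<And>v. v \<in> carrier_vec (dim_col A) \<Longrightarrow> column_inner (A *\<^sub>v v) (A *\<^sub>v v) \<preceq> K\<^sup>2 *\<^sub>R column_inner v v"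
    by (rule column_inner_mult_cle[of A "dim_row A" "dim_col A"]) auto
  have "column_norm (A *\<^sub>v v) \<le> K" if "v \<in> carrier_vec (dim_col A)" "column_norm v \<le> 1" for v
  proof -
    have "column_norm (A *\<^sub>v v) \<le> K * column_norm v"
      using K that by (intro column_norm_mono_cle) auto
    also have "\<dots> \<le> K" using K that by simp
    finally show ?thesis .
  qed
  then show ?thesis by (auto intro!: bdd_aboveI[of _ K])
qed

lemma zero_column: "0\<^sub>v m \<in> {v \<in> carrier_vec m. column_norm v \<le> 1}"
  by (simp add: column_norm_alt column_inner_def)

lemma matrix_norm_nonneg: "0 \<le> matrix_norm (A :: 'a::unital_cstar_algebra mat)"
  unfolding matrix_norm_def
  by (rule cSUP_upper2[OF bdd_above_matrix_norm zero_column]) simp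

lemma column_norm_mult_le:
  fixes A :: "'a::unital_cstar_algebra mat"
  assumes A: "A \<in> carrier_mat n m" and v: "v \<in> carrier_vec m"
  shows "column_norm (A *\<^sub>v v) \<le> matrix_norm A * column_norm v"
proof (cases "column_norm v = 0")
  case True
  then have "v $ i = 0" if "i < m" for i
    using norm_entry_le_column_norm[of i v] that v by simp
  then have "(A *\<^sub>v v) $ i = 0" if "i < n" for i
    using A v that by (simp add: index_mult_mat_vec_sum del: index_mult_mat_vec)
  then have "column_inner (A *\<^sub>v v) (A *\<^sub>v v) = 0"
    using A by (simp add: column_inner_def)
  then show ?thesis using True by (simp add: column_norm_alt)
next
  case False
  then have pos: "column_norm v > 0" by (simp add: order_less_le)
  define w where "w = map_vec (scaleR (1 / column_norm v)) v"
  have "column_norm w = 1" using pos by (simp add: w_def column_norm_scaleR)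
  then have "column_norm (A *\<^sub>v w) \<le> matrix_norm A"
    unfolding matrix_norm_def using A v
    by (intro cSUP_upper bdd_above_matrix_norm) (auto simp: w_def)
  then show ?thesis
    using pos by (simp add: w_def mult_mat_vec_scaleR[OF A v] column_norm_scaleR field_simps)
qed

lemma matrix_norm_le:
  fixes A :: "'a::unital_cstar_algebra mat"
  assumes A: "A \<in> carrier_mat n m" and "0 \<le> c"
    and le: "\<And>v. v \<in> carrier_vec m \<Longrightarrow> column_norm (A *\<^sub>v v) \<le> c * column_norm v"
  shows "matrix_norm A \<le> c"
  unfolding matrix_norm_def
proof (rule cSUP_least)
  fix v :: "'a vec" assume v: "v \<in> {v \<in> carrier_vec (dim_col A). column_norm v \<le> 1}"
  then have "column_norm (A *\<^sub>v v) \<le> c * column_norm v" using A le by auto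
  also have "\<dots> \<le> c" using v assms(2) by (simp add: mult_left_le)
  finally show "column_norm (A *\<^sub>v v) \<le> c" .
qed (use zero_column in blast)

lemma matrix_norm_triangle:
  fixes A B :: "'a::unital_cstar_algebra mat"
  assumes A: "A \<in> carrier_mat n m" and B: "B \<in> carrier_mat n m"
  shows "matrix_norm (A + B) \<le> matrix_norm A + matrix_norm B"
proof (rule matrix_norm_le)
  fix v :: "'a vec" assume v: "v \<in> carrier_vec m"
  have "column_norm ((A + B) *\<^sub>v v) = column_norm (A *\<^sub>v v + B *\<^sub>v v)"
    by (simp add: add_mult_distrib_mat_vec[OF A B v])
  also have "\<dots> \<le> column_norm (A *\<^sub>v v) + column_norm (B *\<^sub>v v)"
    using A B by (intro column_norm_triangle) auto
  also have "\<dots> \<le> (matrix_norm A + matrix_norm B) * column_norm v"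
    using column_norm_mult_le[OF A v] column_norm_mult_le[OF B v] by (simp add: algebra_simps)
  finally show "column_norm ((A + B) *\<^sub>v v) \<le> (matrix_norm A + matrix_norm B) * column_norm v" .
qed (use A B matrix_norm_nonneg in \<open>auto intro: add_nonneg_nonneg\<close>)

lemma matrix_norm_diag_le:
  fixes b :: "'a::unital_cstar_algebra"
  shows "matrix_norm (mat n n (\<lambda>(i, j). if i = j then b else 0)) \<le> norm b"
proof (rule matrix_norm_le)
  fix v :: "'a vec" assume v: "v \<in> carrier_vec n"
  let ?D = "mat n n (\<lambda>(i, j). if i = j then b else 0)"
  have ix: "(?D *\<^sub>v v) $ i = b * v $ i" if "i < n" for i
  proof -
    have "(?D *\<^sub>v v) $ i = (\<Sum>j<n. ?D $$ (i, j) * v $ j)"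
      using v that by (intro index_mult_mat_vec_sum) auto
    also have "\<dots> = (\<Sum>j<n. if i = j then b * v $ j else 0)"
      using that by (intro sum.cong) auto
    finally show ?thesis using that by simp
  qed
  have "column_inner (?D *\<^sub>v v) (?D *\<^sub>v v) \<preceq> (\<Sum>i<n. (norm b)\<^sup>2 *\<^sub>R (star (v $ i) * v $ i))"
    unfolding column_inner_def using ix star_mult_cle_norm[of b]
    by (auto simp del: index_mult_mat_vec intro!: cle_sum)
  also have "\<dots> = (norm b)\<^sup>2 *\<^sub>R column_inner v v"
    using v by (simp add: column_inner_def scaleR_sum_right)
  finally show "column_norm (?D *\<^sub>v v) \<le> norm b * column_norm v"
    by (rule column_norm_mono_cle) auto
qed auto

lemma matrix_norm_1x1: "matrix_norm (mat 1 1 (\<lambda>_. b)) = norm (b :: 'a::unital_cstar_algebra)"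
proof (rule antisym)
  have "mat 1 1 (\<lambda>_. b) = mat 1 1 (\<lambda>(i, j). if i = j then b else 0)" by auto
  then show "matrix_norm (mat 1 1 (\<lambda>_. b)) \<le> norm b"
    using matrix_norm_diag_le[of 1 b] by simp
  have "column_norm (mat 1 1 (\<lambda>_. b) *\<^sub>v vec 1 (\<lambda>_. 1)) \<le> matrix_norm (mat 1 1 (\<lambda>_. b)) * column_norm (vec 1 (\<lambda>_. 1 :: 'a))"
    by (rule column_norm_mult_le) auto
  then show "norm b \<le> matrix_norm (mat 1 1 (\<lambda>_. b))"
    by (simp add: column_norm_alt column_inner_def norm_star_mult scalar_prod_def)
qed

text \<open>With \<open>w = X v\<close>, the parallelogram law gives \<open>w + v\<close> and
  \<open>w - v\<close> the joint inner square
  \<open>2 (\<langle>w,w\<rangle> + \<langle>v,v\<rangle>)\<close>. Estimating the contributions of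
  \<open>c (X + 1)\<close> and \<open>Y (X - 1)\<close> together instead of separately yields
  \<open>sqrt (s^2 + M^2)\<close> in place of \<open>s + M\<close>, and the later limit depends on
  this gain.\<close>

lemma column_norm_dilation:
  fixes X Y :: "'a::unital_cstar_algebra mat"
  assumes X: "X \<in> carrier_mat n n" and Y: "Y \<in> carrier_mat n n"
    and contr: "\<And>v. v \<in> carrier_vec n \<Longrightarrow> column_norm (X *\<^sub>v v) \<le> column_norm v"
    and M: "0 < M"
    "\<And>v. v \<in> carrier_vec n \<Longrightarrow> column_inner (Y *\<^sub>v v) (Y *\<^sub>v v) \<preceq> M\<^sup>2 *\<^sub>R column_inner v v"
    and s: "cmod c = s" "0 < s"
  shows "matrix_norm (map_mat (scaleC c) (X + 1\<^sub>m n) - Y * (X - 1\<^sub>m n)) \<le> 2 * sqrt (s\<^sup>2 + M\<^sup>2)"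
    (is "matrix_norm ?Z \<le> _")
proof (rule matrix_norm_le)
  show "?Z \<in> carrier_mat n n" using X Y by auto
  fix v :: "'a vec" assume v: "v \<in> carrier_vec n"
  define w where "w = X *\<^sub>v v"
  define d where "d = w - v"
  define a where "a = w + v"
  have w: "w \<in> carrier_vec n" "d \<in> carrier_vec n" "a \<in> carrier_vec n"
    using X v by (auto simp: w_def d_def a_def)
  have XI: "X + 1\<^sub>m n \<in> carrier_mat n n" "X - 1\<^sub>m n \<in> carrier_mat n n" using X by auto
  have Zv: "(?Z *\<^sub>v v) $ i = c *\<^sub>C a $ i - (Y *\<^sub>v d) $ i" if i: "i < n" for i
  proof -
    have "?Z *\<^sub>v v = map_mat (scaleC c) (X + 1\<^sub>m n) *\<^sub>v v - (Y * (X - 1\<^sub>m n)) *\<^sub>v v"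
      using X Y v by (intro minus_mult_distrib_mat_vec) auto
    moreover have "(Y * (X - 1\<^sub>m n)) *\<^sub>v v = Y *\<^sub>v d"
      using X Y v by (simp add: assoc_mult_mat_vec[OF Y XI(2) v] minus_mult_distrib_mat_vec[OF X _ v] d_def w_def)
    moreover have "(map_mat (scaleC c) (X + 1\<^sub>m n) *\<^sub>v v) $ i = c *\<^sub>C ((X + 1\<^sub>m n) *\<^sub>v v) $ i"
      using XI v i by (subst (1 2) index_mult_mat_vec_sum[of _ n n])
        (auto simp: scaleC.scale_sum_right simp del: index_mult_mat_vec)
    moreover have "(X + 1\<^sub>m n) *\<^sub>v v = a"
      using X v by (simp add: add_mult_distrib_mat_vec[OF X _ v] a_def w_def)
    ultimately show ?thesis using X Y v i w XI by (simp del: index_mult_mat_vec)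
  qed
  \<comment> \<open>This weight makes the two coefficients \<open>(1 + \<delta>) s^2\<close> and
    \<open>(1 + 1/\<delta>) M^2\<close> both equal to \<open>s^2 + M^2\<close>.\<close>
  define \<delta> where "\<delta> = M\<^sup>2 / s\<^sup>2"
  have \<delta>: "\<delta> > 0" using M s by (simp add: \<delta>_def)
  have "column_inner (?Z *\<^sub>v v) (?Z *\<^sub>v v)
      \<preceq> (\<Sum>i<n. (1 + \<delta>) *\<^sub>R (star (c *\<^sub>C a $ i) * (c *\<^sub>C a $ i))
            + (1 + 1/\<delta>) *\<^sub>R (star ((Y *\<^sub>v d) $ i) * (Y *\<^sub>v d) $ i))"
    unfolding column_inner_def using X Y Zv star_diff_mult_cle[OF \<delta>]
    by (auto simp del: index_mult_mat_vec star_scaleC mult_scaleC_left mult_scaleC_right intro!: cle_sum)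
  also have "\<dots> = (1 + \<delta>) *\<^sub>R s\<^sup>2 *\<^sub>R column_inner a a + (1 + 1/\<delta>) *\<^sub>R column_inner (Y *\<^sub>v d) (Y *\<^sub>v d)"
  proof -
    have "star (c *\<^sub>C a $ i) * (c *\<^sub>C a $ i) = s\<^sup>2 *\<^sub>R (star (a $ i) * a $ i)" for i
      using complex_norm_square[of c] s
      by (simp add: scaleC_scaleC scaleR_scaleC del: of_real_power)
    then show ?thesis using w Y by (simp add: column_inner_def sum.distrib scaleR_sum_right del: index_mult_mat_vec)
  qed
  also have "\<dots> \<preceq> (1 + \<delta>) *\<^sub>R s\<^sup>2 *\<^sub>R column_inner a a + (1 + 1/\<delta>) *\<^sub>R M\<^sup>2 *\<^sub>R column_inner d d"
    using M(2)[OF w(2)] \<delta> by (intro cle_add cle_scaleR cle_refl) auto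
  also have "\<dots> = (s\<^sup>2 + M\<^sup>2) *\<^sub>R (column_inner a a + column_inner d d)"
  proof -
    have "(1 + \<delta>) * s\<^sup>2 = s\<^sup>2 + M\<^sup>2" "(1 + 1/\<delta>) * M\<^sup>2 = s\<^sup>2 + M\<^sup>2"
      using M s by (simp_all add: \<delta>_def field_simps)
    then show ?thesis by (simp only: scaleR_scaleR scaleR_add_right)
  qed
  also have "column_inner a a + column_inner d d = 2 *\<^sub>R (column_inner w w + column_inner v v)"
    using w v by (simp add: a_def d_def column_inner_def star_add star_diff algebra_simps sum.distrib
        sum_subtractf scaleR_2)
  finally have "column_inner (?Z *\<^sub>v v) (?Z *\<^sub>v v)
      \<preceq> (s\<^sup>2 + M\<^sup>2) *\<^sub>R 2 *\<^sub>R (column_inner w w + column_inner v v)" .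
  then have "norm (column_inner (?Z *\<^sub>v v) (?Z *\<^sub>v v))
      \<le> norm ((s\<^sup>2 + M\<^sup>2) *\<^sub>R 2 *\<^sub>R (column_inner w w + column_inner v v))"
    by (rule norm_mono[OF positive_column_inner])
  also have "\<dots> \<le> (s\<^sup>2 + M\<^sup>2) * (2 * (norm (column_inner w w) + norm (column_inner v v)))"
  proof -
    have nn: "norm ((s\<^sup>2 + M\<^sup>2) *\<^sub>R 2 *\<^sub>R x) = (s\<^sup>2 + M\<^sup>2) * (2 * norm x)" for x :: 'a
      by simp
    show ?thesis unfolding nn by (intro mult_left_mono norm_triangle_ineq) auto
  qed
  also have "\<dots> \<le> (s\<^sup>2 + M\<^sup>2) * (2 * (norm (column_inner v v) + norm (column_inner v v)))"
    using contr[OF v] by (intro mult_left_mono add_mono)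
      (auto simp: w_def simp flip: column_norm_square intro: power_mono)
  also have "\<dots> = (2 * sqrt (s\<^sup>2 + M\<^sup>2))\<^sup>2 * norm (column_inner v v)"
    by (simp add: power_mult_distrib)
  finally show "column_norm (?Z *\<^sub>v v) \<le> 2 * sqrt (s\<^sup>2 + M\<^sup>2) * column_norm v"
    by (subst column_norm_le_mult_iff) auto
qed simp

section \<open>Bimodules over the canonical masa of a UHF algebra\<close>

definition projection :: "'a::unital_cstar_algebra \<Rightarrow> bool" where
  "projection f \<longleftrightarrow> star f = f \<and> f * f = f"

lemma positive_projection: "projection f \<Longrightarrow> positive f"
  by (metis positive_square projection_def)

lemma norm_projection_le: "projection f \<Longrightarrow> norm f \<le> 1"
proof -
  assume "projection f"
  then have "(norm f)\<^sup>2 = norm f" by (metis norm_star_mult projection_def)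
  then show ?thesis by (cases "norm f = 0") (auto simp: power2_eq_square)
qed

lemma norm_mult3_ineq:
  "norm (x * y * z) \<le> norm x * norm y * norm (z :: 'a::real_normed_algebra)"
  by (meson mult_right_mono norm_ge_zero norm_mult_ineq order_trans)

text \<open>The summands have orthogonal ranges, so the cross terms vanish, and each
  \<open>star (y r) * y r\<close> lies below \<open>(K * norm x)^2\<close> times \<open>g r\<close>.
  The bound is therefore independent of the number of summands, which matters because that number
  grows with the level.\<close>

lemma norm_compression_le:
  fixes x :: "'a::unital_cstar_algebra"
  assumes "finite J"
    and f: "\<And>r. r \<in> J \<Longrightarrow> projection (f r)"
    and orth: "\<And>r s. r \<in> J \<Longrightarrow> s \<in> J \<Longrightarrow> r \<noteq> s \<Longrightarrow> f r * f s = 0"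
    and g: "\<And>r. r \<in> J \<Longrightarrow> projection (g r)" "sum g J \<preceq> 1"
    and c: "\<And>r. r \<in> J \<Longrightarrow> cmod (c r) \<le> K" and K: "0 \<le> K"
  shows "norm (\<Sum>r\<in>J. c r *\<^sub>C (f r * x * g r)) \<le> K * norm x"
proof -
  define y where "y r = c r *\<^sub>C (f r * x * g r)" for r
  have off: "star (y r) * y s = 0" if "r \<in> J" "s \<in> J" "r \<noteq> s" for r s
  proof -
    have "star (y r) * y s = (cnj (c r) * c s) *\<^sub>C (star (g r) * star x * ((star (f r) * f s) * x * g s))"
      by (simp add: y_def star_mult scaleC_scaleC mult.assoc)
    also have "star (f r) * f s = 0" using f[OF that(1)] orth[OF that] by (simp add: projection_def)
    finally show ?thesis by simp
  qed
  have diag: "star (y r) * y r \<preceq> (K * norm x)\<^sup>2 *\<^sub>R g r" if r: "r \<in> J" for r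
  proof -
    have "y r = (c r *\<^sub>C (f r * x)) * g r" by (simp add: y_def)
    then have "star (y r) * y r \<preceq> (norm (c r *\<^sub>C (f r * x)))\<^sup>2 *\<^sub>R (star (g r) * g r)"
      using star_mult_cle_norm by metis
    also have "star (g r) * g r = g r" using g(1)[OF r] by (simp add: projection_def)
    also have "(norm (c r *\<^sub>C (f r * x)))\<^sup>2 *\<^sub>R g r \<preceq> (K * norm x)\<^sup>2 *\<^sub>R g r"
    proof -
      have "norm (f r * x) \<le> 1 * norm x"
        using norm_projection_le[OF f[OF r]] by (intro order_trans[OF norm_mult_ineq] mult_right_mono) auto
      then have "norm (c r *\<^sub>C (f r * x)) \<le> K * norm x"
        unfolding norm_scaleC using c[OF r] K by (intro mult_mono) auto
      then have "(norm (c r *\<^sub>C (f r * x)))\<^sup>2 \<le> (K * norm x)\<^sup>2" by (intro power_mono) auto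
      then show ?thesis
        using positive_scaleR[OF positive_projection[OF g(1)[OF r]]]
        by (simp add: cle_def flip: scaleR_diff_left)
    qed
    finally show ?thesis .
  qed
  have "star (sum y J) * sum y J = (\<Sum>r\<in>J. \<Sum>s\<in>J. star (y r) * y s)"
    by (simp add: star_sum sum_product)
  also have "\<dots> = (\<Sum>r\<in>J. \<Sum>s\<in>J. if r = s then star (y r) * y r else 0)"
    by (intro sum.cong refl) (auto simp: off)
  also have "\<dots> = (\<Sum>r\<in>J. star (y r) * y r)" using assms(1) by simp
  also have "\<dots> \<preceq> (\<Sum>r\<in>J. (K * norm x)\<^sup>2 *\<^sub>R g r)" by (intro cle_sum diag)
  also have "\<dots> = (K * norm x)\<^sup>2 *\<^sub>R sum g J" by (simp add: scaleR_sum_right)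
  also have "\<dots> \<preceq> (K * norm x)\<^sup>2 *\<^sub>R 1" by (intro cle_scaleR g) simp
  finally have "star (sum y J) * sum y J \<preceq> of_real ((K * norm x)\<^sup>2)" by (simp only: of_real_def)
  then have "norm (star (sum y J) * sum y J) \<le> (K * norm x)\<^sup>2"
    by (rule norm_le_of_cle_of_real[OF positive_star_mult])
  then have "(norm (sum y J))\<^sup>2 \<le> (K * norm x)\<^sup>2" by (simp add: norm_star_mult)
  then have "norm (sum y J) \<le> K * norm x"
    using K by (simp add: power2_le_iff_abs_le)
  then show ?thesis by (simp add: y_def)
qed

section \<open>Matrix units and their expansion at higher levels\<close>

lemma matrix_unit_carrier [simp]: "matrix_unit N i j \<in> carrier_mat N N"
  by (simp add: matrix_unit_def)

lemma matrix_unit_mult: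
  assumes "i < N" "j < N" "k < N" "l < N"
  shows "matrix_unit N i j * matrix_unit N k l = (if j = k then matrix_unit N i l else 0\<^sub>m N N)"
proof (rule eq_matI)
  fix p q assume "p < dim_row (if j = k then matrix_unit N i l else 0\<^sub>m N N)"
    "q < dim_col (if j = k then matrix_unit N i l else 0\<^sub>m N N)"
  then have pq: "p < N" "q < N" by (auto simp: matrix_unit_def split: if_splits)
  have "(matrix_unit N i j * matrix_unit N k l) $$ (p, q)
      = (\<Sum>r<N. matrix_unit N i j $$ (p, r) * matrix_unit N k l $$ (r, q))"
    by (intro index_mult_mat_sum[of _ N N _ N] pq) auto
  also have "\<dots> = (\<Sum>r<N. if r = j then (if p = i \<and> j = k \<and> q = l then 1 else 0) else 0)"
    using pq by (intro sum.cong) (auto simp: matrix_unit_def)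
  also have "\<dots> = (if j = k then matrix_unit N i l else 0\<^sub>m N N) $$ (p, q)"
    using pq assms by (auto simp: matrix_unit_def)
  finally show "(matrix_unit N i j * matrix_unit N k l) $$ (p, q) = \<dots>" .
qed (auto simp: matrix_unit_def)

lemma mat_star_matrix_unit: "mat_star (matrix_unit N i j) = matrix_unit N j i"
  by (rule eq_matI) (auto simp: mat_star_def matrix_unit_def)

lemma block_index_eq_iff:
  fixes i i' r r' N :: nat
  assumes "i < N" "i' < N"
  shows "r * N + i = r' * N + i' \<longleftrightarrow> r = r' \<and> i = i'"
  by (metis add.commute assms div_mult_self3 div_less less_nat_zero_code add_left_cancel
      mod_less mod_mult_self3 add_0_right)

lemma block_index_less:
  fixes i r N M :: nat
  assumes "i < N" "r < M div N" "N dvd M"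
  shows "r * N + i < M"
proof -
  have "r * N + i < Suc r * N" using assms by simp
  also have "\<dots> \<le> (M div N) * N" using assms by (intro mult_right_mono) auto
  finally show ?thesis using assms by simp
qed

lemma sum_lessThan_mult:
  "(\<Sum>s<n. \<Sum>r<k. f (s * k + r)) = (\<Sum>t<n * k. f (t :: nat))"
proof -
  have "sum f {s * k..<s * k + k} = (\<Sum>r<k. f (s * k + r))" for s
    using sum.shift_bounds_nat_ivl[of f 0 "s * k" k] by (simp add: atLeast0LessThan add.commute)
  then show ?thesis using sum.nat_group[of f k n] by simp
qed

locale uhf =
  fixes n :: "nat \<Rightarrow> nat" and \<iota> :: "nat \<Rightarrow> complex mat \<Rightarrow> 'a::unital_cstar_algebra"
  assumes uhf: "uhf_algebra n \<iota>"
begin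

lemma n_pos: "0 < n k" and n_dvd_Suc: "n k dvd n (Suc k)"
  using uhf by (auto simp: uhf_algebra_def)

lemma n_dvd: "k \<le> m \<Longrightarrow> n k dvd n m"
  by (induction m rule: dec_induct) (auto intro: dvd_trans n_dvd_Suc)

lemma
  assumes "x \<in> carrier_mat (n k) (n k)"
  shows \<iota>_add: "y \<in> carrier_mat (n k) (n k) \<Longrightarrow> \<iota> k (x + y) = \<iota> k x + \<iota> k y"
    and \<iota>_mult: "y \<in> carrier_mat (n k) (n k) \<Longrightarrow> \<iota> k (x * y) = \<iota> k x * \<iota> k y"
    and \<iota>_smult: "\<iota> k (c \<cdot>\<^sub>m x) = c *\<^sub>C \<iota> k x"
    and \<iota>_star: "\<iota> k (mat_star x) = star (\<iota> k x)"
    and \<iota>_connect: "\<iota> (Suc k) (uhf_connect n k x) = \<iota> k x"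
  using uhf assms by (auto simp: uhf_algebra_def unital_matrix_star_hom_def)

lemma \<iota>_one: "\<iota> k (1\<^sub>m (n k)) = 1"
  and \<iota>_inj: "inj_on (\<iota> k) (carrier_mat (n k) (n k))"
  using uhf by (auto simp: uhf_algebra_def unital_matrix_star_hom_def)

lemma \<iota>_zero: "\<iota> k (0\<^sub>m (n k) (n k)) = 0"
proof -
  have "0\<^sub>m (n k) (n k) = 0 \<cdot>\<^sub>m (1\<^sub>m (n k) :: complex mat)" by auto
  then show ?thesis by (simp add: \<iota>_smult)
qed

definition E :: "nat \<Rightarrow> nat \<Rightarrow> nat \<Rightarrow> 'a" where
  "E k p q = \<iota> k (matrix_unit (n k) p q)"

lemma E_mult:
  "i < n k \<Longrightarrow> j < n k \<Longrightarrow> p < n k \<Longrightarrow> q < n k \<Longrightarrow>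
    E k i j * E k p q = (if j = p then E k i q else 0)"
  by (simp add: E_def \<iota>_mult[symmetric] matrix_unit_mult \<iota>_zero)

lemma star_E: "star (E k i j) = E k j i"
  by (simp add: E_def \<iota>_star[symmetric] mat_star_matrix_unit)

lemma projection_E: "i < n k \<Longrightarrow> projection (E k i i)"
  by (simp add: projection_def star_E E_mult)

lemma \<iota>_sum_subset:
  assumes "finite J" "J \<subseteq> {..<n k} \<times> {..<n k}"
  shows "\<iota> k (mat (n k) (n k) (\<lambda>ij. if ij \<in> J then c ij else 0)) = (\<Sum>ij\<in>J. c ij *\<^sub>C E k (fst ij) (snd ij))"
  using assms
proof (induction J)
  case empty
  have "mat (n k) (n k) (\<lambda>ij. if ij \<in> {} then c ij else 0) = 0\<^sub>m (n k) (n k)" by auto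
  then show ?case by (simp add: \<iota>_zero)
next
  case (insert ij J)
  have "mat (n k) (n k) (\<lambda>ij'. if ij' \<in> insert ij J then c ij' else 0)
      = c ij \<cdot>\<^sub>m matrix_unit (n k) (fst ij) (snd ij) + mat (n k) (n k) (\<lambda>ij. if ij \<in> J then c ij else 0)"
    using insert by (intro eq_matI) (auto simp: matrix_unit_def)
  then show ?case using insert by (simp add: \<iota>_add \<iota>_smult E_def)
qed

lemma \<iota>_expand:
  assumes "x \<in> carrier_mat (n k) (n k)"
  shows "\<iota> k x = (\<Sum>i<n k. \<Sum>j<n k. x $$ (i, j) *\<^sub>C E k i j)"
proof -
  have "x = mat (n k) (n k) (\<lambda>ij. if ij \<in> {..<n k} \<times> {..<n k} then x $$ ij else 0)"
    using assms by auto
  then have "\<iota> k x = (\<Sum>ij\<in>{..<n k} \<times> {..<n k}. x $$ ij *\<^sub>C E k (fst ij) (snd ij))"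
    using \<iota>_sum_subset[of "{..<n k} \<times> {..<n k}" k "\<lambda>ij. x $$ ij"] by simp
  then show ?thesis by (simp add: sum.cartesian_product case_prod_beta)
qed

lemma sum_E: "(\<Sum>i<n k. E k i i) = 1"
proof -
  have "(\<Sum>i<n k. E k i i) = (\<Sum>i<n k. \<Sum>j<n k. (1\<^sub>m (n k)) $$ (i, j) *\<^sub>C E k i j)"
    by (intro sum.cong refl) (auto simp: if_distrib[of "\<lambda>c. c *\<^sub>C _"] cong: if_cong)
  then show ?thesis using \<iota>_expand[of "1\<^sub>m (n k)" k] by (simp add: \<iota>_one)
qed

lemma E_compress:
  assumes x: "x \<in> carrier_mat (n k) (n k)" and pq: "p < n k" "q < n k"
  shows "E k p p * \<iota> k x * E k q q = x $$ (p, q) *\<^sub>C E k p q"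
proof -
  have "E k p p * \<iota> k x * E k q q = (\<Sum>i<n k. \<Sum>j<n k. x $$ (i, j) *\<^sub>C (E k p p * E k i j * E k q q))"
    by (simp add: \<iota>_expand[OF x] sum_distrib_left sum_distrib_right)
  also have "\<dots> = (\<Sum>i<n k. \<Sum>j<n k. if j = q then (if i = p then x $$ (p, q) *\<^sub>C E k p q else 0) else 0)"
    using pq by (intro sum.cong refl) (auto simp: E_mult)
  also have "\<dots> = x $$ (p, q) *\<^sub>C E k p q" using pq by simp
  finally show ?thesis .
qed

lemma norm_E_diag: "p < n k \<Longrightarrow> norm (E k p p) = 1"
proof -
  assume p: "p < n k"
  have "matrix_unit (n k) p p \<noteq> 0\<^sub>m (n k) (n k)"
  proof
    assume "matrix_unit (n k) p p = 0\<^sub>m (n k) (n k)"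
    then have "matrix_unit (n k) p p $$ (p, p) = 0\<^sub>m (n k) (n k) $$ (p, p)" by simp
    then show False using p by (simp add: matrix_unit_def)
  qed
  then have "E k p p \<noteq> 0"
    using inj_onD[OF \<iota>_inj, of k "matrix_unit (n k) p p" "0\<^sub>m (n k) (n k)"] by (auto simp: E_def \<iota>_zero)
  moreover have "(norm (E k p p))\<^sup>2 = norm (E k p p)"
    using projection_E[OF p] by (metis norm_star_mult projection_def)
  ultimately show ?thesis by (simp add: power2_eq_square)
qed

lemma norm_E: "p < n k \<Longrightarrow> q < n k \<Longrightarrow> norm (E k p q) = 1"
  using norm_star_mult[of "E k p q"] norm_E_diag[of q k] 
  by (auto simp: star_E E_mult power2_eq_1_iff dest: order_trans[OF norm_ge_zero eq_refl])

lemma sum_E_cle_1: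
  assumes "inj_on p J" "finite J" "\<And>r. r \<in> J \<Longrightarrow> p r < n k"
  shows "(\<Sum>r\<in>J. E k (p r) (p r)) \<preceq> 1"
proof -
  have "(\<Sum>r\<in>J. E k (p r) (p r)) = (\<Sum>i\<in>p ` J. E k i i)" using assms by (simp add: sum.reindex)
  moreover have "1 - (\<Sum>i\<in>p ` J. E k i i) = (\<Sum>i\<in>{..<n k} - p ` J. E k i i)"
    using assms by (subst sum_diff) (auto simp: sum_E)
  moreover have "positive (\<Sum>i\<in>{..<n k} - p ` J. E k i i)"
    by (intro positive_sum positive_projection projection_E) auto
  ultimately show ?thesis by (simp add: cle_def)
qed

lemma E_Suc:
  assumes "i < n k" "j < n k"
  shows "E k i j = (\<Sum>r < n (Suc k) div n k. E (Suc k) (r * n k + i) (r * n k + j))"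
proof -
  let ?N = "n k" and ?M = "n (Suc k)"
  let ?J = "(\<lambda>r. (r * ?N + i, r * ?N + j)) ` {..<?M div ?N}"
  have sub: "?J \<subseteq> {..<?M} \<times> {..<?M}"
    using assms by (auto intro: block_index_less n_dvd_Suc)
  have inj: "inj_on (\<lambda>r. (r * ?N + i, r * ?N + j)) {..<?M div ?N}"
    using n_pos[of k] by (auto simp: inj_on_def)
  have "uhf_connect n k (matrix_unit ?N i j) = mat ?M ?M (\<lambda>pq. if pq \<in> ?J then 1 else 0)"
  proof (rule eq_matI)
    fix p q assume "p < dim_row (mat ?M ?M (\<lambda>pq. if pq \<in> ?J then 1 else (0::complex)))"
      "q < dim_col (mat ?M ?M (\<lambda>pq. if pq \<in> ?J then 1 else (0::complex)))"
    then have pq: "p < ?M" "q < ?M" by auto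
    have "uhf_connect n k (matrix_unit ?N i j) $$ (p, q)
       = (\<Sum>r < ?M div ?N. if (p, q) = (r * ?N + i, r * ?N + j) then 1 else 0)"
      unfolding uhf_connect_matrix_unit[OF n_dvd_Suc assms pq]
      using pq by (intro sum.cong) (auto simp: matrix_unit_def)
    also have "\<dots> = (\<Sum>r < ?M div ?N. if r = p div ?N \<and> (p, q) = (r * ?N + i, r * ?N + j) then 1 else 0)"
    proof -
      have "r = p div ?N" if "p = r * ?N + i" for r using assms that by simp
      then show ?thesis by (intro sum.cong refl if_cong) auto
    qed
    also have "\<dots> = (if (p, q) \<in> ?J then 1 else 0)"
    proof (cases "(p, q) \<in> ?J")
      case True
      then obtain r where r: "r < ?M div ?N" "p = r * ?N + i" "q = r * ?N + j" by auto
      have "(\<Sum>r < ?M div ?N. if r = p div ?N \<and> (p, q) = (r * ?N + i, r * ?N + j) then 1 else (0::complex))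
          = (\<Sum>r' < ?M div ?N. if r' = r then 1 else 0)"
        using r assms by (intro sum.cong) (auto simp: div_mult_self3)
      then show ?thesis using True r by (simp del: split_paired_All)
    next
      case False
      then have "(\<Sum>r < ?M div ?N. if r = p div ?N \<and> (p, q) = (r * ?N + i, r * ?N + j) then 1 else (0::complex)) = 0"
        by (intro sum.neutral) auto
      then show ?thesis using False by simp
    qed
    also have "\<dots> = mat ?M ?M (\<lambda>pq. if pq \<in> ?J then 1 else 0) $$ (p, q)" using pq by simp
    finally show "uhf_connect n k (matrix_unit ?N i j) $$ (p, q)
       = mat ?M ?M (\<lambda>pq. if pq \<in> ?J then 1 else 0) $$ (p, q)" .
  qed (auto simp: uhf_connect_def)
  then have "E k i j = \<iota> (Suc k) (mat ?M ?M (\<lambda>pq. if pq \<in> ?J then 1 else 0))"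
    using \<iota>_connect[of "matrix_unit ?N i j" k] by (simp add: E_def)
  also have "\<dots> = (\<Sum>pq\<in>?J. 1 *\<^sub>C E (Suc k) (fst pq) (snd pq))"
    using sub by (intro \<iota>_sum_subset) auto
  also have "\<dots> = (\<Sum>r < ?M div ?N. E (Suc k) (r * ?N + i) (r * ?N + j))"
    by (simp add: sum.reindex[OF inj])
  finally show ?thesis .
qed

lemma E_expand:
  assumes "k \<le> m" "i < n k" "j < n k"
  shows "E k i j = (\<Sum>r < n m div n k. E m (r * n k + i) (r * n k + j))"
  using assms(1)
proof (induction m rule: dec_induct)
  case base
  then show ?case using n_pos[of k] by simp
next
  case (step m)
  let ?N = "n k" and ?M = "n m" and ?L = "n (Suc m)"
  obtain R where R: "?M = R * ?N" using n_dvd[OF step(1)] by (metis dvdE mult.commute)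
  obtain T where T: "?L = T * ?M" using n_dvd_Suc[of m] by (metis dvdE mult.commute)
  have div: "?M div ?N = R" "?L div ?M = T" "?L div ?N = T * R"
    using n_pos[of k] n_pos[of m] R T by auto
  have "E k i j = (\<Sum>r < R. E m (r * ?N + i) (r * ?N + j))" using step.IH by (simp add: div)
  also have "\<dots> = (\<Sum>r < R. \<Sum>s < T.
      E (Suc m) (s * ?M + (r * ?N + i)) (s * ?M + (r * ?N + j)))"
  proof (intro sum.cong refl)
    fix r assume "r \<in> {..<R}"
    then have "r * ?N + i < ?M" "r * ?N + j < ?M"
      using assms n_dvd[OF step(1)] by (auto simp: div intro!: block_index_less)
    then show "E m (r * ?N + i) (r * ?N + j)
        = (\<Sum>s < T. E (Suc m) (s * ?M + (r * ?N + i)) (s * ?M + (r * ?N + j)))"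
      by (simp add: E_Suc div)
  qed
  also have "\<dots> = (\<Sum>s < T. \<Sum>r < R.
      E (Suc m) (s * ?M + (r * ?N + i)) (s * ?M + (r * ?N + j)))"
    by (rule sum.swap)
  \<comment> \<open>Block \<open>r\<close> of level \<open>k\<close> inside block \<open>s\<close>
    of level \<open>m\<close> is block \<open>s * R + r\<close> counted from the start.\<close>
  also have "\<dots> = (\<Sum>s < T. \<Sum>r < R. E (Suc m) ((s * R + r) * ?N + i) ((s * R + r) * ?N + j))"
    by (simp add: R add_mult_distrib mult.assoc add.assoc)
  also have "\<dots> = (\<Sum>t < T * R. E (Suc m) (t * ?N + i) (t * ?N + j))"
    by (rule sum_lessThan_mult)
  finally show ?case by (simp add: div)
qed

lemma A_mono:
  assumes "k \<le> m"
  shows "\<iota> k ` carrier_mat (n k) (n k) \<subseteq> \<iota> m ` carrier_mat (n m) (n m)"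
  using assms
proof (induction m rule: dec_induct)
  case (step m)
  have "\<iota> m ` carrier_mat (n m) (n m) \<subseteq> \<iota> (Suc m) ` carrier_mat (n (Suc m)) (n (Suc m))"
  proof (intro image_subsetI)
    fix x :: "complex mat" assume "x \<in> carrier_mat (n m) (n m)"
    then have "\<iota> m x = \<iota> (Suc m) (uhf_connect n m x)" by (simp add: \<iota>_connect)
    then show "\<iota> m x \<in> \<iota> (Suc m) ` carrier_mat (n (Suc m)) (n (Suc m))"
      by (auto simp: uhf_connect_def)
  qed
  then show ?case using step.IH by blast
qed simp

lemma approx:
  assumes "0 < \<epsilon>"
  obtains m b where "k \<le> m" "b \<in> carrier_mat (n m) (n m)" "norm (x - \<iota> m b) < \<epsilon>"
proof -
  have "x \<in> closure (\<Union>k. \<iota> k ` carrier_mat (n k) (n k))" using uhf by (simp add: uhf_algebra_def)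
  then obtain y where "y \<in> (\<Union>k. \<iota> k ` carrier_mat (n k) (n k))" and yx: "dist y x < \<epsilon>"
    using assms unfolding closure_approachable by blast
  then obtain j where y: "y \<in> \<iota> j ` carrier_mat (n j) (n j)" by blast
  have "y \<in> \<iota> (max j k) ` carrier_mat (n (max j k)) (n (max j k))"
    using A_mono[of j "max j k"] y by auto
  then show thesis using that[of "max j k"] yx by (auto simp: dist_norm norm_minus_commute)
qed

lemma E_diag_sum_in_masa:
  assumes "finite J" "\<And>r. r \<in> J \<Longrightarrow> p r < n k" "inj_on p J"
  shows "(\<Sum>r\<in>J. c r *\<^sub>C E k (p r) (p r)) \<in> canonical_masa n \<iota>"
proof -
  define Q where "Q = (\<lambda>r. (p r, p r)) ` J"
  define d where "d = mat (n k) (n k) (\<lambda>ij. if ij \<in> Q then c (the_inv_into J p (fst ij)) else 0)"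
  have "\<iota> k d = (\<Sum>ij\<in>Q. c (the_inv_into J p (fst ij)) *\<^sub>C E k (fst ij) (snd ij))"
    unfolding d_def using assms by (intro \<iota>_sum_subset) (auto simp: Q_def)
  also have "\<dots> = (\<Sum>r\<in>J. c r *\<^sub>C E k (p r) (p r))"
    unfolding Q_def using assms
    by (subst sum.reindex) (auto simp: inj_on_def the_inv_into_f_f intro!: sum.cong)
  finally have "(\<Sum>r\<in>J. c r *\<^sub>C E k (p r) (p r)) = \<iota> k d" by simp
  moreover have "d \<in> carrier_mat (n k) (n k)" "diagonal_mat d"
    by (auto simp: d_def diagonal_mat_def Q_def)
  ultimately show ?thesis
    unfolding canonical_masa_def by (intro subsetD[OF closure_subset]) blast
qed

lemma E_in_masa: "p < n k \<Longrightarrow> E k p p \<in> canonical_masa n \<iota>"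
  using E_diag_sum_in_masa[of "{()}" "\<lambda>_. p" k "\<lambda>_. 1"] by simp

lemma one_in_masa: "1 \<in> canonical_masa n \<iota>"
  using E_diag_sum_in_masa[of "{..<n 0}" "\<lambda>r. r" 0 "\<lambda>_. 1"] by (simp add: sum_E)

end

locale uhf_system = uhf n \<iota>
  for n :: "nat \<Rightarrow> nat" and \<iota> :: "nat \<Rightarrow> complex mat \<Rightarrow> 'a::unital_cstar_algebra" +
  fixes S :: "'a set"
  assumes system: "concrete_operator_system_over (canonical_masa n \<iota>) S"
begin

lemma S_add: "x \<in> S \<Longrightarrow> y \<in> S \<Longrightarrow> x + y \<in> S"
  and S_scaleC: "x \<in> S \<Longrightarrow> c *\<^sub>C x \<in> S"
  and S_0: "0 \<in> S"
  and S_closed: "closed S"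
  and S_star: "x \<in> S \<Longrightarrow> star x \<in> S"
  and masa_subset_S: "canonical_masa n \<iota> \<subseteq> S"
  and S_bimodule: "d \<in> canonical_masa n \<iota> \<Longrightarrow> x \<in> S \<Longrightarrow> d' \<in> canonical_masa n \<iota> \<Longrightarrow> d * x * d' \<in> S"
  using system by (auto simp: concrete_operator_system_over_def csubspace_def)

lemma S_sum: "(\<And>i. i \<in> J \<Longrightarrow> f i \<in> S) \<Longrightarrow> sum f J \<in> S"
  by (induction J rule: infinite_finite_induct) (auto simp: S_0 S_add)

lemma S_diff: "x \<in> S \<Longrightarrow> y \<in> S \<Longrightarrow> x - y \<in> S"
  using S_add[of x "(-1) *\<^sub>C y"] S_scaleC[of y "-1"] by (simp add: scaleC.scale_minus_left)

lemma one_in_S: "1 \<in> S"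
  using one_in_masa masa_subset_S by auto

text \<open>
  The compression of \<open>s\<close> to the corner of \<open>E m p q\<close> is close to a nonzero multiple of \<open>E m p q\<close>, and
  compressing it further by the diagonal of a high level turns it into \<open>d * E m p q\<close> up to a small
  error, where \<open>d\<close> is an invertible diagonal element of the corner; dividing by \<open>d\<close> stays in the bimodule.
\<close>

lemma matrix_unit_mem:
  assumes s: "s \<in> S" and b: "b \<in> carrier_mat (n m) (n m)" and near: "norm (s - \<iota> m b) < cmod (b $$ (p, q))"
    and pq: "p < n m" "q < n m"
  shows "E m p q \<in> S"
proof -
  define c where "c = b $$ (p, q)"
  define \<gamma> where "\<gamma> = cmod c - norm (s - \<iota> m b)"
  have \<gamma>: "\<gamma> > 0" using near by (simp add: \<gamma>_def c_def)
  define x where "x = E m p p * s * E m q q"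
  have x: "x \<in> S" unfolding x_def by (intro S_bimodule s E_in_masa pq)
  have "x - c *\<^sub>C E m p q = E m p p * (s - \<iota> m b) * E m q q"
    using E_compress[OF b pq] by (simp add: x_def c_def algebra_simps)
  then have "norm (x - c *\<^sub>C E m p q) \<le> norm (E m p p) * norm (s - \<iota> m b) * norm (E m q q)"
    by (simp only: norm_mult3_ineq)
  then have xc: "norm (x - c *\<^sub>C E m p q) \<le> cmod c - \<gamma>"
    using pq by (simp add: norm_E_diag \<gamma>_def)
  have "E m p q \<in> closure S"
  proof (unfold closure_approachable, intro allI impI)
    fix \<epsilon> :: real assume \<epsilon>: "0 < \<epsilon>"
    \<comment> \<open>The bound \<open>\<gamma> / 2\<close> keeps the entries \<open>d r\<close> at
      modulus at least \<open>\<gamma> / 2\<close>, so dividing by them costs a factor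
      \<open>2 / \<gamma>\<close>; the bound \<open>\<epsilon> * \<gamma> / 4\<close> reduces the
      error after division to \<open>\<epsilon> / 2\<close>.\<close>
    define \<delta> where "\<delta> = min (\<gamma> / 2) (\<epsilon> * \<gamma> / 4)"
    have \<delta>: "0 < \<delta>" using \<gamma> \<epsilon> by (simp add: \<delta>_def)
    obtain M y where y: "m \<le> M" "y \<in> carrier_mat (n M) (n M)" "norm (x - \<iota> M y) < \<delta>"
      using approx[OF \<delta>] by metis
    define N where "N = n m"
    define L where "L = n M div N"
    define f where "f i r = E M (r * N + i) (r * N + i)" for i r
    have lt: "r * N + i < n M" if "r < L" "i < N" for r i
      using that n_dvd[OF y(1)] by (auto simp: L_def N_def intro: block_index_less)
    have eq_iff: "r * N + i = r' * N + i' \<longleftrightarrow> r = r' \<and> i = i'" if "i < N" "i' < N" for i i' r r'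
      using that by (rule block_index_eq_iff)
    have pN: "p < N" "q < N" using pq by (simp_all add: N_def)
    define v where "v r = E M (r * N + p) (r * N + q)" for r
    have Epq: "E m p q = (\<Sum>r<L. v r)"
      using E_expand[OF y(1) pq] by (simp add: L_def N_def v_def)
    have fE: "f p r * E m p q * f q r = v r" if r: "r < L" for r
    proof -
      have "f p r * E m p q * f q r = (\<Sum>r'<L. f p r * v r' * f q r)"
        by (simp add: Epq sum_distrib_left sum_distrib_right)
      also have "\<dots> = (\<Sum>r'<L. if r' = r then v r else 0)"
        using r lt pN by (intro sum.cong refl) (auto simp: f_def v_def E_mult)
      finally show ?thesis using r by simp
    qed
    define d where "d r = y $$ (r * N + p, r * N + q)" for r
    have fy: "f p r * \<iota> M y * f q r = d r *\<^sub>C v r" if "r < L" for r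
      unfolding f_def d_def v_def using that lt pN by (intro E_compress[OF y(2)]) auto
    have proj: "projection (f i r)" if "r < L" "i < N" for i r
      using that lt by (simp add: f_def projection_E)
    have orth: "f i r * f i s = 0" if "r < L" "s < L" "r \<noteq> s" "i < N" for i r s
      using that lt by (simp add: f_def E_mult)
    have le1: "(\<Sum>r<L. f i r) \<preceq> 1" if "i < N" for i
      unfolding f_def using that lt eq_iff by (intro sum_E_cle_1) (auto simp: inj_on_def)
    have dr: "cmod (d r) \<ge> \<gamma> / 2" if r: "r < L" for r
    proof -
      have "(d r - c) *\<^sub>C v r = f p r * (\<iota> M y - c *\<^sub>C E m p q) * f q r"
        using fy[OF r] fE[OF r] by (simp add: algebra_simps scaleC.scale_left_diff_distrib)
      then have "norm ((d r - c) *\<^sub>C v r) \<le> norm (f p r) * norm (\<iota> M y - c *\<^sub>C E m p q) * norm (f q r)"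
        by (simp only: norm_mult3_ineq)
      then have "cmod (d r - c) \<le> norm (\<iota> M y - c *\<^sub>C E m p q)"
        using r lt pN by (simp add: norm_scaleC v_def f_def norm_E norm_E_diag)
      also have "\<dots> \<le> norm (\<iota> M y - x) + norm (x - c *\<^sub>C E m p q)"
        using norm_triangle_ineq[of "\<iota> M y - x" "x - c *\<^sub>C E m p q"] by simp
      also have "\<dots> \<le> \<delta> + (cmod c - \<gamma>)" using y(3) xc by (simp add: norm_minus_commute)
      also have "\<dots> \<le> cmod c - \<gamma> / 2" by (simp add: \<delta>_def)
      finally show ?thesis using norm_triangle_ineq2[of c "d r"] by (simp add: norm_minus_commute)
    qed
    \<comment> \<open>Each corner \<open>f p r * x * f q r\<close> is close to \<open>d r\<close>
      times \<open>v r\<close>, and the \<open>v r\<close> add up to \<open>E m p q\<close>. The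
      corners themselves belong to \<open>S\<close>, unlike the approximant
      \<open>y\<close>.\<close>
    define z where "z = (\<Sum>r<L. (1 / d r) *\<^sub>C (f p r * x * f q r))"
    have "z \<in> S"
      unfolding z_def f_def using lt pN by (intro S_sum S_scaleC S_bimodule x E_in_masa) auto
    moreover have "norm (z - E m p q) < \<epsilon>"
    proof -
      have "z - E m p q = (\<Sum>r<L. (1 / d r) *\<^sub>C (f p r * (x - \<iota> M y) * f q r))"
      proof -
        have "(1 / d r) *\<^sub>C (f p r * (x - \<iota> M y) * f q r) = (1 / d r) *\<^sub>C (f p r * x * f q r) - v r"
          if r: "r < L" for r
        proof -
          have "d r \<noteq> 0" using dr[OF r] \<gamma> by auto
          have "f p r * (x - \<iota> M y) * f q r = f p r * x * f q r - d r *\<^sub>C v r"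
            using fy[OF r] by (simp add: algebra_simps)
          then show ?thesis using \<open>d r \<noteq> 0\<close> by (simp add: scaleC.scale_right_diff_distrib scaleC_scaleC)
        qed
        then show ?thesis by (simp add: z_def Epq sum_subtractf)
      qed
      then have "norm (z - E m p q) \<le> (2 / \<gamma>) * norm (x - \<iota> M y)"
      proof (simp only:, intro norm_compression_le)
        fix r assume r: "r \<in> {..<L}"
        show "cmod (1 / d r) \<le> 2 / \<gamma>"
          using dr[of r] r \<gamma> by (simp add: norm_divide divide_simps)
      qed (use proj orth le1 pN \<gamma> in auto)
      also have "\<dots> \<le> (2 / \<gamma>) * \<delta>" using y(3) \<gamma> by (intro mult_left_mono) auto
      also have "\<dots> \<le> (2 / \<gamma>) * (\<epsilon> * \<gamma> / 4)" using \<gamma> by (intro mult_left_mono) (auto simp: \<delta>_def)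
      also have "\<dots> < \<epsilon>" using \<gamma> \<epsilon> by simp
      finally show ?thesis .
    qed
    ultimately show "\<exists>z\<in>S. dist z (E m p q) < \<epsilon>" by (auto simp: dist_norm)
  qed
  then show ?thesis using S_closed by simp
qed

definition units :: "nat \<Rightarrow> 'a set" where
  "units m = {E m p q |p q. p < n m \<and> q < n m \<and> E m p q \<in> S}"

text \<open>
  Thresholding the entries of an approximant at level \<open>m\<close> is only harmless after compressing to the
  blocks of a fixed level \<open>k\<close>: the discarded part is then a sum of \<open>n k * n k\<close> weighted partial
  isometries, whatever \<open>m\<close> is.
\<close>

lemma span_units_dense:
  assumes s: "s \<in> S" and \<epsilon>: "0 < \<epsilon>"
  obtains m t where "t \<in> scaleC.span (units m)" "norm (s - t) < \<epsilon>"
proof -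
  obtain k a where a: "a \<in> carrier_mat (n k) (n k)" "norm (s - \<iota> k a) < \<epsilon> / 4"
    using approx[of "\<epsilon> / 4"] \<epsilon> by (metis zero_less_divide_iff zero_less_numeral)
  define N where "N = n k"
  have N: "N > 0" by (simp add: N_def n_pos)
  \<comment> \<open>There will be \<open>N * N\<close> discarded sums, each of norm at most
    \<open>\<eta>\<close>, for a total of \<open>\<epsilon> / 4\<close>.\<close>
  define \<eta> where "\<eta> = \<epsilon> / (4 * real N * real N)"
  have \<eta>: "0 < \<eta>" using \<epsilon> N by (simp add: \<eta>_def)
  obtain m b where b: "k \<le> m" "b \<in> carrier_mat (n m) (n m)" "norm (s - \<iota> m b) < min \<eta> (\<epsilon> / 4)"
    using approx[of "min \<eta> (\<epsilon> / 4)" k] \<eta> \<epsilon> by (metis min_less_iff_conj zero_less_divide_iff zero_less_numeral)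
  define L where "L = n m div N"
  have lt: "r * N + i < n m" if "r < L" "i < N" for r i
    using that n_dvd[OF b(1)] by (auto simp: L_def N_def intro: block_index_less)
  have eq_iff: "r * N + i = r' * N + i' \<longleftrightarrow> r = r' \<and> i = i'" if "i < N" "i' < N" for i i' r r'
    using that by (rule block_index_eq_iff)
  define f where "f i r = E m (r * N + i) (r * N + i)" for i r
  define g where "g r = (\<Sum>i<N. f i r)" for r
  have f_mult: "f i r * f j s = (if r = s \<and> i = j then f i r else 0)" if "r < L" "s < L" "i < N" "j < N" for i j r s
    using that lt eq_iff by (auto simp: f_def E_mult)
  have proj: "projection (f i r)" if "r < L" "i < N" for i r
    using that lt by (simp add: f_def projection_E)
  have g_mult: "g r * g s = (if r = s then g r else 0)" if "r < L" "s < L" for r s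
  proof -
    have "g r * g s = (\<Sum>i<N. \<Sum>j<N. f i r * f j s)" by (simp add: g_def sum_product)
    also have "\<dots> = (\<Sum>i<N. \<Sum>j<N. if j = i then (if r = s then f i r else 0) else 0)"
      using that f_mult by (intro sum.cong refl) auto
    also have "\<dots> = (\<Sum>i<N. if r = s then f i r else 0)" by simp
    finally show ?thesis by (simp add: g_def)
  qed
  have g_proj: "projection (g r)" if "r < L" for r
  proof -
    have "star (g r) = g r" using proj[OF that] by (simp add: g_def star_sum projection_def)
    then show ?thesis using g_mult[OF that that] by (simp add: projection_def)
  qed
  have sum_g: "(\<Sum>r<L. g r) = 1"
  proof -
    have "(\<Sum>r<L. g r) = (\<Sum>i<N. \<Sum>r<L. f i r)" unfolding g_def by (rule sum.swap)
    also have "\<dots> = (\<Sum>i<N. E k i i)"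
      using E_expand[OF b(1)] by (intro sum.cong) (auto simp: f_def N_def L_def)
    finally show ?thesis by (simp add: N_def sum_E)
  qed
  \<comment> \<open>Compression to the diagonal blocks of size \<open>N\<close> at level
    \<open>m\<close>. Elements of level \<open>k\<close> repeat along these blocks and are fixed, so
    \<open>\<Psi> s\<close> is still close to \<open>s\<close>. The factor 1 only matches the shape
    of \<open>norm_compression_le\<close>.\<close>
  define \<Psi> where "\<Psi> x = (\<Sum>r<L. 1 *\<^sub>C (g r * x * g r))" for x
  have \<Psi>_le: "norm (\<Psi> x) \<le> norm x" for x
    using norm_compression_le[of "{..<L}" g g "\<lambda>_. 1" 1 x] g_proj g_mult sum_g by (simp add: \<Psi>_def)
  have \<Psi>_diff: "\<Psi> (x - y) = \<Psi> x - \<Psi> y" for x y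
    by (simp add: \<Psi>_def algebra_simps sum_subtractf)
  have f_E: "f i' r * E k i j = (if i' = i then E m (r * N + i) (r * N + j) else 0)"
    and E_f: "E k i j * f i' r = (if i' = j then E m (r * N + i) (r * N + j) else 0)"
    if "r < L" "i < N" "j < N" "i' < N" for r i j i'
  proof -
    have e: "E k i j = (\<Sum>r'<L. E m (r' * N + i) (r' * N + j))"
      using E_expand[OF b(1)] that by (simp add: L_def N_def)
    have "f i' r * E k i j = (\<Sum>r'<L. if r' = r then (if i' = i then E m (r * N + i) (r * N + j) else 0) else 0)"
      unfolding e sum_distrib_left f_def using that lt eq_iff by (intro sum.cong refl) (auto simp: E_mult)
    then show "f i' r * E k i j = (if i' = i then E m (r * N + i) (r * N + j) else 0)" using that by simp
    have "E k i j * f i' r = (\<Sum>r'<L. if r' = r then (if i' = j then E m (r * N + i) (r * N + j) else 0) else 0)"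
      unfolding e sum_distrib_right f_def using that lt eq_iff by (intro sum.cong refl) (auto simp: E_mult)
    then show "E k i j * f i' r = (if i' = j then E m (r * N + i) (r * N + j) else 0)" using that by simp
  qed
  have g_E: "g r * E k i j = E k i j * g r" if "r < L" "i < N" "j < N" for r i j
    using that by (simp add: g_def sum_distrib_left sum_distrib_right f_E E_f)
  have g_a: "g r * \<iota> k a = \<iota> k a * g r" if "r < L" for r
    using that g_E by (simp add: \<iota>_expand[OF a(1)] sum_distrib_left sum_distrib_right flip: N_def)
  have \<Psi>_a: "\<Psi> (\<iota> k a) = \<iota> k a"
  proof -
    have "\<Psi> (\<iota> k a) = (\<Sum>r<L. \<iota> k a * (g r * g r))"
      unfolding \<Psi>_def using g_a by (intro sum.cong) (auto simp: mult.assoc)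
    also have "\<dots> = (\<Sum>r<L. \<iota> k a * g r)" using g_mult by (intro sum.cong) auto
    finally show ?thesis by (simp add: sum_g flip: sum_distrib_left)
  qed
  define B where "B r i j = b $$ (r * N + i, r * N + j)" for r i j
  define U where "U r i j = E m (r * N + i) (r * N + j)" for r i j
  have \<Psi>_b: "\<Psi> (\<iota> m b) = (\<Sum>i<N. \<Sum>j<N. \<Sum>r<L. B r i j *\<^sub>C U r i j)"
  proof -
    have "\<Psi> (\<iota> m b) = (\<Sum>r<L. \<Sum>j<N. \<Sum>i<N. f i r * \<iota> m b * f j r)"
      by (simp add: \<Psi>_def g_def sum_distrib_left sum_distrib_right)
    also have "\<dots> = (\<Sum>r<L. \<Sum>j<N. \<Sum>i<N. B r i j *\<^sub>C U r i j)"
      unfolding f_def B_def U_def using lt by (intro sum.cong refl E_compress[OF b(2)]) auto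
    also have "\<dots> = (\<Sum>j<N. \<Sum>r<L. \<Sum>i<N. B r i j *\<^sub>C U r i j)" by (rule sum.swap)
    also have "\<dots> = (\<Sum>j<N. \<Sum>i<N. \<Sum>r<L. B r i j *\<^sub>C U r i j)"
      by (intro sum.cong refl sum.swap)
    also have "\<dots> = (\<Sum>i<N. \<Sum>j<N. \<Sum>r<L. B r i j *\<^sub>C U r i j)" by (rule sum.swap)
    finally show ?thesis .
  qed
  \<comment> \<open>An entry of modulus at least \<open>\<eta>\<close> exceeds the approximation
    error, so \<open>matrix_unit_mem\<close> puts its matrix unit into \<open>S\<close>.\<close>
  define B1 where "B1 r i j = (if \<eta> \<le> cmod (B r i j) then B r i j else 0)" for r i j
  define B2 where "B2 r i j = (if \<eta> \<le> cmod (B r i j) then 0 else B r i j)" for r i j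
  define t where "t = (\<Sum>i<N. \<Sum>j<N. \<Sum>r<L. B1 r i j *\<^sub>C U r i j)"
  have t: "t \<in> scaleC.span (units m)"
    unfolding t_def
  proof (intro scaleC.span_sum)
    fix i j r assume "i \<in> {..<N}" "j \<in> {..<N}" "r \<in> {..<L}"
    then have ij: "i < N" "j < N" "r < L" by auto
    show "B1 r i j *\<^sub>C U r i j \<in> scaleC.span (units m)"
    proof (cases "\<eta> \<le> cmod (B r i j)")
      case True
      then have "U r i j \<in> S"
        unfolding U_def using b lt ij by (intro matrix_unit_mem[OF s b(2)]) (auto simp: B_def)
      then have "U r i j \<in> units m" using lt ij by (auto simp: units_def U_def)
      then show ?thesis by (intro scaleC.span_scale scaleC.span_base)
    next
      case False
      then show ?thesis by (simp add: B1_def scaleC.span_zero)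
    qed
  qed
  have "norm (\<Psi> (\<iota> m b) - t) \<le> \<epsilon> / 4"
  proof -
    have "\<Psi> (\<iota> m b) - t = (\<Sum>i<N. \<Sum>j<N. \<Sum>r<L. B2 r i j *\<^sub>C U r i j)"
      unfolding \<Psi>_b t_def sum_subtractf[symmetric]
      by (intro sum.cong refl) (auto simp: B1_def B2_def)
    also have "norm \<dots> \<le> (\<Sum>i\<in>{..<N}. \<Sum>j\<in>{..<N}. \<eta>)"
    proof (rule sum_norm_le, rule sum_norm_le)
      fix i j assume "i \<in> {..<N}" "j \<in> {..<N}"
      then have ij: "i < N" "j < N" by auto
      \<comment> \<open>For fixed \<open>i\<close> and \<open>j\<close> all these matrix units are
        corners of the single element \<open>E k i j\<close>, so the whole sum is no larger than its
        largest coefficient.\<close>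
      have "(\<Sum>r<L. B2 r i j *\<^sub>C U r i j) = (\<Sum>r<L. B2 r i j *\<^sub>C (f i r * E k i j * f j r))"
        using ij lt by (intro sum.cong refl) (simp add: f_E, simp add: U_def f_def E_mult)
      also have "norm \<dots> \<le> \<eta> * norm (E k i j)"
      proof (rule norm_compression_le)
        show "(\<Sum>r<L. f j r) \<preceq> 1"
          unfolding f_def using ij lt eq_iff by (intro sum_E_cle_1) (auto simp: inj_on_def)
      qed (use ij proj f_mult \<eta> in \<open>auto simp: B2_def\<close>)
      finally show "norm (\<Sum>r<L. B2 r i j *\<^sub>C U r i j) \<le> \<eta>"
        using ij by (simp add: norm_E N_def)
    qed
    also have "\<dots> = \<epsilon> / 4" using N by (simp add: \<eta>_def)
    finally show ?thesis .
  qed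
  moreover have "norm (\<Psi> s - \<Psi> (\<iota> m b)) < \<epsilon> / 4"
    using \<Psi>_le[of "s - \<iota> m b"] b(3) by (simp add: \<Psi>_diff)
  moreover have "norm (\<iota> k a - \<Psi> s) < \<epsilon> / 4"
    using \<Psi>_le[of "\<iota> k a - s"] a(2) by (simp add: \<Psi>_diff \<Psi>_a norm_minus_commute)
  moreover have "norm (s - t) \<le> norm (s - \<iota> k a) + norm (\<iota> k a - \<Psi> s)
      + norm (\<Psi> s - \<Psi> (\<iota> m b)) + norm (\<Psi> (\<iota> m b) - t)"
    using norm_triangle_ineq[of "s - \<iota> k a" "\<iota> k a - t"]
      norm_triangle_ineq[of "\<iota> k a - \<Psi> s" "\<Psi> s - t"]
      norm_triangle_ineq[of "\<Psi> s - \<Psi> (\<iota> m b)" "\<Psi> (\<iota> m b) - t"] by simp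
  ultimately have "norm (s - t) < \<epsilon>" using a(2) by linarith
  with t show thesis by (rule that)
qed

end

section \<open>Generation by unitaries\<close>

context uhf
begin

definition A :: "nat \<Rightarrow> 'a set" where
  "A k = \<iota> k ` carrier_mat (n k) (n k)"

lemma A_add: "x \<in> A k \<Longrightarrow> y \<in> A k \<Longrightarrow> x + y \<in> A k"
  unfolding A_def by clarify (metis \<iota>_add add_carrier_mat image_eqI)

lemma A_scaleC: "x \<in> A k \<Longrightarrow> c *\<^sub>C x \<in> A k"
  unfolding A_def by clarify (metis \<iota>_smult smult_carrier_mat image_eqI)

lemma A_diff: "x \<in> A k \<Longrightarrow> y \<in> A k \<Longrightarrow> x - y \<in> A k"
  using A_add[of x k "(-1) *\<^sub>C y"] A_scaleC[of y k "-1"] by (simp add: scaleC.scale_minus_left)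

lemma A_star: "x \<in> A k \<Longrightarrow> star x \<in> A k"
proof -
  assume "x \<in> A k"
  then obtain a where a: "a \<in> carrier_mat (n k) (n k)" "x = \<iota> k a" by (auto simp: A_def)
  have "mat_star a \<in> carrier_mat (n k) (n k)" using a by (auto simp: mat_star_def)
  then show ?thesis unfolding A_def a(2) \<iota>_star[OF a(1), symmetric] by (rule imageI)
qed

lemma one_in_A: "1 \<in> A k"
  unfolding A_def using \<iota>_one[of k] by (metis imageI one_carrier_mat)

lemma E_in_A: "E k p q \<in> A k"
  by (auto simp: A_def E_def)

end

context uhf_system
begin

definition V :: "nat \<Rightarrow> 'a set" where
  "V k = {u \<in> S \<inter> A k. star u * u = 1 \<and> u * star u = 1}"

lemma V_mono: "k \<le> m \<Longrightarrow> V k \<subseteq> V m"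
  using A_mono[of k m] unfolding V_def A_def by blast

lemma star_in_V: "u \<in> V k \<Longrightarrow> star u \<in> V k"
  by (auto simp: V_def S_star A_star)

lemma reflection_in_V:
  assumes "p < n k"
  shows "1 - 2 *\<^sub>C E k p p \<in> V k"
proof -
  define x where "x = 1 - 2 *\<^sub>C E k p p"
  have E: "E k p p \<in> S" using E_in_masa[OF assms] masa_subset_S by auto
  have "star x = x" by (simp add: x_def star_diff star_E)
  moreover have "x * x = 1"
    using assms by (simp add: x_def algebra_simps E_mult scaleC_scaleC)
      (simp flip: scaleC_add_left)
  ultimately show ?thesis
    using E by (auto simp: V_def intro!: S_diff S_scaleC A_diff A_scaleC one_in_S one_in_A E_in_A simp flip: x_def)
       (auto simp: x_def intro!: S_diff S_scaleC A_diff A_scaleC one_in_S one_in_A E_in_A)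
qed

text \<open>For distinct \<open>p\<close>, \<open>q\<close> and \<open>c\<close> of modulus 1, this
  is the selfadjoint unitary that exchanges two basis vectors with phase \<open>c\<close> and fixes
  the others.\<close>

definition swap_unitary :: "nat \<Rightarrow> complex \<Rightarrow> nat \<Rightarrow> nat \<Rightarrow> 'a" where
  "swap_unitary k c p q = 1 - E k p p - E k q q + c *\<^sub>C E k p q + cnj c *\<^sub>C E k q p"

lemma swap_unitary_in_V:
  assumes pq: "p < n k" "q < n k" "p \<noteq> q" and c: "cmod c = 1" and S: "E k p q \<in> S"
  shows "swap_unitary k c p q \<in> V k"
proof -
  let ?x = "swap_unitary k c p q"
  have cc: "c * cnj c = 1" "cnj c * c = 1"
    using complex_norm_square[of c] c by (simp_all add: mult.commute)
  have star: "star ?x = ?x"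
    by (simp add: swap_unitary_def star_diff star_add star_E algebra_simps)
  have sq: "?x * ?x = 1"
    using pq by (simp add: swap_unitary_def algebra_simps E_mult scaleC_scaleC cc)
  have "E k q p \<in> S" using S_star[OF S] by (simp add: star_E)
  moreover have "E k p p \<in> S" "E k q q \<in> S"
    using E_in_masa pq masa_subset_S by auto
  ultimately have "?x \<in> S"
    unfolding swap_unitary_def by (intro S_add S_diff S_scaleC one_in_S S)
  moreover have "?x \<in> A k"
    unfolding swap_unitary_def by (intro A_add A_diff A_scaleC one_in_A E_in_A)
  ultimately show ?thesis using star sq by (simp add: V_def)
qed

text \<open>The phases \<open>1\<close> and \<open>\<i>\<close> separate the off-diagonal units: the
  weights \<open>1\<close> and \<open>-\<i>\<close> give \<open>E k p q\<close> twice and cancel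
  \<open>E k q p\<close>. The last summand removes the diagonal contribution
  \<open>(1 - \<i>) (1 - E k p p - E k q q)\<close>.\<close>

lemma matrix_unit_eq_swap_unitaries:
  "E k p q = (1/2) *\<^sub>C (swap_unitary k 1 p q + (-\<i>) *\<^sub>C swap_unitary k \<i> p q
     + (\<i> - 1) *\<^sub>C (1 + (-1) *\<^sub>C E k p p + (-1) *\<^sub>C E k q q))"
  by (simp add: swap_unitary_def algebra_simps scaleC_scaleC scaleC.scale_right_diff_distrib
      scaleC.scale_left_diff_distrib scaleC.scale_minus_left scaleC.scale_minus_right)
     (simp flip: scaleC_add_left)

end

section \<open>Unital complete isometries\<close>

text \<open>For selfadjoint \<open>h\<close> the norm of \<open>h + \<i> t\<close> is at most
  \<open>sqrt (H^2 + t^2)\<close>, and the isometry carries this over. The imaginary part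
  \<open>b\<close> of the image then satisfies the same bound for \<open>b + t\<close>, for every
  real \<open>t\<close>. Since the bound exceeds the modulus of \<open>t\<close> by arbitrarily
  little for large \<open>t\<close> of either sign, \<open>b\<close> vanishes.\<close>

lemma selfadjoint_image:
  fixes \<phi> :: "'a::unital_cstar_algebra \<Rightarrow> 'b::unital_cstar_algebra"
  assumes lin: "clinear_on S \<phi>" and one: "1 \<in> S" "\<phi> 1 = 1" and S: "csubspace S"
    and iso: "\<And>x. x \<in> S \<Longrightarrow> norm (\<phi> x) = norm x"
    and h: "h \<in> S" "star h = h"
  shows "star (\<phi> h) = \<phi> h"
proof -
  define y where "y = \<phi> h"
  define b where "b = (- \<i> / 2) *\<^sub>C (y - star y)"
  define H where "H = norm h"
  have bt: "norm (b + of_real t) \<le> sqrt (H\<^sup>2 + t\<^sup>2)" for t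
  proof -
    define z where "z = y + (\<i> * t) *\<^sub>C 1"
    define w where "w = h + (\<i> * t) *\<^sub>C 1"
    have w: "w \<in> S" using S h one by (simp add: w_def csubspace_def)
    have "\<phi> w = z" using lin h one S by (simp add: w_def z_def y_def clinear_on_def csubspace_def)
    then have "norm z = norm w" using iso[OF w] by simp
    moreover have "star w * w = h * h + of_real (t\<^sup>2)"
      by (simp add: w_def star_add h algebra_simps scaleC_scaleC of_real_def scaleR_scaleC
          power2_eq_square scaleC.scale_minus_left)
    then have "(norm w)\<^sup>2 \<le> norm (h * h) + norm (of_real (t\<^sup>2) :: 'a)"
      by (metis norm_star_mult norm_triangle_ineq)
    then have "(norm w)\<^sup>2 \<le> H\<^sup>2 + t\<^sup>2"
      unfolding norm_of_real norm_selfadjoint_square[OF h(2)] H_def by simp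
    then have "norm w \<le> sqrt (H\<^sup>2 + t\<^sup>2)" by (simp add: real_le_rsqrt)
    moreover have "b + of_real t = (- \<i> / 2) *\<^sub>C (z - star z)"
      by (simp add: b_def z_def star_add algebra_simps scaleC_scaleC of_real_def scaleR_scaleC
          scaleC.scale_right_diff_distrib scaleC.scale_minus_left scaleC.scale_minus_right)
        (simp flip: scaleC_add_left)
    then have "norm (b + of_real t) \<le> (1/2) * (norm z + norm z)"
      using norm_triangle_ineq4[of z "star z"] by (simp add: norm_scaleC norm_divide)
    ultimately show ?thesis by simp
  qed
  have star_b: "star b = b"
    by (simp add: b_def star_diff algebra_simps scaleC.scale_right_diff_distrib
        scaleC.scale_minus_left scaleC.scale_minus_right)
  have "norm b \<le> 3 * \<delta>" if \<delta>: "0 < \<delta>" for \<delta>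
  proof -
    \<comment> \<open>Chosen so that \<open>2 t \<delta> = H^2\<close>, whence
      \<open>sqrt (H^2 + t^2) \<le> t + \<delta>\<close>; this is the estimate witnessing that both
      \<open>\<delta> + b\<close> and \<open>\<delta> - b\<close> are positive.\<close>
    define t where "t = H\<^sup>2 / (2 * \<delta>)"
    have t: "0 \<le> t" "2 * t * \<delta> = H\<^sup>2" using \<delta> by (simp_all add: t_def)
    have "H\<^sup>2 + t\<^sup>2 \<le> (t + \<delta>)\<^sup>2" using t by (simp add: power2_sum)
    then have T: "sqrt (H\<^sup>2 + t\<^sup>2) \<le> t + \<delta>"
      using t \<delta> by (simp add: real_le_lsqrt)
    have p1: "positive (of_real \<delta> + b)"
      unfolding positive_def using bt[of "-t"] T
      by (auto simp: star_add star_b norm_minus_commute intro!: exI[of _ "t + \<delta>"])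
    have eq: "of_real (2 * \<delta>) - (of_real \<delta> + b) = of_real \<delta> - b"
      by (simp only: mult_2 of_real_add) simp
    have p2: "positive (of_real \<delta> - b)"
      unfolding positive_def using bt[of t] T
      by (auto simp: star_diff star_add star_b add.commute intro!: exI[of _ "t + \<delta>"])
    have "norm (of_real \<delta> + b) \<le> 2 * \<delta>"
      by (rule positive_norm_le[OF p1]) (simp only: eq p2)
    moreover have "norm b \<le> norm (of_real \<delta> + b) + norm (of_real \<delta> :: 'b)"
      using norm_triangle_ineq4[of "of_real \<delta> + b" "of_real \<delta>"] by simp
    ultimately show ?thesis using \<delta> by (simp only: norm_of_real)
  qed
  from this[of "e / 3" for e] have "norm b \<le> 0 + e" if "0 < e" for e using that by simp
  then have "norm b \<le> 0" by (rule field_le_epsilon)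
  then have "b = 0" by simp
  then have "\<i> *\<^sub>C b = 0" by simp
  then have "(1/2) *\<^sub>C (y - star y) = 0" by (simp add: b_def scaleC_scaleC)
  then show ?thesis by (simp add: y_def)
qed

lemma unital_isometry_star:
  fixes \<phi> :: "'a::unital_cstar_algebra \<Rightarrow> 'b::unital_cstar_algebra"
  assumes lin: "clinear_on S \<phi>" and one: "1 \<in> S" "\<phi> 1 = 1" and S: "csubspace S"
    and iso: "\<And>x. x \<in> S \<Longrightarrow> norm (\<phi> x) = norm x"
    and star: "\<And>x. x \<in> S \<Longrightarrow> star x \<in> S"
    and s: "s \<in> S"
  shows "\<phi> (star s) = star (\<phi> s)"
proof -
  define h where "h = (1/2) *\<^sub>C (s + star s)"
  define k where "k = (\<i>/2) *\<^sub>C (star s + (-1) *\<^sub>C s)"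
  have hk: "h \<in> S" "k \<in> S" using S s star[OF s] by (simp_all only: h_def k_def csubspace_def)
  have sa: "star h = h" "star k = k"
    by (simp_all add: h_def k_def star_add star_diff algebra_simps scaleC_scaleC scaleC.scale_minus_left
        scaleC.scale_minus_right scaleC.scale_right_diff_distrib)
  have img: "star (\<phi> h) = \<phi> h" "star (\<phi> k) = \<phi> k"
    using selfadjoint_image[OF lin one S iso] hk sa by auto
  have s_eq: "s = h + \<i> *\<^sub>C k"
    by (simp add: h_def k_def algebra_simps scaleC_scaleC scaleC.scale_minus_left)
       (simp flip: scaleC_add_left)
  have star_s: "star s = h + (- \<i>) *\<^sub>C k" by (subst s_eq) (simp add: star_add sa)
  have \<phi>: "\<phi> (h + c *\<^sub>C k) = \<phi> h + c *\<^sub>C \<phi> k" for c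
    using lin hk S by (simp add: clinear_on_def csubspace_def)
  have "\<phi> (star s) = \<phi> h + (- \<i>) *\<^sub>C \<phi> k" by (simp only: star_s \<phi>)
  moreover have "\<phi> s = \<phi> h + \<i> *\<^sub>C \<phi> k" by (subst s_eq) (rule \<phi>)
  ultimately show ?thesis by (simp add: star_add img)
qed

text \<open>Starting from \<open>star x * x\<close>, repeated squaring stays in \<open>P\<close>,
  and by the C*-identity norms of selfadjoint squares are exact squares. The same \<open>K\<close>
  serves every power, whereas a ratio of norms above 1 would grow without bound.\<close>

lemma norm_le_of_power_bound:
  fixes P :: "('a::unital_cstar_algebra \<times> 'b::unital_cstar_algebra) set"
  assumes mult: "\<And>x y b c. (x, b) \<in> P \<Longrightarrow> (y, c) \<in> P \<Longrightarrow> (x * y, b * c) \<in> P"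
    and star: "\<And>x b. (x, b) \<in> P \<Longrightarrow> (star x, star b) \<in> P"
    and bound: "\<And>x b. (x, b) \<in> P \<Longrightarrow> norm x \<le> K * norm b"
    and xb: "(x, b) \<in> P"
  shows "norm x \<le> norm b"
proof (rule ccontr)
  assume "\<not> norm x \<le> norm b"
  then have gt: "norm b < norm x" by simp
  have pow: "\<exists>y c. (y, c) \<in> P \<and> star y = y \<and> star c = c
      \<and> norm y = norm x ^ (2 ^ Suc j) \<and> norm c = norm b ^ (2 ^ Suc j)" for j :: nat
  proof (induction j)
    case 0
    have "(star x * x, star b * b) \<in> P" using mult star xb by blast
    then show ?case
      by (intro exI[of _ "star x * x"] exI[of _ "star b * b"]) (simp add: star_mult norm_star_mult)
  next
    case (Suc j)
    then obtain y c where yc: "(y, c) \<in> P" "star y = y" "star c = c"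
      "norm y = norm x ^ (2 ^ Suc j)" "norm c = norm b ^ (2 ^ Suc j)" by blast
    have "norm (y * y) = (norm y)\<^sup>2" "norm (c * c) = (norm c)\<^sup>2"
      using yc by (simp_all add: norm_selfadjoint_square)
    moreover have "(r ^ (2 ^ Suc j))\<^sup>2 = r ^ (2 ^ Suc (Suc j))" for r :: real
      by (simp add: mult.commute flip: power_mult)
    ultimately show ?case using yc mult[OF yc(1) yc(1)]
      by (intro exI[of _ "y * y"] exI[of _ "c * c"]) (simp add: star_mult del: power_Suc)
  qed
  have le: "norm x ^ (2 ^ Suc j) \<le> K * norm b ^ (2 ^ Suc j)" for j :: nat
    using pow[of j] bound by metis
  have b0: "norm b \<noteq> 0"
  proof
    assume "norm b = 0"
    then show False using le[of 0] gt by simp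
  qed
  define r where "r = norm x / norm b"
  have r: "r > 1" using gt b0 by (simp add: r_def)
  have rle: "r ^ (2 ^ Suc j) \<le> K" for j
    using le[of j] b0 by (simp add: r_def power_divide divide_simps)
  obtain m where m: "K < r ^ m" using real_arch_pow[OF r] by blast
  have "m \<le> 2 ^ Suc m" by (metis less_exp less_imp_le_nat lessI order.trans Suc_leD)
  then have "r ^ m \<le> r ^ (2 ^ Suc m)" using r by (intro power_increasing) auto
  then show False using m rle[of m] by simp
qed

section \<open>Comparison of a C*-cover with the ambient algebra\<close>

lemma cstar_subalgebra_generated: "cstar_subalgebra (cstar_generated X)"
  unfolding cstar_subalgebra_def csubspace_def cstar_generated_def
  by (auto simp: cstar_subalgebra_def csubspace_def intro: closed_Inter)

lemma generated_superset: "X \<subseteq> cstar_generated X"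
  by (auto simp: cstar_generated_def)

locale uhf_system_cover = uhf_system n \<iota> S
  for n :: "nat \<Rightarrow> nat" and \<iota> :: "nat \<Rightarrow> complex mat \<Rightarrow> 'a::unital_cstar_algebra" and S :: "'a set" +
  fixes B :: "'b::unital_cstar_algebra set" and \<phi> :: "'a \<Rightarrow> 'b"
  assumes cover: "cstar_cover S B \<phi>"
begin

lemma \<phi>_add: "x \<in> S \<Longrightarrow> y \<in> S \<Longrightarrow> \<phi> (x + y) = \<phi> x + \<phi> y"
  and \<phi>_scaleC: "x \<in> S \<Longrightarrow> \<phi> (c *\<^sub>C x) = c *\<^sub>C \<phi> x"
  and \<phi>_one: "\<phi> 1 = 1"
  using cover by (auto simp: cstar_cover_def clinear_on_def)

lemma \<phi>_0: "\<phi> 0 = 0"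
  using \<phi>_scaleC[OF S_0, of 0] by simp

lemma \<phi>_diff: "x \<in> S \<Longrightarrow> y \<in> S \<Longrightarrow> \<phi> (x - y) = \<phi> x - \<phi> y"
  using \<phi>_add[of x "(-1) *\<^sub>C y"] \<phi>_scaleC[of y "-1"] S_scaleC[of y "-1"]
  by (simp add: scaleC.scale_minus_left)

lemma matrix_norm_\<phi>:
  "X \<in> carrier_mat m m \<Longrightarrow> (\<And>i j. i < m \<Longrightarrow> j < m \<Longrightarrow> X $$ (i, j) \<in> S)
    \<Longrightarrow> matrix_norm (map_mat \<phi> X) = matrix_norm X"
  using cover elements_matD[of _ X] unfolding cstar_cover_def completely_isometric_on_def
  by (metis carrier_matD subsetI)

lemma norm_\<phi>: "x \<in> S \<Longrightarrow> norm (\<phi> x) = norm x"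
proof -
  assume x: "x \<in> S"
  have "map_mat \<phi> (mat 1 1 (\<lambda>_. x)) = mat 1 1 (\<lambda>_. \<phi> x)" by auto
  moreover have "matrix_norm (map_mat \<phi> (mat 1 1 (\<lambda>_. x))) = matrix_norm (mat 1 1 (\<lambda>_. x))"
    using x by (intro matrix_norm_\<phi>[of _ 1]) auto
  ultimately show ?thesis by (simp only: matrix_norm_1x1)
qed

lemma \<phi>_star: "x \<in> S \<Longrightarrow> \<phi> (star x) = star (\<phi> x)"
proof (rule unital_isometry_star)
  show "clinear_on S \<phi>" using cover by (simp add: cstar_cover_def)
  show "csubspace S" using system by (simp add: concrete_operator_system_over_def)
qed (auto simp: one_in_S \<phi>_one norm_\<phi> S_star)

section \<open>Twisted unitaries and the maximally entangled vector\<close>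

definition twist :: "nat \<Rightarrow> complex mat \<Rightarrow> 'a mat" where
  "twist k u = mat (n k) (n k) (\<lambda>(p, q). cnj (u $$ (p, q)) *\<^sub>C \<iota> k u)"

definition unitaries :: "nat \<Rightarrow> complex mat set" where
  "unitaries k = {u \<in> carrier_mat (n k) (n k). \<iota> k u \<in> V k}"

lemma twist_carrier [simp]: "twist k u \<in> carrier_mat (n k) (n k)"
  by (simp add: twist_def)

lemma dim_twist [simp]: "dim_row (twist k u) = n k" "dim_col (twist k u) = n k"
  by (simp_all add: twist_def)

lemma unitaries_carrier: "u \<in> unitaries k \<Longrightarrow> u \<in> carrier_mat (n k) (n k)"
  by (simp add: unitaries_def)

text \<open>Because the factor \<open>conj(u)\<close> is kept as scalar coefficients, every entry is
  a multiple of the one element \<open>\<iota> k u\<close> of \<open>S\<close>. This makes complete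
  isometry applicable to the twist.\<close>

lemma twist_in_S: "u \<in> unitaries k \<Longrightarrow> p < n k \<Longrightarrow> q < n k \<Longrightarrow> twist k u $$ (p, q) \<in> S"
  by (simp add: twist_def unitaries_def V_def S_scaleC)

lemma unitaries_orthonormal:
  assumes u: "u \<in> unitaries k" and pq: "p < n k" "q < n k"
  shows "(\<Sum>r<n k. cnj (u $$ (r, p)) * u $$ (r, q)) = (if p = q then 1 else 0)"
proof -
  have uc: "u \<in> carrier_mat (n k) (n k)" using u by (rule unitaries_carrier)
  have sc: "mat_star u \<in> carrier_mat (n k) (n k)" using uc by (auto simp: mat_star_def)
  have "\<iota> k (mat_star u * u) = \<iota> k (1\<^sub>m (n k))"
    using u uc sc by (simp add: \<iota>_mult \<iota>_star \<iota>_one unitaries_def V_def)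
  then have "mat_star u * u = 1\<^sub>m (n k)"
    using uc sc by (intro inj_onD[OF \<iota>_inj, of k]) auto
  then have "(mat_star u * u) $$ (p, q) = (if p = q then 1 else 0)" using pq by simp
  moreover have "(mat_star u * u) $$ (p, q) = (\<Sum>r<n k. cnj (u $$ (r, p)) * u $$ (r, q))"
    unfolding index_mult_mat_sum[OF sc uc pq] using uc pq by (intro sum.cong) (auto simp: mat_star_def)
  ultimately show ?thesis by simp
qed

text \<open>The twist preserves the inner square of every column: \<open>g\<close> cancels by
  \<open>star g * g = 1\<close>, and the coefficient sums reduce to the orthonormality of the
  columns of \<open>u\<close>.\<close>

lemma matrix_norm_twist_le:
  assumes u: "u \<in> unitaries k"
  shows "matrix_norm (twist k u) \<le> 1"
proof (rule matrix_norm_le[OF twist_carrier])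
  fix v :: "'a vec" assume v: "v \<in> carrier_vec (n k)"
  define g where "g = \<iota> k u"
  have g: "star g * g = 1" using u by (simp add: g_def unitaries_def V_def)
  have row: "(twist k u *\<^sub>v v) $ p = (\<Sum>q<n k. cnj (u $$ (p, q)) *\<^sub>C (g * v $ q))" if "p < n k" for p
    unfolding index_mult_mat_vec_sum[OF twist_carrier v that] using that
    by (intro sum.cong) (auto simp: twist_def g_def)
  have gg: "star (g * x) * (g * y) = star x * y" for x y
    by (metis g mult.assoc mult_1 star_mult)
  have "column_inner (twist k u *\<^sub>v v) (twist k u *\<^sub>v v)
      = (\<Sum>p<n k. star ((twist k u *\<^sub>v v) $ p) * (twist k u *\<^sub>v v) $ p)"
    by (simp add: column_inner_def twist_def del: index_mult_mat_vec)
  also have "\<dots> = (\<Sum>p<n k. \<Sum>q<n k. \<Sum>r<n k. (u $$ (p, q) * cnj (u $$ (p, r))) *\<^sub>C (star (v $ q) * v $ r))"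
    using row by (intro sum.cong refl)
      (auto simp: star_sum sum_product scaleC_scaleC gg mult.commute[of "cnj _"] simp del: index_mult_mat_vec)
  also have "\<dots> = (\<Sum>q<n k. \<Sum>p<n k. \<Sum>r<n k. (u $$ (p, q) * cnj (u $$ (p, r))) *\<^sub>C (star (v $ q) * v $ r))"
    by (rule sum.swap)
  also have "\<dots> = (\<Sum>q<n k. \<Sum>r<n k. \<Sum>p<n k. (u $$ (p, q) * cnj (u $$ (p, r))) *\<^sub>C (star (v $ q) * v $ r))"
    by (intro sum.cong refl sum.swap)
  also have "\<dots> = (\<Sum>q<n k. \<Sum>r<n k. if r = q then star (v $ q) * v $ q else 0)"
  proof (intro sum.cong refl)
    fix q r assume qr: "q \<in> {..<n k}" "r \<in> {..<n k}"
    have "(\<Sum>p<n k. (u $$ (p, q) * cnj (u $$ (p, r))) *\<^sub>C (star (v $ q) * v $ r))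
        = (\<Sum>p<n k. cnj (u $$ (p, r)) * u $$ (p, q)) *\<^sub>C (star (v $ q) * v $ r)"
      by (simp add: scaleC.scale_sum_left mult.commute)
    then show "(\<Sum>p<n k. (u $$ (p, q) * cnj (u $$ (p, r))) *\<^sub>C (star (v $ q) * v $ r))
        = (if r = q then star (v $ q) * v $ q else 0)"
      using unitaries_orthonormal[OF u, of r q] qr by simp
  qed
  also have "\<dots> = column_inner v v" using v by (simp add: column_inner_def)
  finally show "column_norm (twist k u *\<^sub>v v) \<le> 1 * column_norm v"
    by (simp add: column_norm_alt)
qed simp

text \<open>
  The vector functional of the maximally entangled vector of \<open>M\<^bsub>n k\<^esub> \<otimes> A k\<close>, multiplied by \<open>n k\<close>;
  on matrices over \<open>A k\<close> its values are multiples of the minimal projection \<open>E k 0 0\<close>.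
\<close>

definition entangled :: "nat \<Rightarrow> 'a mat \<Rightarrow> 'a" where
  "entangled k X = (\<Sum>p<n k. \<Sum>q<n k. E k 0 p * X $$ (p, q) * E k q 0)"

lemma entangled_add:
  "X \<in> carrier_mat (n k) (n k) \<Longrightarrow> Y \<in> carrier_mat (n k) (n k) \<Longrightarrow>
    entangled k (X + Y) = entangled k X + entangled k Y"
  by (simp add: entangled_def algebra_simps sum.distrib)

lemma entangled_scaleC:
  "X \<in> carrier_mat (n k) (n k) \<Longrightarrow> entangled k (map_mat (scaleC c) X) = c *\<^sub>C entangled k X"
  by (simp add: entangled_def scaleC.scale_sum_right)

lemma entangled_one: "entangled k (1\<^sub>m (n k)) = of_nat (n k) *\<^sub>C E k 0 0"
proof -
  have "entangled k (1\<^sub>m (n k)) = (\<Sum>p<n k. \<Sum>q<n k. if q = p then E k 0 0 else 0)"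
    unfolding entangled_def using n_pos[of k] by (intro sum.cong refl) (auto simp: E_mult)
  also have "\<dots> = (\<Sum>p<n k. 1 *\<^sub>C E k 0 0)" by simp
  finally show ?thesis by (simp only: flip: scaleC.scale_sum_left) simp
qed

text \<open>Sandwiching \<open>\<iota> k u\<close> extracts the entry \<open>u $$ (p, q)\<close>, so
  the coefficient is the squared Hilbert-Schmidt norm of a unitary matrix, the same value as for the
  identity.\<close>

lemma entangled_twist:
  assumes u: "u \<in> unitaries k"
  shows "entangled k (twist k u) = of_nat (n k) *\<^sub>C E k 0 0"
proof -
  have uc: "u \<in> carrier_mat (n k) (n k)" using u by (rule unitaries_carrier)
  have "E k 0 p * \<iota> k u * E k q 0 = u $$ (p, q) *\<^sub>C E k 0 0" if pq: "p < n k" "q < n k" for p q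
  proof -
    have "E k 0 p * \<iota> k u * E k q 0 = E k 0 p * (E k p p * \<iota> k u * E k q q) * E k q 0"
    proof -
      have "E k 0 p = E k 0 p * E k p p" "E k q 0 = E k q q * E k q 0"
        using pq n_pos[of k] by (simp_all add: E_mult)
      then show ?thesis by (metis mult.assoc)
    qed
    then show ?thesis using pq n_pos[of k] by (simp add: E_compress[OF uc pq] E_mult)
  qed
  then have "entangled k (twist k u) = (\<Sum>p<n k. \<Sum>q<n k. (cnj (u $$ (p, q)) * u $$ (p, q)) *\<^sub>C E k 0 0)"
    by (simp add: entangled_def twist_def scaleC_scaleC)
  also have "\<dots> = (\<Sum>q<n k. \<Sum>p<n k. cnj (u $$ (p, q)) * u $$ (p, q)) *\<^sub>C E k 0 0"
    by (subst sum.swap) (simp add: scaleC.scale_sum_left)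
  also have "(\<Sum>q<n k. \<Sum>p<n k. cnj (u $$ (p, q)) * u $$ (p, q)) = of_nat (n k)"
    using unitaries_orthonormal[OF u] by simp
  finally show ?thesis .
qed

text \<open>The column of the \<open>E k q 0\<close> is the unnormalized entangled vector:
  \<open>entangled k X\<close> is its inner product with its image under \<open>X\<close>, and its
  squared norm is \<open>n k\<close>.\<close>

lemma norm_entangled_le:
  assumes X: "X \<in> carrier_mat (n k) (n k)"
  shows "norm (entangled k X) \<le> real (n k) * matrix_norm X"
proof -
  define v where "v = vec (n k) (\<lambda>q. E k q 0)"
  have v: "v \<in> carrier_vec (n k)" by (simp add: v_def)
  have row: "(X *\<^sub>v v) $ p = (\<Sum>q<n k. X $$ (p, q) * E k q 0)" if "p < n k" for p
    unfolding index_mult_mat_vec_sum[OF X v that] by (intro sum.cong) (auto simp: v_def)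
  have "entangled k X = column_inner v (X *\<^sub>v v)"
    by (simp add: column_inner_def v_def row[unfolded v_def] entangled_def star_E sum_distrib_left mult.assoc
        del: index_mult_mat_vec)
  then have "norm (entangled k X) \<le> column_norm v * column_norm (X *\<^sub>v v)"
    using column_Cauchy_Schwarz[of "X *\<^sub>v v" v] X v by simp
  also have "\<dots> \<le> column_norm v * (matrix_norm X * column_norm v)"
    by (intro mult_left_mono column_norm_mult_le[OF X v]) simp
  also have "column_norm v * (matrix_norm X * column_norm v) = matrix_norm X * (column_norm v)\<^sup>2"
    by (simp add: power2_eq_square)
  also have "(column_norm v)\<^sup>2 = real (n k)"
  proof -
    have "column_inner v v = (\<Sum>q<n k. 1 *\<^sub>C E k 0 0)"
      using n_pos[of k] by (simp add: column_inner_def v_def star_E E_mult)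
    also have "\<dots> = of_nat (n k) *\<^sub>C E k 0 0"
      by (simp only: flip: scaleC.scale_sum_left) simp
    finally show ?thesis
      using n_pos[of k] by (simp add: column_norm_square norm_scaleC norm_E)
  qed
  finally show ?thesis by (simp add: mult.commute)
qed

text \<open>The left ideal generated by all \<open>X_u - 1\<close>. Adding one term per step allows
  the norm estimate below to absorb a single \<open>Y (X_u - 1)\<close> at a time.\<close>

inductive_set ideal :: "nat \<Rightarrow> 'b mat set" for k where
  zero: "0\<^sub>m (n k) (n k) \<in> ideal k"
| step: "l \<in> ideal k \<Longrightarrow> Y \<in> carrier_mat (n k) (n k) \<Longrightarrow> u \<in> unitaries k \<Longrightarrow>
    l + Y * (map_mat \<phi> (twist k u) - 1\<^sub>m (n k)) \<in> ideal k"

lemma ideal_carrier: "l \<in> ideal k \<Longrightarrow> l \<in> carrier_mat (n k) (n k)"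
  by (induction rule: ideal.induct) (auto intro!: minus_carrier_mat)

lemma ideal_add:
  assumes "l' \<in> ideal k" and l: "l \<in> ideal k"
  shows "l + l' \<in> ideal k"
  using assms(1)
proof (induction rule: ideal.induct)
  case zero
  then show ?case using l ideal_carrier[OF l] by simp
next
  case (step l' Y u)
  let ?D = "Y * (map_mat \<phi> (twist k u) - 1\<^sub>m (n k))"
  have D: "?D \<in> carrier_mat (n k) (n k)" using step by (auto intro!: minus_carrier_mat)
  have "l + (l' + ?D) = (l + l') + ?D"
    using assoc_add_mat[OF ideal_carrier[OF l] ideal_carrier[OF step.hyps(1)] D] by simp
  then show ?case using ideal.step[OF step.IH step.hyps(2,3)] by simp
qed

lemma ideal_mult_left:
  assumes "l \<in> ideal k" and Z: "Z \<in> carrier_mat (n k) (n k)"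
  shows "Z * l \<in> ideal k"
  using assms(1)
proof (induction rule: ideal.induct)
  case zero
  then show ?case using Z ideal.zero by simp
next
  case (step l Y u)
  let ?D = "map_mat \<phi> (twist k u) - 1\<^sub>m (n k)"
  have D: "?D \<in> carrier_mat (n k) (n k)" by (auto intro!: minus_carrier_mat)
  have "Z * (l + Y * ?D) = Z * l + (Z * Y) * ?D"
    using mult_add_distrib_mat[OF Z ideal_carrier[OF step.hyps(1)], of "Y * ?D"]
      assoc_mult_mat[OF Z step.hyps(2) D] step.hyps(2) D by simp
  then show ?case using ideal.step[OF step.IH _ step.hyps(3), of "Z * Y"] Z step.hyps(2) by simp
qed

text \<open>
  The functional \<open>entangled\<close> on matrices over \<open>\<phi> ` S\<close> stays
  contractive after passing to the quotient by the left ideal.  Since \<open>X = map_mat \<phi> (twist k u)\<close> is a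
  contraction on which the functional is as large as on \<open>1\<close>, the elements \<open>c (X + 1) - Y (X - 1)\<close> have
  norm at most \<open>2 sqrt (\<bar>c\<bar>\<^sup>2 + M\<^sup>2)\<close>, which differs from \<open>2 \<bar>c\<bar>\<close> by an amount that vanishes as \<open>\<bar>c\<bar>\<close> grows.
\<close>

lemma entangled_le_mod_ideal:
  assumes "l \<in> ideal k"
    and "K \<in> carrier_mat (n k) (n k)" "\<And>p q. p < n k \<Longrightarrow> q < n k \<Longrightarrow> K $$ (p, q) \<in> S"
    and "entangled k K = c *\<^sub>C E k 0 0"
  shows "cmod c \<le> real (n k) * matrix_norm (map_mat \<phi> K + l)"
  using assms
\<comment> \<open>\<open>K\<close> and \<open>c\<close> have to vary, since each step applies the
  induction hypothesis to a shifted matrix \<open>K + T\<close>.\<close>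
proof (induction arbitrary: K c rule: ideal.induct)
  case zero
  have "cmod c = norm (entangled k K)" using zero n_pos[of k] by (simp add: norm_scaleC norm_E)
  also have "\<dots> \<le> real (n k) * matrix_norm (map_mat \<phi> K)"
    using norm_entangled_le[of K k] zero matrix_norm_\<phi>[of K "n k"] by simp
  also have "map_mat \<phi> K = map_mat \<phi> K + 0\<^sub>m (n k) (n k)" using zero by auto
  finally show ?case .
next
  case (step l Y u)
  let ?N = "n k"
  define N where "N = real ?N"
  have N: "N > 0" using n_pos by (simp add: N_def)
  define X where "X = map_mat \<phi> (twist k u)"
  have X: "X \<in> carrier_mat ?N ?N" by (simp add: X_def)
  have Y: "Y \<in> carrier_mat ?N ?N" using step by simp
  have l: "l \<in> carrier_mat ?N ?N" using ideal_carrier step by simp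
  have K: "K \<in> carrier_mat ?N ?N" using step by simp
  define \<rho> where "\<rho> = matrix_norm (map_mat \<phi> K + (l + Y * (X - 1\<^sub>m ?N)))"
  obtain M where M: "0 < M"
    "\<And>v. v \<in> carrier_vec ?N \<Longrightarrow> column_inner (Y *\<^sub>v v) (Y *\<^sub>v v) \<preceq> M\<^sup>2 *\<^sub>R column_inner v v"
    using column_inner_mult_cle[OF Y] by metis
  have "matrix_norm X = matrix_norm (twist k u)"
    unfolding X_def using step by (intro matrix_norm_\<phi>[of _ ?N]) (auto intro: twist_in_S)
  then have X1: "matrix_norm X \<le> 1" using matrix_norm_twist_le[OF step.hyps(3)] by simp
  have contr: "column_norm (X *\<^sub>v v) \<le> column_norm v" if "v \<in> carrier_vec ?N" for v
    using column_norm_mult_le[OF X that] X1 mult_right_mono[OF X1, of "column_norm v"] by simp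
  \<comment> \<open>The phase of \<open>c\<close>, or 1 if \<open>c = 0\<close>. The shift is given
    this phase, so that the moduli of \<open>c\<close> and of the contribution of \<open>T\<close>
    add up without loss.\<close>
  define \<theta> where "\<theta> = (if c = 0 then 1 else sgn c)"
  have \<theta>: "cmod \<theta> = 1" "c = cmod c * \<theta>"
    by (auto simp: \<theta>_def sgn_eq norm_divide)
  have key: "cmod c + 2 * N * s \<le> N * (\<rho> + 2 * sqrt (s\<^sup>2 + M\<^sup>2))" if s: "0 < s" for s
  proof -
    define d where "d = complex_of_real s * \<theta>"
    have d: "cmod d = s" using s \<theta> by (simp add: d_def norm_mult)
    define T where "T = map_mat (scaleC d) (twist k u + 1\<^sub>m ?N)"
    have T: "T \<in> carrier_mat ?N ?N" by (simp add: T_def)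
    have TS: "T $$ (p, q) \<in> S" if "p < ?N" "q < ?N" for p q
    proof -
      have "T $$ (p, q) = d *\<^sub>C (twist k u $$ (p, q) + (if p = q then 1 else 0))"
        using that by (simp add: T_def)
      then show ?thesis
        using twist_in_S[OF step.hyps(3) that] one_in_S S_0 by (simp add: S_scaleC S_add)
    qed
    have "entangled k T = d *\<^sub>C (of_nat ?N *\<^sub>C E k 0 0 + of_nat ?N *\<^sub>C E k 0 0)"
      unfolding T_def
      by (subst entangled_scaleC) (simp_all add: entangled_add entangled_twist[OF step.hyps(3)] entangled_one)
    also have "\<dots> = (d * (of_nat ?N + of_nat ?N)) *\<^sub>C E k 0 0"
      by (simp only: scaleC_add_left[symmetric] scaleC_scaleC)
    finally have "entangled k (K + T) = (c + d * (2 * of_nat ?N)) *\<^sub>C E k 0 0"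
      using entangled_add[OF K T] step.prems(3) by (simp only: scaleC_add_left mult_2)
    then have IH: "cmod (c + d * (2 * of_nat ?N)) \<le> N * matrix_norm (map_mat \<phi> (K + T) + l)"
      unfolding N_def using K T TS step.prems(2) by (intro step.IH) (auto simp: S_add)
    have "c + d * (2 * of_nat ?N) = complex_of_real (cmod c + 2 * N * s) * \<theta>"
      by (subst \<theta>(2)) (simp add: d_def N_def algebra_simps)
    then have lhs: "cmod (c + d * (2 * of_nat ?N)) = cmod c + 2 * N * s"
      using s \<theta>(1) N by (simp add: norm_mult del: of_real_add of_real_mult)
    \<comment> \<open>Adding \<open>Z\<close> trades the last ideal term \<open>Y (X - 1)\<close>
      for \<open>d (X + 1)\<close>, which is the image of \<open>T\<close>; what remains is covered
      by the induction hypothesis.\<close>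
    define Z where "Z = map_mat (scaleC d) (X + 1\<^sub>m ?N) - Y * (X - 1\<^sub>m ?N)"
    have XI: "X - 1\<^sub>m ?N \<in> carrier_mat ?N ?N" using X by (auto intro!: minus_carrier_mat)
    have YX: "Y * (X - 1\<^sub>m ?N) \<in> carrier_mat ?N ?N" using Y XI by simp
    have Z: "Z \<in> carrier_mat ?N ?N" unfolding Z_def using YX by (intro minus_carrier_mat)
    have "map_mat \<phi> (K + T) + l = (map_mat \<phi> K + (l + Y * (X - 1\<^sub>m ?N))) + Z"
    proof (rule eq_matI)
      fix p q assume "p < dim_row ((map_mat \<phi> K + (l + Y * (X - 1\<^sub>m ?N))) + Z)"
        "q < dim_col ((map_mat \<phi> K + (l + Y * (X - 1\<^sub>m ?N))) + Z)"
      then have pq: "p < ?N" "q < ?N" using Z by auto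
      have "\<phi> (K $$ (p, q) + T $$ (p, q)) = \<phi> (K $$ (p, q)) + \<phi> (T $$ (p, q))"
        using pq step.prems(2) TS by (intro \<phi>_add) auto
      moreover have "\<phi> (T $$ (p, q)) = d *\<^sub>C (X + 1\<^sub>m ?N) $$ (p, q)"
        using pq twist_in_S[OF step.hyps(3) pq] X
        by (auto simp: T_def X_def \<phi>_scaleC \<phi>_add S_add one_in_S \<phi>_one)
      ultimately show "(map_mat \<phi> (K + T) + l) $$ (p, q)
          = ((map_mat \<phi> K + (l + Y * (X - 1\<^sub>m ?N))) + Z) $$ (p, q)"
        using pq K T l YX X Z by (simp add: Z_def del: index_mult_mat)
    qed (use K T l YX X Z in auto)
    moreover have "map_mat \<phi> K + (l + Y * (X - 1\<^sub>m ?N)) \<in> carrier_mat ?N ?N"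
      using K l YX by (intro add_carrier_mat) auto
    ultimately have "matrix_norm (map_mat \<phi> (K + T) + l) \<le> \<rho> + matrix_norm Z"
      unfolding \<rho>_def using matrix_norm_triangle[OF _ Z] by metis
    also have "matrix_norm Z \<le> 2 * sqrt (s\<^sup>2 + M\<^sup>2)"
      unfolding Z_def by (rule column_norm_dilation[OF X Y contr M d s])
    finally have "N * matrix_norm (map_mat \<phi> (K + T) + l) \<le> N * (\<rho> + 2 * sqrt (s\<^sup>2 + M\<^sup>2))"
      using N by (intro mult_left_mono) auto
    then show ?thesis using IH lhs by simp
  qed
  have "cmod c \<le> N * \<rho> + e" if e: "0 < e" for e
  proof -
    \<comment> \<open>From \<open>sqrt (s^2 + M^2) \<le> s + M^2 / (2 s)\<close> the excess in
      \<open>key\<close> is at most \<open>N M^2 / s\<close>, which equals \<open>e\<close> for this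
      \<open>s\<close>.\<close>
    define s where "s = N * M\<^sup>2 / e"
    have s: "0 < s" using e M N by (simp add: s_def)
    have "s\<^sup>2 + M\<^sup>2 \<le> (s + M\<^sup>2 / (2 * s))\<^sup>2" using s by (simp add: power2_sum)
    then have "sqrt (s\<^sup>2 + M\<^sup>2) \<le> s + M\<^sup>2 / (2 * s)" using s by (simp add: real_le_lsqrt)
    then have "N * (2 * sqrt (s\<^sup>2 + M\<^sup>2)) \<le> N * (2 * (s + M\<^sup>2 / (2 * s)))"
      using N by (intro mult_left_mono) auto
    also have "\<dots> = 2 * N * s + e" using s e M N by (simp add: s_def field_simps)
    finally show ?thesis using key[OF s] by (simp add: algebra_simps)
  qed
  then have "cmod c \<le> N * \<rho>" by (rule field_le_epsilon)
  then show ?case by (simp add: \<rho>_def N_def X_def)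
qed

text \<open>In tensor notation this is \<open>1 (x) b - transpose(a) (x) 1\<close>. Its membership
  in \<open>ideal k\<close> says that \<open>b\<close> acts on the entangled vector like the
  transposed scalar matrix.\<close>

definition defect :: "nat \<Rightarrow> complex mat \<Rightarrow> 'b \<Rightarrow> 'b mat" where
  "defect k a b = mat (n k) (n k) (\<lambda>(p, q). (if p = q then b else 0) - a $$ (q, p) *\<^sub>C 1)"

definition Rel :: "nat \<Rightarrow> ('a \<times> 'b) set" where
  "Rel k = {(\<iota> k a, b) |a b. a \<in> carrier_mat (n k) (n k) \<and> defect k a b \<in> ideal k}"

abbreviation diag :: "nat \<Rightarrow> 'b \<Rightarrow> 'b mat" where
  "diag k b \<equiv> mat (n k) (n k) (\<lambda>(p, q). if p = q then b else 0)"

abbreviation tscalar :: "nat \<Rightarrow> complex mat \<Rightarrow> 'b mat" where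
  "tscalar k a \<equiv> mat (n k) (n k) (\<lambda>(p, q). a $$ (q, p) *\<^sub>C 1)"

lemma diag_mult:
  assumes X: "X \<in> carrier_mat (n k) (n k)" and pq: "p < n k" "q < n k"
  shows "(diag k b * X) $$ (p, q) = b * X $$ (p, q)"
proof -
  have "(diag k b * X) $$ (p, q) = (\<Sum>r<n k. diag k b $$ (p, r) * X $$ (r, q))"
    using pq by (intro index_mult_mat_sum[OF _ X]) auto
  also have "\<dots> = (\<Sum>r<n k. if r = p then b * X $$ (p, q) else 0)"
    using pq by (intro sum.cong) auto
  finally show ?thesis using pq by simp
qed

lemma tscalar_mult:
  assumes X: "X \<in> carrier_mat (n k) (n k)" and pq: "p < n k" "q < n k"
  shows "(tscalar k a * X) $$ (p, q) = (\<Sum>r<n k. a $$ (r, p) *\<^sub>C X $$ (r, q))"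
proof -
  have "(tscalar k a * X) $$ (p, q) = (\<Sum>r<n k. tscalar k a $$ (p, r) * X $$ (r, q))"
    using pq by (intro index_mult_mat_sum[OF _ X]) auto
  then show ?thesis using pq by simp
qed

text \<open>Multiplying the generator \<open>X_u - 1\<close> on the left by the scalar matrix
  \<open>transpose(u)\<close> cancels \<open>conj(u)\<close>, since
  \<open>transpose(u) conj(u) = 1\<close>, and leaves exactly the defect.\<close>

lemma Rel_unitary:
  assumes "x \<in> V k"
  shows "(x, \<phi> x) \<in> Rel k"
proof -
  obtain u where u: "u \<in> carrier_mat (n k) (n k)" "x = \<iota> k u"
    using assms by (auto simp: V_def A_def)
  then have uu: "u \<in> unitaries k" using assms by (simp add: unitaries_def)
  have xS: "x \<in> S" using assms by (simp add: V_def)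
  let ?D = "map_mat \<phi> (twist k u) - 1\<^sub>m (n k)"
  have D: "?D \<in> carrier_mat (n k) (n k)" by (auto intro!: minus_carrier_mat)
  have "defect k u (\<phi> x) = tscalar k u * ?D"
  proof (rule eq_matI)
    fix p q assume "p < dim_row (tscalar k u * ?D)" "q < dim_col (tscalar k u * ?D)"
    then have pq: "p < n k" "q < n k" by (auto simp: twist_def)
    have "(tscalar k u * ?D) $$ (p, q) = (\<Sum>r<n k. u $$ (r, p) *\<^sub>C ?D $$ (r, q))"
      by (rule tscalar_mult[OF D pq])
    also have "\<dots> = (\<Sum>r<n k. (cnj (u $$ (r, q)) * u $$ (r, p)) *\<^sub>C \<phi> x - (if r = q then u $$ (q, p) *\<^sub>C 1 else 0))"
      using pq xS by (intro sum.cong)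
        (auto simp: twist_def u(2)[symmetric] \<phi>_scaleC scaleC.scale_right_diff_distrib scaleC_scaleC mult.commute)
    also have "\<dots> = (\<Sum>r<n k. cnj (u $$ (r, q)) * u $$ (r, p)) *\<^sub>C \<phi> x - u $$ (q, p) *\<^sub>C 1"
      using pq by (simp add: sum_subtractf scaleC.scale_sum_left)
    also have "\<dots> = defect k u (\<phi> x) $$ (p, q)"
      using pq unitaries_orthonormal[OF uu pq(2,1)] by (simp add: defect_def)
    finally show "defect k u (\<phi> x) $$ (p, q) = (tscalar k u * ?D) $$ (p, q)" by simp
  qed (auto simp: defect_def twist_def)
  also have "\<dots> = 0\<^sub>m (n k) (n k) + tscalar k u * ?D"
    using D by (intro left_add_zero_mat[symmetric]) auto
  also have "\<dots> \<in> ideal k" by (intro ideal.intros uu) auto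
  finally show ?thesis using u by (auto simp: Rel_def)
qed

lemma Rel_scalar: "(c *\<^sub>C 1, c *\<^sub>C 1) \<in> Rel k"
proof -
  have "defect k (c \<cdot>\<^sub>m 1\<^sub>m (n k)) (c *\<^sub>C 1) = 0\<^sub>m (n k) (n k)"
    by (rule eq_matI) (auto simp: defect_def)
  then show ?thesis
    unfolding Rel_def using ideal.zero[of k]
    by (auto simp: \<iota>_smult \<iota>_one intro!: exI[of _ "c \<cdot>\<^sub>m 1\<^sub>m (n k)"] exI[of _ "c *\<^sub>C 1"])
qed

lemma Rel_add:
  assumes "(x, b) \<in> Rel k" "(x', b') \<in> Rel k"
  shows "(x + x', b + b') \<in> Rel k"
proof -
  obtain a a' where a: "a \<in> carrier_mat (n k) (n k)" "x = \<iota> k a" "defect k a b \<in> ideal k"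
    and a': "a' \<in> carrier_mat (n k) (n k)" "x' = \<iota> k a'" "defect k a' b' \<in> ideal k"
    using assms by (auto simp: Rel_def)
  have "defect k (a + a') (b + b') = defect k a b + defect k a' b'"
    using a a' by (intro eq_matI) (auto simp: defect_def scaleC_add_left)
  then have "defect k (a + a') (b + b') \<in> ideal k" using a a' by (simp add: ideal_add)
  then show ?thesis
    unfolding Rel_def using a a'
    by (auto simp: \<iota>_add intro!: exI[of _ "a + a'"] exI[of _ "b + b'"])
qed

text \<open>Scalar matrices commute with \<open>diag k b\<close>, so the defect of the product is
  \<open>b\<close> times the second defect plus \<open>transpose(a')\<close> times the first. Both
  are left multiples, and the factors come out in the order of
  \<open>transpose(a a') = transpose(a') transpose(a)\<close>.\<close>

lemma Rel_mult:
  assumes "(x, b) \<in> Rel k" "(x', b') \<in> Rel k"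
  shows "(x * x', b * b') \<in> Rel k"
proof -
  obtain a a' where a: "a \<in> carrier_mat (n k) (n k)" "x = \<iota> k a" "defect k a b \<in> ideal k"
    and a': "a' \<in> carrier_mat (n k) (n k)" "x' = \<iota> k a'" "defect k a' b' \<in> ideal k"
    using assms by (auto simp: Rel_def)
  have T: "defect k a b \<in> carrier_mat (n k) (n k)" "defect k a' b' \<in> carrier_mat (n k) (n k)"
    by (simp_all add: defect_def)
  have "defect k (a * a') (b * b') = diag k b * defect k a' b' + tscalar k a' * defect k a b"
  proof (rule eq_matI)
    fix p q assume "p < dim_row (diag k b * defect k a' b' + tscalar k a' * defect k a b)"
      "q < dim_col (diag k b * defect k a' b' + tscalar k a' * defect k a b)"
    then have pq: "p < n k" "q < n k" by (auto simp: defect_def)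
    have "(diag k b * defect k a' b' + tscalar k a' * defect k a b) $$ (p, q)
        = (diag k b * defect k a' b') $$ (p, q) + (tscalar k a' * defect k a b) $$ (p, q)"
      using pq by (intro index_add_mat) (auto simp: defect_def)
    also have "\<dots> = b * ((if p = q then b' else 0) - a' $$ (q, p) *\<^sub>C 1)
        + (\<Sum>r<n k. a' $$ (r, p) *\<^sub>C ((if r = q then b else 0) - a $$ (q, r) *\<^sub>C 1))"
      unfolding diag_mult[OF T(2) pq] tscalar_mult[OF T(1) pq]
      using pq by (simp add: defect_def)
    also have "(\<Sum>r<n k. a' $$ (r, p) *\<^sub>C ((if r = q then b else 0) - a $$ (q, r) *\<^sub>C 1))
        = (\<Sum>r<n k. (if r = q then a' $$ (q, p) *\<^sub>C b else 0) - (a $$ (q, r) * a' $$ (r, p)) *\<^sub>C 1)"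
      by (intro sum.cong refl)
         (auto simp: scaleC.scale_right_diff_distrib scaleC_scaleC mult.commute)
    also have "\<dots> = a' $$ (q, p) *\<^sub>C b - (\<Sum>r<n k. a $$ (q, r) * a' $$ (r, p)) *\<^sub>C 1"
      using pq by (simp add: sum_subtractf scaleC.scale_sum_left)
    also have "(\<Sum>r<n k. a $$ (q, r) * a' $$ (r, p)) = (a * a') $$ (q, p)"
      by (rule index_mult_mat_sum[OF a(1) a'(1) pq(2,1), symmetric])
    also have "b * ((if p = q then b' else 0) - a' $$ (q, p) *\<^sub>C 1) + (a' $$ (q, p) *\<^sub>C b - (a * a') $$ (q, p) *\<^sub>C 1)
        = (if p = q then b * b' else 0) - (a * a') $$ (q, p) *\<^sub>C 1"
      by (simp add: right_diff_distrib)
    also have "\<dots> = defect k (a * a') (b * b') $$ (p, q)"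
      using pq by (simp add: defect_def del: index_mult_mat)
    finally show "defect k (a * a') (b * b') $$ (p, q)
        = (diag k b * defect k a' b' + tscalar k a' * defect k a b) $$ (p, q)" by simp
  qed (auto simp: defect_def)
  also have "\<dots> \<in> ideal k" using a a' by (intro ideal_add ideal_mult_left) auto
  finally show ?thesis
    unfolding Rel_def using a a'
    by (auto simp: \<iota>_mult intro!: exI[of _ "a * a'"] exI[of _ "b * b'"])
qed

text \<open>The matrix \<open>K = transpose(a) (x) 1\<close> has entries in \<open>S\<close>, its
  entangled value is the trace of \<open>a\<close>, and adding the defect turns its image into the
  diagonal matrix of \<open>b\<close>.\<close>

lemma Rel_trace_le:
  assumes a: "a \<in> carrier_mat (n k) (n k)" and ab: "defect k a b \<in> ideal k"
  shows "cmod (\<Sum>p<n k. a $$ (p, p)) \<le> real (n k) * norm b"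
proof -
  define K where "K = mat (n k) (n k) (\<lambda>(p, q). a $$ (q, p) *\<^sub>C (1 :: 'a))"
  have "entangled k K = (\<Sum>p<n k. \<Sum>q<n k. if q = p then a $$ (p, p) *\<^sub>C E k 0 0 else 0)"
    unfolding entangled_def K_def using n_pos[of k] by (intro sum.cong refl) (auto simp: E_mult)
  then have "entangled k K = (\<Sum>p<n k. a $$ (p, p)) *\<^sub>C E k 0 0"
    by (simp add: scaleC.scale_sum_left)
  then have "cmod (\<Sum>p<n k. a $$ (p, p)) \<le> real (n k) * matrix_norm (map_mat \<phi> K + defect k a b)"
    using ab by (intro entangled_le_mod_ideal) (auto simp: K_def S_scaleC one_in_S)
  also have "map_mat \<phi> K + defect k a b = diag k b"
    by (rule eq_matI) (auto simp: K_def defect_def \<phi>_scaleC one_in_S \<phi>_one)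
  also have "real (n k) * matrix_norm (diag k b) \<le> real (n k) * norm b"
    by (intro mult_left_mono matrix_norm_diag_le) simp
  finally show ?thesis .
qed

section \<open>Words in the unitaries of one level\<close>

inductive_set Q :: "nat \<Rightarrow> ('a \<times> 'b) set" for k where
  unitary: "x \<in> V k \<Longrightarrow> (x, \<phi> x) \<in> Q k"
| scalar: "(c *\<^sub>C 1, c *\<^sub>C 1) \<in> Q k"
| add: "(x, b) \<in> Q k \<Longrightarrow> (x', b') \<in> Q k \<Longrightarrow> (x + x', b + b') \<in> Q k"
| mult: "(x, b) \<in> Q k \<Longrightarrow> (x', b') \<in> Q k \<Longrightarrow> (x * x', b * b') \<in> Q k"

text \<open>Closure under \<open>star\<close> is the reason for keeping words apart from
  \<open>Rel\<close>: the ideal is only a left ideal, so adjoints there are not evidently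
  available.\<close>

lemma Q_star: "(x, b) \<in> Q k \<Longrightarrow> (star x, star b) \<in> Q k"
proof (induction rule: Q.induct)
  case (unitary x)
  then show ?case using Q.unitary[OF star_in_V[OF unitary]] by (simp add: \<phi>_star V_def)
next
  case (scalar c)
  then show ?case using Q.scalar[of "cnj c" k] by simp
qed (auto simp: star_add star_mult intro: Q.intros)

lemma Q_Rel: "(x, b) \<in> Q k \<Longrightarrow> (x, b) \<in> Rel k"
  by (induction rule: Q.induct) (auto intro: Rel_unitary Rel_scalar Rel_add Rel_mult)

text \<open>Words pass to higher levels through their unitaries, so ideals of different levels never
  have to be compared.\<close>

lemma Q_mono: "(x, b) \<in> Q k \<Longrightarrow> k \<le> m \<Longrightarrow> (x, b) \<in> Q m"
  by (induction rule: Q.induct) (use V_mono in \<open>auto intro: Q.intros\<close>)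

lemma Q_scaleC: "(x, b) \<in> Q k \<Longrightarrow> (c *\<^sub>C x, c *\<^sub>C b) \<in> Q k"
  using Q.mult[OF Q.scalar[of c k], of x b] by simp

text \<open>The trace bound for \<open>star x * x\<close> controls the squared Hilbert-Schmidt norm
  of \<open>a\<close> by \<open>N * norm b ^ 2\<close>. Every entry is then at most
  \<open>sqrt N * norm b\<close>, and summing over \<open>N * N\<close> matrix units gives the
  constant, which \<open>norm_le_of_power_bound\<close> removes.\<close>

lemma Q_norm_le:
  assumes "(x, b) \<in> Q k"
  shows "norm x \<le> norm b"
proof (rule norm_le_of_power_bound[of "Q k" "(real (n k))\<^sup>2 * sqrt (real (n k))"])
  fix x b assume xb: "(x, b) \<in> Q k"
  define N where "N = real (n k)"
  obtain a where a: "a \<in> carrier_mat (n k) (n k)" "x = \<iota> k a"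
    using Q_Rel[OF xb] by (auto simp: Rel_def)
  have sa: "mat_star a \<in> carrier_mat (n k) (n k)" using a by (auto simp: mat_star_def)
  have "(star x * x, star b * b) \<in> Rel k" using xb by (intro Q_Rel Q.mult Q_star)
  then obtain a' where a': "a' \<in> carrier_mat (n k) (n k)" "star x * x = \<iota> k a'"
    "defect k a' (star b * b) \<in> ideal k" by (auto simp: Rel_def)
  have "\<iota> k a' = \<iota> k (mat_star a * a)" using a a' sa by (simp add: \<iota>_mult \<iota>_star)
  then have "a' = mat_star a * a" using inj_onD[OF \<iota>_inj] a a' sa by simp
  define H where "H = (\<Sum>p<n k. \<Sum>q<n k. (cmod (a $$ (q, p)))\<^sup>2)"
  have "(\<Sum>p<n k. a' $$ (p, p)) = (\<Sum>p<n k. \<Sum>q<n k. cnj (a $$ (q, p)) * a $$ (q, p))"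
  proof (intro sum.cong refl)
    fix p assume "p \<in> {..<n k}"
    then have p: "p < n k" by simp
    show "a' $$ (p, p) = (\<Sum>q<n k. cnj (a $$ (q, p)) * a $$ (q, p))"
      unfolding \<open>a' = _\<close> index_mult_mat_sum[OF sa a(1) p p]
      using a(1) p by (intro sum.cong) (auto simp: mat_star_def)
  qed
  also have "\<dots> = complex_of_real H"
    by (simp add: H_def complex_norm_square mult.commute flip: of_real_power)
  finally have "cmod (complex_of_real H) \<le> N * norm (star b * b)"
    using Rel_trace_le[OF a'(1,3)] by (simp add: N_def)
  then have HN: "H \<le> N * (norm b)\<^sup>2" by (simp add: norm_star_mult)
  have entry: "cmod (a $$ (i, j)) \<le> sqrt N * norm b" if "i < n k" "j < n k" for i j
  proof -
    have "(cmod (a $$ (i, j)))\<^sup>2 \<le> (\<Sum>q<n k. (cmod (a $$ (q, j)))\<^sup>2)"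
      using that by (intro member_le_sum) auto
    also have "\<dots> \<le> H"
      unfolding H_def using that by (intro member_le_sum[of j _ "\<lambda>p. \<Sum>q<n k. (cmod (a $$ (q, p)))\<^sup>2"]) (auto intro: sum_nonneg)
    finally have "(cmod (a $$ (i, j)))\<^sup>2 \<le> (sqrt N * norm b)\<^sup>2"
      using HN by (simp add: power_mult_distrib N_def)
    then show ?thesis by (rule power2_le_imp_le) (simp add: N_def)
  qed
  have "norm x \<le> (\<Sum>i\<in>{..<n k}. \<Sum>j\<in>{..<n k}. sqrt N * norm b)"
    unfolding a(2) \<iota>_expand[OF a(1)]
  proof (rule sum_norm_le, rule sum_norm_le)
    fix i j assume "i \<in> {..<n k}" "j \<in> {..<n k}"
    then show "norm (a $$ (i, j) *\<^sub>C E k i j) \<le> sqrt N * norm b"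
      using entry by (simp add: norm_scaleC norm_E)
  qed
  then show "norm x \<le> (real (n k))\<^sup>2 * sqrt (real (n k)) * norm b"
    by (simp add: N_def power2_eq_square)
qed (auto intro: Q.mult Q_star assms)

section \<open>Closure of the relation and the homomorphism\<close>

definition graph :: "('a \<times> 'b) set" where
  "graph = closure (\<Union>k. Q k)"

lemma Q_common:
  assumes "p \<in> (\<Union>k. Q k)" "q \<in> (\<Union>k. Q k)"
  obtains m where "p \<in> Q m" "q \<in> Q m"
proof -
  obtain k k' where "p \<in> Q k" "q \<in> Q k'" using assms by auto
  then show thesis using that[of "max k k'"] Q_mono
    by (metis max.cobounded1 max.cobounded2 prod.collapse)
qed

text \<open>Two pairs of words can be moved to a common level, so closure of each \<open>Q k\<close>
  under the operation suffices on the union; continuity carries it to the closure. A unary operation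
  is covered by repeating its argument.\<close>

lemma graph_binary:
  assumes pq: "p \<in> graph" "q \<in> graph"
    and cont: "continuous_on UNIV f"
    and closed: "\<And>k x b y c. (x, b) \<in> Q k \<Longrightarrow> (y, c) \<in> Q k \<Longrightarrow> f ((x, b), (y, c)) \<in> Q k"
  shows "f (p, q) \<in> graph"
proof -
  let ?U = "\<Union>k. Q k"
  have "f ` closure (?U \<times> ?U) \<subseteq> closure ?U"
  proof (rule image_closure_subset)
    show "f ` (?U \<times> ?U) \<subseteq> closure ?U"
    proof (rule image_subsetI)
      fix r assume "r \<in> ?U \<times> ?U"
      then have "fst r \<in> ?U" "snd r \<in> ?U" by (simp_all only: mem_Times_iff)
      then obtain m where "fst r \<in> Q m" "snd r \<in> Q m" by (rule Q_common)
      then have "f r \<in> Q m"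
        using closed[of "fst (fst r)" "snd (fst r)" m "fst (snd r)" "snd (snd r)"] by simp
      then show "f r \<in> closure ?U" by (intro subsetD[OF closure_subset]) blast
    qed
  qed (use cont continuous_on_subset in auto)
  then show ?thesis using pq by (auto simp: graph_def closure_Times)
qed

lemma graph_add: "(x, b) \<in> graph \<Longrightarrow> (x', b') \<in> graph \<Longrightarrow> (x + x', b + b') \<in> graph"
  using graph_binary[of "(x, b)" "(x', b')" "\<lambda>r. (fst (fst r) + fst (snd r), snd (fst r) + snd (snd r))"]
  by (simp add: Q.add continuous_intros)

lemma graph_mult: "(x, b) \<in> graph \<Longrightarrow> (x', b') \<in> graph \<Longrightarrow> (x * x', b * b') \<in> graph"
  using graph_binary[of "(x, b)" "(x', b')" "\<lambda>r. (fst (fst r) * fst (snd r), snd (fst r) * snd (snd r))"]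
  by (simp add: Q.mult continuous_intros)

lemma graph_scalar: "(c *\<^sub>C 1, c *\<^sub>C 1) \<in> graph"
  unfolding graph_def by (rule subsetD[OF closure_subset]) (use Q.scalar in blast)

lemma graph_scaleC: "(x, b) \<in> graph \<Longrightarrow> (c *\<^sub>C x, c *\<^sub>C b) \<in> graph"
  using graph_mult[OF graph_scalar[of c], of x b] by simp

lemma graph_diff: "(x, b) \<in> graph \<Longrightarrow> (x', b') \<in> graph \<Longrightarrow> (x - x', b - b') \<in> graph"
  using graph_add[of x b "(-1) *\<^sub>C x'" "(-1) *\<^sub>C b'"] graph_scaleC[of x' b' "-1"]
  by (simp add: scaleC.scale_minus_left)

lemma graph_star: "(x, b) \<in> graph \<Longrightarrow> (star x, star b) \<in> graph"
  using graph_binary[of "(x, b)" "(x, b)" "\<lambda>r. (star (fst (fst r)), star (snd (fst r)))"]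
  by (simp add: Q_star continuous_intros bounded_linear.continuous_on[OF bounded_linear_star])

lemma graph_norm_le: "(x, b) \<in> graph \<Longrightarrow> norm x \<le> norm b"
proof -
  have "closed {p :: 'a \<times> 'b. norm (fst p) \<le> norm (snd p)}"
    by (intro closed_Collect_le continuous_intros)
  moreover have "(\<Union>k. Q k) \<subseteq> {p. norm (fst p) \<le> norm (snd p)}"
    using Q_norm_le by auto
  ultimately have "graph \<subseteq> {p. norm (fst p) \<le> norm (snd p)}"
    unfolding graph_def by (rule closure_minimal[rotated])
  then show "(x, b) \<in> graph \<Longrightarrow> norm x \<le> norm b" by auto
qed

lemma graph_unique: "(x, b) \<in> graph \<Longrightarrow> (x', b) \<in> graph \<Longrightarrow> x = x'"
  using graph_norm_le[of "x - x'" 0] graph_diff[of x b x' b] by simp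

text \<open>The elements of \<open>S\<close> whose pair with their image is a word pair form a
  subspace. It contains the unitaries in \<open>V m\<close>, and every matrix unit in
  \<open>S\<close> is a combination of reflections, swaps and 1.\<close>

lemma Q_span_units:
  assumes "t \<in> scaleC.span (units m)"
  shows "t \<in> S" "(t, \<phi> t) \<in> Q m"
proof -
  let ?T = "{x \<in> S. (x, \<phi> x) \<in> Q m}"
  have sub: "scaleC.subspace ?T"
  proof (rule scaleC.subspaceI)
    show "0 \<in> ?T" using Q.scalar[of 0 m] by (simp add: S_0 \<phi>_0)
  qed (auto simp: S_add \<phi>_add S_scaleC \<phi>_scaleC intro: Q.add Q_scaleC)
  have V: "x \<in> ?T" if "x \<in> V m" for x using that Q.unitary by (auto simp: V_def)
  have one: "1 \<in> ?T" using Q.scalar[of 1 m] by (simp add: one_in_S \<phi>_one)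
  have diag: "E m p p \<in> ?T" if "p < n m" for p
  proof -
    have "E m p p = (1/2) *\<^sub>C (1 - (1 - 2 *\<^sub>C E m p p))" by (simp add: scaleC_scaleC)
    moreover have "(1/2) *\<^sub>C (1 - (1 - 2 *\<^sub>C E m p p)) \<in> ?T"
      by (intro scaleC.subspace_scale[OF sub] scaleC.subspace_diff[OF sub] one V reflection_in_V that)
    ultimately show ?thesis by simp
  qed
  have "units m \<subseteq> ?T"
  proof
    fix x assume "x \<in> units m"
    then obtain p q where x: "x = E m p q" "p < n m" "q < n m" "E m p q \<in> S" by (auto simp: units_def)
    show "x \<in> ?T"
    proof (cases "p = q")
      case False
      show ?thesis
        unfolding x(1) matrix_unit_eq_swap_unitaries[of m p q]
        by (intro scaleC.subspace_scale[OF sub] scaleC.subspace_add[OF sub] one V diag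
            swap_unitary_in_V x False) auto
    qed (use x diag in simp)
  qed
  then have "scaleC.span (units m) \<subseteq> ?T" using sub by (rule scaleC.span_minimal)
  then show "t \<in> S" "(t, \<phi> t) \<in> Q m" using assms by auto
qed

lemma graph_system: "s \<in> S \<Longrightarrow> (s, \<phi> s) \<in> graph"
  unfolding graph_def closure_approachable
proof (intro allI impI)
  fix e :: real assume s: "s \<in> S" and e: "0 < e"
  obtain m t where t: "t \<in> scaleC.span (units m)" "norm (s - t) < e / 2"
    using span_units_dense[OF s, of "e / 2"] e by (metis half_gt_zero)
  note Q = Q_span_units[OF t(1)]
  have "norm (\<phi> s - \<phi> t) = norm (s - t)"
    using norm_\<phi>[OF S_diff[OF s Q(1)]] \<phi>_diff[OF s Q(1)] by simp
  then have "dist (t, \<phi> t) (s, \<phi> s) \<le> norm (s - t) + norm (s - t)"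
    unfolding dist_Pair_Pair using sqrt_sum_squares_le_sum_abs[of "dist t s" "dist (\<phi> t) (\<phi> s)"]
    by (simp add: dist_norm norm_minus_commute)
  then show "\<exists>y\<in>\<Union>k. Q k. dist y (s, \<phi> s) < e" using t Q by (intro bexI[of _ "(t, \<phi> t)"]) auto
qed

text \<open>Closedness is the substantial point. By \<open>graph_norm_le\<close>, convergence of
  second coordinates forces the first coordinates to be Cauchy, so the limit pair exists and lies in
  the closed relation.\<close>

lemma cstar_subalgebra_graph_range: "cstar_subalgebra {b. \<exists>x. (x, b) \<in> graph}"
  unfolding cstar_subalgebra_def csubspace_def
proof (intro conjI)
  let ?D = "{b. \<exists>x. (x, b) \<in> graph}"
  show "0 \<in> ?D" using graph_scalar[of 0] by auto
  show "\<forall>x\<in>?D. \<forall>y\<in>?D. x + y \<in> ?D" using graph_add by blast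
  show "\<forall>c. \<forall>x\<in>?D. c *\<^sub>C x \<in> ?D" using graph_scaleC by blast
  show "\<forall>x\<in>?D. \<forall>y\<in>?D. x * y \<in> ?D" using graph_mult by blast
  show "\<forall>x\<in>?D. star x \<in> ?D" using graph_star by blast
  show "closed ?D"
    unfolding closed_sequential_limits
  proof (intro allI impI, elim conjE)
    fix b l assume b: "\<forall>i. b i \<in> ?D" "b \<longlonglongrightarrow> l"
    then have "\<forall>i. \<exists>x. (x, b i) \<in> graph" by simp
    from choice[OF this] obtain x where x: "\<And>i. (x i, b i) \<in> graph" by blast
    have "Cauchy x"
    proof (rule metric_CauchyI)
      fix e :: real assume "0 < e"
      then obtain M where M: "\<forall>m\<ge>M. \<forall>n\<ge>M. dist (b m) (b n) < e"
        using LIMSEQ_imp_Cauchy[OF b(2)] by (auto simp: Cauchy_def)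
      have "dist (x m) (x n) \<le> dist (b m) (b n)" for m n
        unfolding dist_norm by (intro graph_norm_le graph_diff x)
      then show "\<exists>M. \<forall>m\<ge>M. \<forall>n\<ge>M. dist (x m) (x n) < e"
        using M by (meson le_less_trans)
    qed
    then obtain y where "x \<longlonglongrightarrow> y" using Cauchy_convergent unfolding convergent_def by blast
    then have lim: "(\<lambda>i. (x i, b i)) \<longlonglongrightarrow> (y, l)" using b(2) by (rule tendsto_Pair)
    have "closed graph" by (simp add: graph_def)
    then have "(y, l) \<in> graph" by (rule closed_sequentially[OF _ x lim])
    then show "l \<in> ?D" by auto
  qed
qed

lemma graph_subset_generated: "(x, b) \<in> graph \<Longrightarrow> x \<in> cstar_generated S"
proof -
  let ?G = "cstar_generated S"
  have G: "closed ?G" "\<And>x y. x \<in> ?G \<Longrightarrow> y \<in> ?G \<Longrightarrow> x + y \<in> ?G \<and> x * y \<in> ?G"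
    "\<And>c x. x \<in> ?G \<Longrightarrow> c *\<^sub>C x \<in> ?G"
    using cstar_subalgebra_generated[of S] by (auto simp: cstar_subalgebra_def csubspace_def)
  have "x \<in> ?G" if "(x, b) \<in> Q k" for x b k
    using that
  proof (induction rule: Q.induct)
    case (unitary x)
    then show ?case using generated_superset by (auto simp: V_def)
  next
    case (scalar c)
    then show ?case using generated_superset[of S] one_in_S G(3) by blast
  qed (use G in auto)
  then have "(\<Union>k. Q k) \<subseteq> ?G \<times> UNIV" by auto
  then have "graph \<subseteq> ?G \<times> UNIV"
    unfolding graph_def by (rule closure_minimal) (intro closed_Times G closed_UNIV)
  then show "(x, b) \<in> graph \<Longrightarrow> x \<in> ?G" by auto
qed

lemma envelope_map:
  "\<exists>\<pi>. star_homomorphism B (cstar_generated S) \<pi> \<and> (\<forall>s\<in>S. \<pi> (\<phi> s) = s)"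
proof -
  define \<pi> where "\<pi> b = (THE x. (x, b) \<in> graph)" for b
  have \<pi>_eq: "\<pi> b = x" if "(x, b) \<in> graph" for x b
    unfolding \<pi>_def using that graph_unique by blast
  \<comment> \<open>The second coordinates form a C*-subalgebra containing the image of
    \<open>S\<close>, so they exhaust the cover; thus the description defining \<open>\<pi>\<close>
    denotes on all of \<open>B\<close>.\<close>
  have "cstar_generated (\<phi> ` S) \<subseteq> {b. \<exists>x. (x, b) \<in> graph}"
    unfolding cstar_generated_def using cstar_subalgebra_graph_range graph_system
    by (intro Inter_lower) auto
  then have "\<exists>x. (x, b) \<in> graph" if "b \<in> B" for b
    using that cover by (auto simp: cstar_cover_def)
  then have \<pi>: "(\<pi> b, b) \<in> graph" if "b \<in> B" for b using that \<pi>_eq by metis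
  have "star_homomorphism B (cstar_generated S) \<pi>"
    unfolding star_homomorphism_def clinear_on_def
    using \<pi> by (auto intro!: \<pi>_eq graph_add graph_scaleC graph_mult graph_star graph_subset_generated)
  then show ?thesis using \<pi>_eq graph_system by blast
qed

end

theorem theorem6p8:
  fixes n :: "nat \<Rightarrow> nat"
    and \<iota> :: "nat \<Rightarrow> complex mat \<Rightarrow> 'a::unital_cstar_algebra"
    and S :: "'a set"
  assumes "uhf_algebra n \<iota>"
    and "concrete_operator_system_over (canonical_masa n \<iota>) S"
  shows "cstar_envelope TYPE('b::unital_cstar_algebra) S (cstar_generated S) (\<lambda>s. s)"
  unfolding cstar_envelope_def
proof (intro conjI allI impI)
  interpret uhf_system n \<iota> S using assms by unfold_locales
  have "map_mat (\<lambda>s. s) X = X" for X :: "'a mat" by auto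
  then show "cstar_cover S (cstar_generated S) (\<lambda>s. s)"
    using generated_superset[of S] one_in_S
    by (auto simp: cstar_cover_def cstar_subalgebra_generated clinear_on_def completely_isometric_on_def)
  fix B :: "'b set" and \<phi> assume "cstar_cover S B \<phi>"
  then interpret uhf_system_cover n \<iota> S B \<phi> by unfold_locales
  show "\<exists>\<pi>. star_homomorphism B (cstar_generated S) \<pi> \<and> (\<forall>s\<in>S. \<pi> (\<phi> s) = s)"
    by (rule envelope_map)
qed

end
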